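(* Let $\alpha>-1$ and $\alpha+\beta>-1/2$. Then, for each $t>0$, the operators $\mathcal{M}_t^{\alpha,\beta}$ and $M_t^{\alpha,\beta}$ coincide on $L^2(d\mu_\alpha)$.
   Context: $J_\nu$ is the Bessel function of the first kind of order $\nu$, and $d\mu_\alpha(y)=y^{2\alpha+1}dy$ on $\mathbb{R}_+=(0,\infty)$; $L^2(d\mu_\alpha)=L^2(\mathbb{R}_+,d\mu_\alpha)$. For $\alpha>-1$ the (modified) Hankel transform is $\mathcal{H}_\alpha f(x)=\int_0^\infty f(y)\frac{J_\alpha(xy)}{(xy)^\alpha}\,d\mu_\alpha(y)$ for suitable $f$; it extends to an isometry of $L^2(d\mu_\alpha)$ with $\mathcal{H}_\alpha^{-1}=\mathcal{H}_\alpha$. For $t>0$, $\mathcal{M}_t^{\alpha,\beta}f=\mathcal{H}_\alpha\big(m_{\alpha,\beta}(t\,\cdot)\mathcal{H}_\alpha f\big)$, $f\in L^2(d\mu_\alpha)$, where $m_{\alpha,\beta}(s)=2^{\alpha+\beta}\Gamma(\alpha+\beta+1)\frac{J_{\alpha+\beta}(s)}{s^{\alpha+\beta}}$, $s>0$ (a bounded function when $\alpha+\beta\ge-1/2$). For $t,x,z>0$ with $t\ne|x-z|$, $t\neq x+z$, $$K_t^{\alpha,\beta}(x,z)=2^{\alpha+\beta}\Gamma(\alpha+\beta+1)\int_0^\infty \frac{J_{\alpha+\beta}(ty)}{(ty)^{\alpha+\beta}}\frac{J_\alpha(xy)}{(xy)^\alpha}\frac{J_\alpha(zy)}{(zy)^\alpha}\,d\mu_\alpha(y)$$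 (absolutely convergent if $\alpha+\beta>1/2$, otherwise an improper Riemann integral at $\infty$). The integral operator is $M_t^{\alpha,\beta}f(x)=\int_0^\infty K_t^{\alpha,\beta}(x,z)f(z)\,d\mu_\alpha(z)$, defined on the set of all $f$ for which this integral converges absolutely for a.a. $x>0$. *)

theory Defs
  imports "HOL-Analysis.Analysis"
begin

text \<open>
  Bessel function of the first kind, for real order and argument \<open>x > 0\<close>, by its power series.
  The entire function \<open>rGamma = 1 / Gamma\<close> makes the terms at poles of \<open>Gamma\<close> vanish.
\<close>

definition bessel_J :: "real \<Rightarrow> real \<Rightarrow> real" where
  "bessel_J \<nu> x =
     (\<Sum>k. (-1) ^ k * rGamma (real k + \<nu> + 1) / fact k * (x / 2) powr (2 * real k + \<nu>))"

definition bessel_quot :: "real \<Rightarrow> real \<Rightarrow> real" where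
  "bessel_quot \<nu> s = bessel_J \<nu> s / s powr \<nu>"

definition \<mu> :: "real \<Rightarrow> real measure" where
  "\<mu> \<alpha> = density (restrict_space lborel {0<..}) (\<lambda>y. ennreal (y powr (2 * \<alpha> + 1)))"

text \<open>
  Elements of \<open>L\<^sup>2(d\<mu>\<^sub>\<alpha>)\<close> are represented by functions rather than by classes modulo null sets,
  so equality of elements is equality almost everywhere. Since the density is positive, the
  null sets of \<open>\<mu> \<alpha>\<close> are the Lebesgue null sets of the half-line.
\<close>

definition L2 :: "real \<Rightarrow> (real \<Rightarrow> complex) set" where
  "L2 \<alpha> = {f \<in> borel_measurable (\<mu> \<alpha>). integrable (\<mu> \<alpha>) (\<lambda>y. (cmod (f y))\<^sup>2)}"

definition L2_norm :: "real \<Rightarrow> (real \<Rightarrow> complex) \<Rightarrow> real" where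
  "L2_norm \<alpha> f = sqrt (LINT y|\<mu> \<alpha>. (cmod (f y))\<^sup>2)"

definition hankel_integrand :: "real \<Rightarrow> (real \<Rightarrow> complex) \<Rightarrow> real \<Rightarrow> real \<Rightarrow> complex" where
  "hankel_integrand \<alpha> f x y = f y * complex_of_real (bessel_quot \<alpha> (x * y))"

definition hankel_integral :: "real \<Rightarrow> (real \<Rightarrow> complex) \<Rightarrow> real \<Rightarrow> complex" where
  "hankel_integral \<alpha> f x = (LINT y|\<mu> \<alpha>. hankel_integrand \<alpha> f x y)"

text \<open>
  \<open>T\<close> is an isometry of \<open>L\<^sup>2(d\<mu>\<^sub>\<alpha>)\<close> that agrees with the Hankel integral on every \<open>f\<close> in \<open>L\<^sup>2\<close> for
  which this integral converges absolutely almost everywhere. This class of \<open>f\<close> contains all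
  square integrable functions vanishing outside a compact subset of \<open>(0,\<infinity>)\<close> and so is dense;
  hence \<open>T f\<close> is determined almost everywhere, and \<open>T\<close> is linear modulo null sets.
\<close>

definition isometric_hankel_extension ::
  "real \<Rightarrow> ((real \<Rightarrow> complex) \<Rightarrow> real \<Rightarrow> complex) \<Rightarrow> bool" where
  "isometric_hankel_extension \<alpha> T \<longleftrightarrow>
     (\<forall>f \<in> L2 \<alpha>. T f \<in> L2 \<alpha>) \<and>
     (\<forall>f \<in> L2 \<alpha>. \<forall>g \<in> L2 \<alpha>.
        L2_norm \<alpha> (\<lambda>x. T f x - T g x) = L2_norm \<alpha> (\<lambda>x. f x - g x)) \<and>
     (\<forall>f \<in> L2 \<alpha>. (AE x in \<mu> \<alpha>. integrable (\<mu> \<alpha>) (hankel_integrand \<alpha> f x)) \<longrightarrow>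
        (AE x in \<mu> \<alpha>. T f x = hankel_integral \<alpha> f x))"

definition hankel :: "real \<Rightarrow> (real \<Rightarrow> complex) \<Rightarrow> real \<Rightarrow> complex" where
  "hankel \<alpha> = (SOME T. isometric_hankel_extension \<alpha> T)"

definition multiplier :: "real \<Rightarrow> real \<Rightarrow> real \<Rightarrow> real" where
  "multiplier \<alpha> \<beta> s = 2 powr (\<alpha> + \<beta>) * Gamma (\<alpha> + \<beta> + 1) * bessel_quot (\<alpha> + \<beta>) s"

definition multiplier_op ::
  "real \<Rightarrow> real \<Rightarrow> real \<Rightarrow> (real \<Rightarrow> complex) \<Rightarrow> real \<Rightarrow> complex" where
  "multiplier_op \<alpha> \<beta> t f =
     hankel \<alpha> (\<lambda>y. complex_of_real (multiplier \<alpha> \<beta> (t * y)) * hankel \<alpha> f y)"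

text \<open>
  The integral over \<open>(0,\<infinity>)\<close> is the limit of the integrals over \<open>(0,R)\<close>: an improper integral
  at infinity, which agrees with the Lebesgue integral whenever the latter converges absolutely.
  The kernel is meaningful for \<open>t, x, z > 0\<close> with \<open>t \<noteq> \<bar>x - z\<bar>\<close> and \<open>t \<noteq> x + z\<close>; for fixed
  \<open>t, x\<close> the excluded \<open>z\<close> form a finite set.
\<close>

definition kernel :: "real \<Rightarrow> real \<Rightarrow> real \<Rightarrow> real \<Rightarrow> real \<Rightarrow> real" where
  "kernel \<alpha> \<beta> t x z =
     2 powr (\<alpha> + \<beta>) * Gamma (\<alpha> + \<beta> + 1) *
     Lim at_top (\<lambda>R. LINT y:{0<..<R}|\<mu> \<alpha>.
       bessel_quot (\<alpha> + \<beta>) (t * y) * bessel_quot \<alpha> (x * y) * bessel_quot \<alpha> (z * y))"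

definition kernel_op_domain :: "real \<Rightarrow> real \<Rightarrow> real \<Rightarrow> (real \<Rightarrow> complex) set" where
  "kernel_op_domain \<alpha> \<beta> t =
     {f. AE x in \<mu> \<alpha>. integrable (\<mu> \<alpha>) (\<lambda>z. complex_of_real (kernel \<alpha> \<beta> t x z) * f z)}"

definition kernel_op ::
  "real \<Rightarrow> real \<Rightarrow> real \<Rightarrow> (real \<Rightarrow> complex) \<Rightarrow> real \<Rightarrow> complex" where
  "kernel_op \<alpha> \<beta> t f x = (LINT z|\<mu> \<alpha>. complex_of_real (kernel \<alpha> \<beta> t x z) * f z)"

end

theory Submission
  imports Defs "HOL-Computational_Algebra.Polynomial"
begin

text \<open>
  Write \<open>\<phi>\<^sub>\<nu>(s) = J\<^sub>\<nu>(s) / s\<^sup>\<nu>\<close> and \<open>\<nu> = \<alpha> + \<beta>\<close>. The Hankel transform maps a Gaussian to a Gaussian and preserves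
  the inner products of Gaussians; since these span a dense subspace (Weierstrass, in the variable
  \<open>exp(-y\<^sup>2)\<close>), it extends to an isometry \<open>H\<close> of \<open>L\<^sup>2\<close>.

  Let \<open>K\<^sub>n(x,z)\<close> be the kernel integral taken over \<open>(0,n)\<close> only. By Fubini and the symmetry of \<open>H\<close>, the integral of
  \<open>K\<^sub>n(x,\<cdot>) f\<close> is the value at \<open>x\<close> of \<open>H\<close> applied to \<open>m(t\<cdot>) Hf\<close> cut off at \<open>n\<close>, which tends in \<open>L\<^sup>2\<close> to the
  multiplier operator. It remains to pass to the limit under the integral for almost every fixed \<open>x\<close>. Replace
  \<open>\<phi>\<^sub>\<nu>(ty) \<phi>\<^sub>\<alpha>(xy)\<close> by its leading asymptotic term, two cosines times a power of \<open>y\<close>. The error is in \<open>L\<^sup>2\<close>, so the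
  isometry takes care of it. For the leading term, integration by parts bounds the truncated kernels uniformly
  in \<open>n\<close> by an \<open>L\<^sup>2\<close> function of \<open>z\<close> plus singularities \<open>\<bar>z \<plusminus> x \<plusminus> t\<bar>\<^sup>\<delta>\<^sup>-\<^sup>1\<close>. The latter are integrable against \<open>f\<close> for almost
  every \<open>x\<close>, by Tonelli, because \<open>\<delta> > 0\<close>; this is where \<open>\<alpha> + \<beta> > -1/2\<close> enters.
\<close>

section \<open>Square integrable functions\<close>

text \<open>\<open>hankel\<close> is a Hilbert choice, so nothing is known about it until an
  isometric extension has been built, and its specification asks for agreement with the Hankel
  integral wherever that converges, not only on a dense class. Functions of bounded support carry
  the construction, because for \<alpha> < -1/2 the available bound
  \<open>s powr (- \<alpha> - 1/2)\<close> on \<open>bessel_quot \<alpha>\<close> grows at infinity.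
  The obstacle afterwards: the three Bessel factors and the density are together only of size
  \<open>y powr (- \<alpha> - \<beta> - 1/2)\<close>, so for \<alpha> + \<beta> \<le> 1/2 the
  truncated kernels converge by oscillation alone. Their singular bounds, with exponent \<delta> - 1
  and \<delta> \<le> 1/2, are not square integrable, so Cauchy-Schwarz in z does not apply and only
  almost every x is reached. The factor \<open>bessel_quot \<alpha> (z * y)\<close> is deliberately
  left unexpanded when the leading term is split off: the remainder then contributes the Hankel
  transform of a function of y, and the isometry controls it without any estimate in z.\<close>

definition sq_integrable :: "'a measure \<Rightarrow> ('a \<Rightarrow> complex) set" where
  "sq_integrable M = {f \<in> borel_measurable M. integrable M (\<lambda>y. (cmod (f y))\<^sup>2)}"

definition sq_norm :: "'a measure \<Rightarrow> ('a \<Rightarrow> complex) \<Rightarrow> real" where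
  "sq_norm M f = sqrt (LINT y|M. (cmod (f y))\<^sup>2)"

lemma sq_integrable_measurable [measurable_dest]:
  "f \<in> sq_integrable M \<Longrightarrow> f \<in> borel_measurable M"
  by (simp add: sq_integrable_def)

lemma sq_integrableD:
  "f \<in> sq_integrable M \<Longrightarrow> integrable M (\<lambda>y. (cmod (f y))\<^sup>2)"
  by (simp add: sq_integrable_def)

lemma sq_integrable_bound:
  assumes "f \<in> borel_measurable M" "integrable M g" "AE x in M. (cmod (f x))\<^sup>2 \<le> g x"
  shows "f \<in> sq_integrable M"
  unfolding sq_integrable_def using assms
  by (auto intro!: Bochner_Integration.integrable_bound[of M g] elim!: eventually_mono)

lemma sq_norm_nonneg [simp]: "sq_norm M f \<ge> 0"
  by (simp add: sq_norm_def)

lemma sq_norm_power2: "(sq_norm M f)\<^sup>2 = (LINT y|M. (cmod (f y))\<^sup>2)"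
  by (simp add: sq_norm_def)

lemma sq_norm_cong_AE:
  assumes "AE x in M. f x = g x" "f \<in> borel_measurable M" "g \<in> borel_measurable M"
  shows "sq_norm M f = sq_norm M g"
  unfolding sq_norm_def using assms by (intro arg_cong[where f=sqrt] integral_cong_AE) auto

lemma sq_norm_mono:
  assumes "f \<in> borel_measurable M" "g \<in> sq_integrable M" "AE x in M. cmod (f x) \<le> cmod (g x)"
  shows "sq_norm M f \<le> sq_norm M g"
  unfolding sq_norm_def real_sqrt_le_iff
  using assms sq_integrableD[OF assms(2)]
  by (intro integral_mono_AE Bochner_Integration.integrable_bound[of M "\<lambda>x. (cmod (g x))\<^sup>2" "\<lambda>x. (cmod (f x))\<^sup>2"])
     (auto elim!: eventually_mono intro: power_mono)

lemma sq_integrable_add: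
  assumes "f \<in> sq_integrable M" "g \<in> sq_integrable M"
  shows "(\<lambda>x. f x + g x) \<in> sq_integrable M"
proof (rule sq_integrable_bound)
  show "integrable M (\<lambda>x. 2 * (cmod (f x))\<^sup>2 + 2 * (cmod (g x))\<^sup>2)"
    by (intro Bochner_Integration.integrable_add integrable_mult_right sq_integrableD assms)
  have "(cmod (a + b))\<^sup>2 \<le> 2 * (cmod a)\<^sup>2 + 2 * (cmod b)\<^sup>2" for a b
  proof -
    have "(cmod (a + b))\<^sup>2 \<le> (cmod a + cmod b)\<^sup>2"
      by (intro power_mono norm_triangle_ineq) auto
    also have "\<dots> \<le> 2 * (cmod a)\<^sup>2 + 2 * (cmod b)\<^sup>2"
      using sum_squares_bound[of "cmod a" "cmod b"] by (simp add: power2_sum)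
    finally show ?thesis .
  qed
  then show "AE x in M. (cmod (f x + g x))\<^sup>2 \<le> 2 * (cmod (f x))\<^sup>2 + 2 * (cmod (g x))\<^sup>2"
    by auto
qed (use assms in \<open>auto intro: sq_integrable_measurable\<close>)

lemma sq_integrable_mult_bounded:
  assumes "f \<in> sq_integrable M" "m \<in> borel_measurable M" "\<And>x. x \<in> space M \<Longrightarrow> cmod (m x) \<le> B"
  shows "(\<lambda>x. m x * f x) \<in> sq_integrable M"
proof (rule sq_integrable_bound)
  show "integrable M (\<lambda>x. B\<^sup>2 * (cmod (f x))\<^sup>2)"
    using assms by (auto dest: sq_integrableD)
  show "AE x in M. (cmod (m x * f x))\<^sup>2 \<le> B\<^sup>2 * (cmod (f x))\<^sup>2"
    using assms(3) by (auto simp: norm_mult power_mult_distrib intro!: AE_I2 mult_right_mono power_mono)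
qed (use assms in \<open>auto intro: sq_integrable_measurable borel_measurable_times\<close>)

lemma sq_integrable_cmult:
  "f \<in> sq_integrable M \<Longrightarrow> (\<lambda>x. c * f x) \<in> sq_integrable M"
  by (rule sq_integrable_mult_bounded[where B="cmod c"]) auto

lemma sq_integrable_diff:
  assumes "f \<in> sq_integrable M" "g \<in> sq_integrable M"
  shows "(\<lambda>x. f x - g x) \<in> sq_integrable M"
  using sq_integrable_add[OF assms(1) sq_integrable_cmult[OF assms(2), of "-1"]] by simp

lemma sq_integrable_mult_integrable:
  assumes "f \<in> sq_integrable M" "g \<in> sq_integrable M"
  shows "integrable M (\<lambda>x. f x * g x)"
proof (rule Bochner_Integration.integrable_bound)
  show "integrable M (\<lambda>x. (cmod (f x))\<^sup>2 + (cmod (g x))\<^sup>2)"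
    using assms by (auto dest: sq_integrableD)
  have "a * b \<le> a\<^sup>2 + b\<^sup>2" for a b :: real
    using sum_squares_bound[of a b] zero_le_power2[of a] zero_le_power2[of b] by linarith
  then show "AE x in M. norm (f x * g x) \<le> norm ((cmod (f x))\<^sup>2 + (cmod (g x))\<^sup>2)"
    by (auto simp: norm_mult)
qed (use assms in \<open>auto intro!: borel_measurable_times sq_integrable_measurable\<close>)

text \<open>Cauchy-Schwarz by the discriminant argument: expanding
  \<open>(c * cmod (f x) - cmod (g x))\<^sup>2 \<ge> 0\<close> bounds \<open>2 * c * I\<close> for
  every real c. If a = 0, a large c forces \<open>I \<le> 0\<close>; otherwise the optimal
  \<open>c = I / a\<^sup>2\<close> gives the claim.\<close>

lemma integral_norm_mult_le:
  assumes f: "f \<in> sq_integrable M" and g: "g \<in> sq_integrable M"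
  shows "(LINT x|M. cmod (f x) * cmod (g x)) \<le> sq_norm M f * sq_norm M g"
proof -
  define a where "a = sq_norm M f"
  define b where "b = sq_norm M g"
  define I where "I = (LINT x|M. cmod (f x) * cmod (g x))"
  have int: "integrable M (\<lambda>x. cmod (f x) * cmod (g x))"
    using integrable_norm[OF sq_integrable_mult_integrable[OF f g]] by (simp add: norm_mult)
  have ineq: "2 * c * I \<le> c\<^sup>2 * a\<^sup>2 + b\<^sup>2" for c
  proof -
    have "2 * c * I = (LINT x|M. 2 * c * (cmod (f x) * cmod (g x)))"
      by (simp add: I_def)
    also have "\<dots> \<le> (LINT x|M. c\<^sup>2 * (cmod (f x))\<^sup>2 + (cmod (g x))\<^sup>2)"
    proof (rule integral_mono)
      show "2 * c * (cmod (f x) * cmod (g x)) \<le> c\<^sup>2 * (cmod (f x))\<^sup>2 + (cmod (g x))\<^sup>2" for x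
        using sum_squares_bound[of "c * cmod (f x)" "cmod (g x)"] by (simp add: power_mult_distrib mult_ac)
    qed (intro Bochner_Integration.integrable_add integrable_mult_right sq_integrableD int f g)+
    also have "\<dots> = c\<^sup>2 * a\<^sup>2 + b\<^sup>2"
      using f g by (simp add: a_def b_def sq_norm_power2 sq_integrableD)
    finally show ?thesis .
  qed
  have a0: "a \<ge> 0" "b \<ge> 0" by (auto simp: a_def b_def)
  have "I \<le> a * b"
  proof (cases "a = 0")
    case True
    have "I \<le> 0"
    proof (rule ccontr)
      assume I: "\<not> I \<le> 0"
      have "2 * ((b\<^sup>2 + 1) / I) * I = 2 * (b\<^sup>2 + 1)" using I by (simp add: divide_simps)
      then have "2 * (b\<^sup>2 + 1) \<le> b\<^sup>2" using ineq[of "(b\<^sup>2 + 1) / I"] True by simp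
      then have "b\<^sup>2 + 2 \<le> 0" by simp
      moreover have "0 < b\<^sup>2 + 2" by (rule add_nonneg_pos) simp_all
      ultimately show False by simp
    qed
    then show ?thesis using True by simp
  next
    case False
    define q where "q = I / a\<^sup>2"
    have I: "I = q * a\<^sup>2" using False by (simp add: q_def)
    have "2 * (q\<^sup>2 * a\<^sup>2) \<le> q\<^sup>2 * a\<^sup>2 + b\<^sup>2"
      using ineq[of q] by (simp add: I power2_eq_square mult_ac)
    then have "q\<^sup>2 * a\<^sup>2 \<le> b\<^sup>2" by (simp add: mult.commute)
    from mult_right_mono[OF this, of "a\<^sup>2"] have "I\<^sup>2 \<le> (a * b)\<^sup>2"
      by (simp add: I power_mult_distrib power2_eq_square[of "a\<^sup>2"] mult_ac)
    then show ?thesis by (rule power2_le_imp_le) (use a0 in simp)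
  qed
  then show ?thesis by (simp add: I_def a_def b_def)
qed

lemma cmod_integral_mult_le:
  assumes "f \<in> sq_integrable M" "g \<in> sq_integrable M"
  shows "cmod (LINT x|M. f x * g x) \<le> sq_norm M f * sq_norm M g"
  using integral_norm_bound[of M "\<lambda>x. f x * g x"] integral_norm_mult_le[OF assms]
  by (simp add: norm_mult)

lemma sq_norm_add_le:
  assumes f: "f \<in> sq_integrable M" and g: "g \<in> sq_integrable M"
  shows "sq_norm M (\<lambda>x. f x + g x) \<le> sq_norm M f + sq_norm M g"
proof (rule power2_le_imp_le)
  have int: "integrable M (\<lambda>x. cmod (f x) * cmod (g x))"
    using integrable_norm[OF sq_integrable_mult_integrable[OF f g]] by (simp add: norm_mult)
  have "(sq_norm M (\<lambda>x. f x + g x))\<^sup>2 = (LINT x|M. (cmod (f x + g x))\<^sup>2)"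
    by (simp add: sq_norm_power2)
  also have "\<dots> \<le> (LINT x|M. (cmod (f x))\<^sup>2 + 2 * (cmod (f x) * cmod (g x)) + (cmod (g x))\<^sup>2)"
  proof (rule integral_mono)
    show "(cmod (f x + g x))\<^sup>2 \<le> (cmod (f x))\<^sup>2 + 2 * (cmod (f x) * cmod (g x)) + (cmod (g x))\<^sup>2" for x
      using power_mono[OF norm_triangle_ineq[of "f x" "g x"], of 2] by (simp add: power2_sum)
  qed (intro Bochner_Integration.integrable_add integrable_mult_right sq_integrableD sq_integrable_add int f g)+
  also have "\<dots> = (sq_norm M f)\<^sup>2 + 2 * (LINT x|M. cmod (f x) * cmod (g x)) + (sq_norm M g)\<^sup>2"
    using f g int by (simp add: sq_norm_power2 sq_integrableD)
  also have "\<dots> \<le> (sq_norm M f + sq_norm M g)\<^sup>2"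
    using integral_norm_mult_le[OF f g] by (simp add: power2_sum)
  finally show "(sq_norm M (\<lambda>x. f x + g x))\<^sup>2 \<le> (sq_norm M f + sq_norm M g)\<^sup>2" .
qed simp

lemma sq_norm_cmult: "sq_norm M (\<lambda>x. c * f x) = cmod c * sq_norm M f"
  by (simp add: sq_norm_def norm_mult power_mult_distrib real_sqrt_mult)

lemma sq_norm_minus_commute: "sq_norm M (\<lambda>x. f x - g x) = sq_norm M (\<lambda>x. g x - f x)"
  by (simp add: sq_norm_def norm_minus_commute)

lemma sq_norm_triangle:
  assumes "f \<in> sq_integrable M" "g \<in> sq_integrable M" "h \<in> sq_integrable M"
  shows "sq_norm M (\<lambda>x. f x - h x) \<le> sq_norm M (\<lambda>x. f x - g x) + sq_norm M (\<lambda>x. g x - h x)"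
  using sq_norm_add_le[OF sq_integrable_diff[OF assms(1,2)] sq_integrable_diff[OF assms(2,3)]] by simp

lemma sq_norm_diff_ge:
  assumes "f \<in> sq_integrable M" "g \<in> sq_integrable M"
  shows "\<bar>sq_norm M f - sq_norm M g\<bar> \<le> sq_norm M (\<lambda>x. f x - g x)"
  using sq_norm_add_le[OF sq_integrable_diff[OF assms] assms(2)]
        sq_norm_add_le[OF sq_integrable_diff[OF assms(2,1)] assms(1)]
        sq_norm_minus_commute[of M f g] by simp

lemma sq_norm_eq_0_AE:
  assumes "f \<in> sq_integrable M" "sq_norm M f = 0"
  shows "AE x in M. f x = 0"
proof -
  have "(LINT y|M. (cmod (f y))\<^sup>2) = 0" using assms(2) by (simp add: sq_norm_def)
  then show ?thesis
    using integral_nonneg_eq_0_iff_AE[of M "\<lambda>y. (cmod (f y))\<^sup>2"] sq_integrableD[OF assms(1)] by simp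
qed

lemma sq_norm_tendsto:
  assumes "\<And>n. F n \<in> sq_integrable M" "f \<in> sq_integrable M"
    and "(\<lambda>n. sq_norm M (\<lambda>x. F n x - f x)) \<longlonglongrightarrow> 0"
  shows "(\<lambda>n. sq_norm M (F n)) \<longlonglongrightarrow> sq_norm M f"
proof (rule LIM_zero_cancel, rule tendsto_rabs_zero_cancel)
  show "(\<lambda>n. \<bar>sq_norm M (F n) - sq_norm M f\<bar>) \<longlonglongrightarrow> 0"
    by (rule tendsto_sandwich[OF _ _ tendsto_const assms(3)])
       (use sq_norm_diff_ge[OF assms(1,2)] in auto)
qed

section \<open>Completeness, and mean-square against pointwise limits\<close>

text \<open>
  The sum of the \<open>2 ^ k * \<bar>F (k + 1) - F k\<bar>\<^sup>2\<close> is integrable, hence finite almost everywhere, so the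
  increments decay geometrically at almost every point.
\<close>

lemma fast_Cauchy_AE_convergent:
  assumes F: "\<And>n. F n \<in> sq_integrable M"
    and fast: "\<And>n. sq_norm M (\<lambda>x. F (Suc n) x - F n x) \<le> (1/2) ^ n"
  shows "AE x in M. convergent (\<lambda>n. F n x)"
proof -
  have [measurable]: "F n \<in> borel_measurable M" for n using F by (rule sq_integrable_measurable)
  define d where "d n x = 2 ^ n * (cmod (F (Suc n) x - F n x))\<^sup>2" for n x
  have [measurable]: "d n \<in> borel_measurable M" for n unfolding d_def by measurable
  have dint: "integrable M (d n)" for n
    unfolding d_def using sq_integrableD[OF sq_integrable_diff[OF F F]] by auto
  have "(\<integral>\<^sup>+x. (\<Sum>n. ennreal (d n x)) \<partial>M) = (\<Sum>n. \<integral>\<^sup>+x. ennreal (d n x) \<partial>M)"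
    by (rule nn_integral_suminf) auto
  also have "\<dots> \<le> (\<Sum>n. ennreal ((1/2) ^ n))"
  proof (rule suminf_le)
    fix n
    have "(\<integral>\<^sup>+x. ennreal (d n x) \<partial>M) = ennreal (LINT x|M. d n x)"
      by (rule nn_integral_eq_integral[OF dint]) (simp add: d_def)
    also have "(LINT x|M. d n x) = 2 ^ n * (sq_norm M (\<lambda>x. F (Suc n) x - F n x))\<^sup>2"
      by (simp add: d_def sq_norm_power2)
    also have "\<dots> \<le> 2 ^ n * ((1/2) ^ n)\<^sup>2"
      by (intro mult_left_mono power_mono fast) auto
    also have "\<dots> = (1/2) ^ n" by (simp add: power2_eq_square power_mult_distrib[symmetric] field_simps)
    finally show "(\<integral>\<^sup>+x. ennreal (d n x) \<partial>M) \<le> ennreal ((1/2) ^ n)" by (simp add: ennreal_leI)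
  qed auto
  also have "\<dots> = ennreal (\<Sum>n. (1/2) ^ n)"
    by (rule suminf_ennreal2) (auto intro: summable_geometric)
  finally have "(\<integral>\<^sup>+x. (\<Sum>n. ennreal (d n x)) \<partial>M) \<noteq> \<infinity>"
    using ennreal_less_top le_less_trans by (metis infinity_ennreal_def less_irrefl)
  then have "AE x in M. (\<Sum>n. ennreal (d n x)) \<noteq> \<infinity>"
    by (intro nn_integral_PInf_AE) auto
  then show ?thesis
  proof eventually_elim
    case (elim x)
    then obtain C where C: "C \<ge> 0" "(\<Sum>n. ennreal (d n x)) = ennreal C"
      by (metis ennreal_cases infinity_ennreal_def)
    have "d n x \<le> C" for n
    proof -
      have "ennreal (d n x) \<le> (\<Sum>n. ennreal (d n x))"
        using sum_le_suminf[of "\<lambda>n. ennreal (d n x)" "{n}"] by simp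
      then show ?thesis using C by simp
    qed
    have bnd: "cmod (F (Suc n) x - F n x) \<le> sqrt C * (1 / sqrt 2) ^ n" for n
    proof (rule power2_le_imp_le)
      have "(cmod (F (Suc n) x - F n x))\<^sup>2 \<le> C / 2 ^ n"
        using \<open>d n x \<le> C\<close> by (simp add: d_def field_simps)
      also have "\<dots> = (sqrt C * (1 / sqrt 2) ^ n)\<^sup>2"
        using C(1) by (simp add: power_mult_distrib power_divide power_mult[symmetric] mult.commute[of n 2])
           (simp add: power_mult)
      finally show "(cmod (F (Suc n) x - F n x))\<^sup>2 \<le> (sqrt C * (1 / sqrt 2) ^ n)\<^sup>2" .
    qed (use C in simp)
    have "summable (\<lambda>n. F (Suc n) x - F n x)"
      by (rule summable_comparison_test'[OF summable_mult[OF summable_geometric]])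
         (use bnd in auto)
    then have "convergent (\<lambda>n. \<Sum>k<n. F (Suc k) x - F k x)"
      by (simp add: summable_iff_convergent)
    moreover have "(\<Sum>k<n. F (Suc k) x - F k x) = F n x - F 0 x" for n
      by (rule sum_lessThan_telescope)
    ultimately have "convergent (\<lambda>n. F n x - F 0 x)" by simp
    then show ?case
      using convergent_add[OF _ convergent_const[of "F 0 x"]] by fastforce
  qed
qed

text \<open>Fatou's lemma for the squares. Membership of h is a conclusion, because h will be a
  pointwise limit of which only measurability is known.\<close>

lemma sq_norm_le_liminf:
  assumes F: "\<And>n. F n \<in> sq_integrable M" and h: "h \<in> borel_measurable M"
    and lim: "AE x in M. (\<lambda>n. F n x) \<longlonglongrightarrow> h x"
    and bound: "\<forall>\<^sub>F n in sequentially. sq_norm M (F n) \<le> B" 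
  shows "h \<in> sq_integrable M" "sq_norm M h \<le> B"
proof -
  note [measurable] = h sq_integrable_measurable[OF F]
  have "\<exists>n. sq_norm M (F n) \<le> B" using bound eventually_happens'[OF sequentially_bot] by blast
  then have B: "B \<ge> 0" using sq_norm_nonneg order_trans by blast
  have "(\<integral>\<^sup>+x. ennreal ((cmod (h x))\<^sup>2) \<partial>M) = (\<integral>\<^sup>+x. liminf (\<lambda>n. ennreal ((cmod (F n x))\<^sup>2)) \<partial>M)"
  proof (rule nn_integral_cong_AE, use lim in eventually_elim)
    case (elim x)
    then have "(\<lambda>n. ennreal ((cmod (F n x))\<^sup>2)) \<longlonglongrightarrow> ennreal ((cmod (h x))\<^sup>2)"
      by (intro tendsto_ennrealI tendsto_intros)
    from lim_imp_Liminf[OF _ this] show ?case by simp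
  qed
  also have "\<dots> \<le> liminf (\<lambda>n. \<integral>\<^sup>+x. ennreal ((cmod (F n x))\<^sup>2) \<partial>M)"
    by (rule nn_integral_liminf) auto
  also have "\<dots> = liminf (\<lambda>n. ennreal ((sq_norm M (F n))\<^sup>2))"
    unfolding sq_norm_power2 by (simp add: nn_integral_eq_integral sq_integrableD[OF F])
  also have "\<dots> \<le> ennreal (B\<^sup>2)"
  proof (rule Liminf_le)
    show "\<forall>\<^sub>F n in sequentially. ennreal ((sq_norm M (F n))\<^sup>2) \<le> ennreal (B\<^sup>2)"
      using bound by eventually_elim (auto intro!: ennreal_leI power_mono)
  qed auto
  finally have le: "(\<integral>\<^sup>+x. ennreal ((cmod (h x))\<^sup>2) \<partial>M) \<le> ennreal (B\<^sup>2)" .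
  then have int: "integrable M (\<lambda>x. (cmod (h x))\<^sup>2)"
    by (intro integrableI_bounded) (auto intro: le_less_trans)
  then show "h \<in> sq_integrable M" using h by (simp add: sq_integrable_def)
  have "ennreal ((sq_norm M h)\<^sup>2) \<le> ennreal (B\<^sup>2)"
    using le int by (simp add: sq_norm_power2 nn_integral_eq_integral)
  then have "(sq_norm M h)\<^sup>2 \<le> B\<^sup>2" by (simp add: ennreal_le_iff)
  then show "sq_norm M h \<le> B" using B by (rule power2_le_imp_le)
qed

text \<open>Riesz-Fischer. The almost everywhere convergent subsequence is exported together with
  the limit, since limits have to be identified pointwise later.\<close>

lemma sq_integrable_complete:
  assumes F: "\<And>n. F n \<in> sq_integrable M"
    and Cauchy: "\<And>e. e > 0 \<Longrightarrow> \<exists>N. \<forall>m\<ge>N. \<forall>n\<ge>N. sq_norm M (\<lambda>x. F m x - F n x) < e"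
  obtains h r where "h \<in> sq_integrable M" "(\<lambda>n. sq_norm M (\<lambda>x. F n x - h x)) \<longlonglongrightarrow> 0"
    "strict_mono r" "AE x in M. (\<lambda>n. F (r n) x) \<longlonglongrightarrow> h x"
proof -
  have "\<exists>N. \<forall>m\<ge>N. \<forall>n\<ge>N. sq_norm M (\<lambda>x. F m x - F n x) < (1/2) ^ k" for k
    by (rule Cauchy) simp
  then obtain N where N: "\<And>k m n. m \<ge> N k \<Longrightarrow> n \<ge> N k \<Longrightarrow> sq_norm M (\<lambda>x. F m x - F n x) < (1/2) ^ k"
    by metis
  \<comment> \<open>The first argument of \<open>max\<close> makes r strictly increasing; the second
    keeps \<open>r k\<close> beyond \<open>N k\<close>, so that consecutive increments beat
    \<open>(1/2) ^ k\<close>.\<close>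
  define r where "r = rec_nat (N 0) (\<lambda>k p. max (Suc p) (N (Suc k)))"
  have rSuc: "r (Suc k) = max (Suc (r k)) (N (Suc k))" for k by (simp add: r_def)
  have r: "strict_mono r" unfolding strict_mono_Suc_iff by (auto simp: rSuc less_max_iff_disj)
  have rN: "r k \<ge> N k" for k by (cases k) (simp_all add: rSuc, simp add: r_def)
  have fast: "sq_norm M (\<lambda>x. F (r (Suc k)) x - F (r k) x) \<le> (1/2) ^ k" for k
    using N[of k "r (Suc k)" "r k"] rN[of k] r by (simp add: strict_mono_Suc_iff less_imp_le le_trans)
  have ae: "AE x in M. convergent (\<lambda>n. F (r n) x)"
    by (rule fast_Cauchy_AE_convergent) (use F fast in auto)
  define h where "h x = lim (\<lambda>n. F (r n) x)" for x
  have [measurable]: "F n \<in> borel_measurable M" for n using F by (rule sq_integrable_measurable)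
  have hm: "h \<in> borel_measurable M" unfolding h_def by measurable
  have lim: "AE x in M. (\<lambda>n. F (r n) x) \<longlonglongrightarrow> h x"
    using ae unfolding h_def by (simp add: convergent_LIMSEQ_iff)
  \<comment> \<open>With m fixed, Fatou along the subsequence turns the Cauchy estimate into a
    distance to h. Hence the whole sequence converges in norm, not just the subsequence.\<close>
  have key: "(\<lambda>x. F m x - h x) \<in> sq_integrable M \<and> sq_norm M (\<lambda>x. F m x - h x) \<le> (1/2) ^ k"
    if "m \<ge> N k" for m k
  proof -
    have 1: "(\<lambda>x. F m x - F (r n) x) \<in> sq_integrable M" for n
      by (intro sq_integrable_diff F)
    have 2: "AE x in M. (\<lambda>n. F m x - F (r n) x) \<longlonglongrightarrow> F m x - h x"
      using lim by eventually_elim (auto intro: tendsto_intros)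
    have 3: "\<forall>\<^sub>F n in sequentially. sq_norm M (\<lambda>x. F m x - F (r n) x) \<le> (1/2) ^ k"
      using eventually_ge_at_top[of "N k"]
      by eventually_elim (use N[OF that] seq_suble[OF r] le_trans less_imp_le in blast)
    from sq_norm_le_liminf[OF 1 _ 2 3] hm show ?thesis by simp
  qed
  have "(\<lambda>x. F (N 0) x - h x) \<in> sq_integrable M" using key[of 0 "N 0"] by simp
  from sq_integrable_diff[OF F[of "N 0"] this] have hL: "h \<in> sq_integrable M" by simp
  have "(\<lambda>n. sq_norm M (\<lambda>x. F n x - h x)) \<longlonglongrightarrow> 0"
  proof (rule LIMSEQ_I)
    fix e :: real assume "e > 0"
    then obtain k where "(1/2) ^ k < e" using real_arch_pow_inv[of e "1/2"] by auto
    then show "\<exists>no. \<forall>n\<ge>no. norm (sq_norm M (\<lambda>x. F n x - h x) - 0) < e"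
      using key[of k] by (intro exI[of _ "N k"]) (auto intro: le_less_trans)
  qed
  from that[OF hL this r lim] show ?thesis .
qed

lemma sq_norm_Cauchy:
  assumes F: "\<And>n. F n \<in> sq_integrable M" and f: "f \<in> sq_integrable M"
    and lim: "(\<lambda>n. sq_norm M (\<lambda>x. F n x - f x)) \<longlonglongrightarrow> 0" and e: "e > 0"
  shows "\<exists>N. \<forall>m\<ge>N. \<forall>n\<ge>N. sq_norm M (\<lambda>x. F m x - F n x) < e"
proof -
  have "\<forall>\<^sub>F n in sequentially. sq_norm M (\<lambda>x. F n x - f x) < e / 2"
    by (rule order_tendstoD(2)[OF lim]) (use e in simp)
  then obtain N where N: "\<And>n. n \<ge> N \<Longrightarrow> sq_norm M (\<lambda>x. F n x - f x) < e / 2"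
    by (auto simp: eventually_sequentially)
  show ?thesis
  proof (intro exI[of _ N] allI impI)
    fix m n assume "N \<le> m" "N \<le> n"
    then show "sq_norm M (\<lambda>x. F m x - F n x) < e"
      using sq_norm_triangle[OF F[of m] f F[of n]] N[of m] N[of n] sq_norm_minus_commute[of M f "F n"] by simp
  qed
qed

lemma sq_norm_limit_unique:
  assumes "\<And>n. F n \<in> sq_integrable M" "f \<in> sq_integrable M" "g \<in> sq_integrable M"
    and "(\<lambda>n. sq_norm M (\<lambda>x. F n x - f x)) \<longlonglongrightarrow> 0" "(\<lambda>n. sq_norm M (\<lambda>x. F n x - g x)) \<longlonglongrightarrow> 0"
  shows "AE x in M. f x = g x"
proof -
  have "sq_norm M (\<lambda>x. f x - g x) \<le> 0"
  proof (rule tendsto_lowerbound)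
    show "(\<lambda>n. sq_norm M (\<lambda>x. F n x - f x) + sq_norm M (\<lambda>x. F n x - g x)) \<longlonglongrightarrow> 0"
      using tendsto_add[OF assms(4,5)] by simp
    show "\<forall>\<^sub>F n in sequentially. sq_norm M (\<lambda>x. f x - g x)
        \<le> sq_norm M (\<lambda>x. F n x - f x) + sq_norm M (\<lambda>x. F n x - g x)"
      using sq_norm_triangle[OF assms(2,1,3)] by (simp add: sq_norm_minus_commute[of M f])
  qed simp
  then have "sq_norm M (\<lambda>x. f x - g x) = 0" using sq_norm_nonneg[of M] by (metis antisym)
  from sq_norm_eq_0_AE[OF sq_integrable_diff[OF assms(2,3)] this] show ?thesis by simp
qed

lemma sq_norm_AE_subseq:
  assumes F: "\<And>n. F n \<in> sq_integrable M" and f: "f \<in> sq_integrable M"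
    and lim: "(\<lambda>n. sq_norm M (\<lambda>x. F n x - f x)) \<longlonglongrightarrow> 0"
  obtains r where "strict_mono r" "AE x in M. (\<lambda>n. F (r n) x) \<longlonglongrightarrow> f x"
proof -
  obtain h r where h: "h \<in> sq_integrable M" "(\<lambda>n. sq_norm M (\<lambda>x. F n x - h x)) \<longlonglongrightarrow> 0"
    "strict_mono r" "AE x in M. (\<lambda>n. F (r n) x) \<longlonglongrightarrow> h x"
    using sq_integrable_complete[OF F sq_norm_Cauchy[OF F f lim]] by blast
  from sq_norm_limit_unique[OF F h(1) f h(2) lim] h(4)
  have "AE x in M. (\<lambda>n. F (r n) x) \<longlonglongrightarrow> f x" by eventually_elim simp
  with h(3) show ?thesis by (rule that)
qed

text \<open>Some subsequence tends to f almost everywhere, so any pointwise limit of the whole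
  sequence must be f. This identifies the abstract transform with concrete integrals and, at the
  end, the multiplier operator with the kernel operator.\<close>

lemma sq_norm_limit_AE_unique:
  assumes "\<And>n. F n \<in> sq_integrable M" "f \<in> sq_integrable M"
    and "(\<lambda>n. sq_norm M (\<lambda>x. F n x - f x)) \<longlonglongrightarrow> 0"
    and "AE x in M. (\<lambda>n. F n x) \<longlonglongrightarrow> g x"
  shows "AE x in M. f x = g x"
proof -
  obtain r where r: "strict_mono r" "AE x in M. (\<lambda>n. F (r n) x) \<longlonglongrightarrow> f x"
    using sq_norm_AE_subseq[OF assms(1-3)] by blast
  from r(2) assms(4) show ?thesis
  proof eventually_elim
    case (elim x)
    from LIMSEQ_subseq_LIMSEQ[OF elim(2) r(1)] have "(\<lambda>n. F (r n) x) \<longlonglongrightarrow> g x"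
      by (simp add: o_def)
    from LIMSEQ_unique[OF elim(1) this] show ?case .
  qed
qed

text \<open>The images G n are Cauchy because the F n are, hence converge in mean square, and h is
  the only candidate for the limit. Isometry of the differences is a separate assumption because no
  linear map relates F and G here.\<close>

lemma sq_norm_isometric_limit:
  assumes F: "\<And>n. F n \<in> sq_integrable M" and f: "f \<in> sq_integrable M"
    and G: "\<And>n. G n \<in> sq_integrable M'" and h: "h \<in> borel_measurable M'"
    and lim: "(\<lambda>n. sq_norm M (\<lambda>x. F n x - f x)) \<longlonglongrightarrow> 0"
    and iso: "\<And>n. sq_norm M' (G n) = sq_norm M (F n)"
      "\<And>m n. sq_norm M' (\<lambda>x. G m x - G n x) = sq_norm M (\<lambda>x. F m x - F n x)"
    and ae: "AE x in M'. (\<lambda>n. G n x) \<longlonglongrightarrow> h x"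
  shows "h \<in> sq_integrable M'" "sq_norm M' h = sq_norm M f"
    "(\<lambda>n. sq_norm M' (\<lambda>x. G n x - h x)) \<longlonglongrightarrow> 0"
proof -
  obtain g r where g: "g \<in> sq_integrable M'" "(\<lambda>n. sq_norm M' (\<lambda>x. G n x - g x)) \<longlonglongrightarrow> 0"
  proof (rule sq_integrable_complete[OF G])
    show "\<exists>N. \<forall>m\<ge>N. \<forall>n\<ge>N. sq_norm M' (\<lambda>x. G m x - G n x) < e" if "e > 0" for e
      unfolding iso by (rule sq_norm_Cauchy[OF F f lim that])
  qed blast
  have eq: "AE x in M'. g x = h x" by (rule sq_norm_limit_AE_unique[OF G g ae])
  show hL: "h \<in> sq_integrable M'"
    by (rule sq_integrable_bound[OF h sq_integrableD[OF g(1)]]) (use eq in \<open>eventually_elim, simp\<close>)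
  have "sq_norm M' (\<lambda>x. G n x - h x) = sq_norm M' (\<lambda>x. G n x - g x)" for n
    by (rule sq_norm_cong_AE)
       (use eq in eventually_elim, simp, auto intro!: sq_integrable_measurable sq_integrable_diff G g hL)
  with g(2) show lim': "(\<lambda>n. sq_norm M' (\<lambda>x. G n x - h x)) \<longlonglongrightarrow> 0" by simp
  show "sq_norm M' h = sq_norm M f"
    using LIMSEQ_unique[OF sq_norm_tendsto[OF G hL lim']] sq_norm_tendsto[OF F f lim] iso(1) by simp
qed

lemma sq_norm_dominated_convergence:
  assumes F: "\<And>n. F n \<in> borel_measurable M" and f: "f \<in> borel_measurable M" and g: "integrable M g"
    and bnd: "\<And>n. AE x in M. (cmod (F n x - f x))\<^sup>2 \<le> g x"
    and lim: "AE x in M. (\<lambda>n. F n x) \<longlonglongrightarrow> f x"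
  shows "(\<lambda>n. sq_norm M (\<lambda>x. F n x - f x)) \<longlonglongrightarrow> 0"
proof -
  have "(\<lambda>n. LINT x|M. (cmod (F n x - f x))\<^sup>2) \<longlonglongrightarrow> (LINT x|M. 0)"
  proof (rule integral_dominated_convergence[OF _ _ g])
    show "AE x in M. (\<lambda>n. (cmod (F n x - f x))\<^sup>2) \<longlonglongrightarrow> 0"
      using lim
    proof eventually_elim
      case (elim x)
      have "(\<lambda>n. (cmod (F n x - f x))\<^sup>2) \<longlonglongrightarrow> (cmod (f x - f x))\<^sup>2"
        by (intro tendsto_intros elim)
      then show ?case by simp
    qed
    show "AE x in M. norm ((cmod (F n x - f x))\<^sup>2) \<le> g x" for n
      using bnd[of n] by simp
  qed (use F f in measurable)
  then have "(\<lambda>n. sqrt (LINT x|M. (cmod (F n x - f x))\<^sup>2)) \<longlonglongrightarrow> sqrt (LINT x|M. 0)"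
    by (rule tendsto_real_sqrt)
  then show ?thesis by (simp add: sq_norm_def)
qed

section \<open>The measure with density \<open>y powr (2 * \<alpha> + 1)\<close>\<close>

lemma space_mu [simp]: "space (\<mu> \<alpha>) = {0<..}"
  by (simp add: \<mu>_def space_restrict_space)

lemma sets_mu: "sets (\<mu> \<alpha>) = sets (restrict_space borel {0<..})"
  by (simp add: \<mu>_def sets_restrict_space)

lemma borel_measurable_mu: "f \<in> borel_measurable borel \<Longrightarrow> f \<in> borel_measurable (\<mu> \<alpha>)"
  by (subst measurable_cong_sets[OF sets_mu refl]) (rule measurable_restrict_space1)

lemma measurable_ident_mu: "(\<lambda>x. x) \<in> borel_measurable (\<mu> \<alpha>)"
  by (rule borel_measurable_mu) simp

lemma borel_measurable_mu_weight:
  fixes \<alpha> :: real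
  shows "(\<lambda>y. y powr (2 * \<alpha> + 1)) \<in> borel_measurable (restrict_space lborel {0<..})"
  by (rule measurable_restrict_space1) simp

lemma borel_measurable_mu_ennreal_weight:
  fixes \<alpha> :: real
  shows "(\<lambda>y. ennreal (y powr (2 * \<alpha> + 1))) \<in> borel_measurable (restrict_space lborel {0<..})"
  by (rule measurable_compose[OF borel_measurable_mu_weight measurable_ennreal])

lemma sigma_finite_mu: "sigma_finite_measure (\<mu> \<alpha>)"
proof -
  interpret R: sigma_finite_measure "restrict_space lborel {0::real<..}"
    by (rule sigma_finite_measure_restrict_space[OF lborel.sigma_finite_measure_axioms]) simp
  show ?thesis unfolding \<mu>_def
    by (subst R.sigma_finite_iff_density_finite[OF borel_measurable_mu_ennreal_weight]) (rule AE_I2, simp)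
qed

lemma AE_mu_iff: "(AE x in \<mu> \<alpha>. P x) \<longleftrightarrow> (AE x in lborel. x > 0 \<longrightarrow> P x)"
proof -
  have "(AE x in \<mu> \<alpha>. P x) \<longleftrightarrow>
      (AE x in restrict_space lborel {0<..}. 0 < ennreal (x powr (2 * \<alpha> + 1)) \<longrightarrow> P x)"
    unfolding \<mu>_def by (rule AE_density[OF borel_measurable_mu_ennreal_weight])
  also have "\<dots> \<longleftrightarrow> (AE x in lborel. x > 0 \<longrightarrow> P x)"
    by (subst AE_restrict_space_iff) (auto intro!: AE_cong)
  finally show ?thesis .
qed

lemma
  fixes f :: "real \<Rightarrow> 'b::{banach, second_countable_topology}"
  assumes "f \<in> borel_measurable (\<mu> \<alpha>)"
  shows integrable_mu_iff:
      "integrable (\<mu> \<alpha>) f \<longleftrightarrow> integrable lborel (\<lambda>y. indicator {0<..} y *\<^sub>R (y powr (2 * \<alpha> + 1) *\<^sub>R f y))"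
    and integral_mu:
      "(LINT y|\<mu> \<alpha>. f y) = (LINT y|lborel. indicator {0<..} y *\<^sub>R (y powr (2 * \<alpha> + 1) *\<^sub>R f y))"
proof -
  have f: "f \<in> borel_measurable (restrict_space lborel {0<..})"
  proof -
    have "borel_measurable (\<mu> \<alpha>) = (borel_measurable (restrict_space lborel {0<..}) :: (real \<Rightarrow> 'b) set)"
      by (rule measurable_cong_sets) (simp_all add: \<mu>_def)
    with assms show ?thesis by blast
  qed
  note w = borel_measurable_mu_weight[of \<alpha>]
  show "integrable (\<mu> \<alpha>) f \<longleftrightarrow> integrable lborel (\<lambda>y. indicator {0<..} y *\<^sub>R (y powr (2 * \<alpha> + 1) *\<^sub>R f y))"
    unfolding \<mu>_def by (subst integrable_density[OF f w]) (auto simp: integrable_restrict_space)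
  show "(LINT y|\<mu> \<alpha>. f y) = (LINT y|lborel. indicator {0<..} y *\<^sub>R (y powr (2 * \<alpha> + 1) *\<^sub>R f y))"
    unfolding \<mu>_def by (subst integral_density[OF f w]) (auto simp: integral_restrict_space)
qed

section \<open>Integrals of powers and Gaussians\<close>

text \<open>A bridge from gauge integrals, in which powers and Euler's integral are evaluated, to
  Lebesgue integrals on the line. For nonnegative measurable functions the two agree.\<close>

lemma has_bochner_integral_of_has_integral_nonneg:
  fixes f :: "real \<Rightarrow> real"
  assumes "(f has_integral I) S" "\<And>x. x \<in> S \<Longrightarrow> 0 \<le> f x"
    and "(\<lambda>x. indicator S x * f x) \<in> borel_measurable borel"
  shows "has_bochner_integral lborel (\<lambda>x. indicator S x * f x) I"
proof (rule has_bochner_integral_nn_integral)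
  have "((\<lambda>x. indicator S x * f x) has_integral I) UNIV"
  proof -
    have "(\<lambda>x. indicator S x * f x) = (\<lambda>x. if x \<in> S then f x else 0)"
      by (auto simp: indicator_def)
    with assms(1) show ?thesis using has_integral_restrict_UNIV[of S f I] by simp
  qed
  then show "(\<integral>\<^sup>+x. ennreal (indicator S x * f x) \<partial>lborel) = ennreal I"
    using assms by (intro nn_integral_has_integral_lborel) (auto simp: indicator_def)
  show "0 \<le> I" using has_integral_nonneg assms(1,2) by blast
qed (use assms in \<open>auto simp: indicator_def\<close>)

lemma integrable_powr_near_0:
  assumes "p > -1" "c \<ge> 0"
  shows "integrable lborel (\<lambda>y::real. indicator {0<..c} y * y powr p)"
proof -
  have "has_bochner_integral lborel (\<lambda>y::real. indicator {0..c} y * y powr p) (c powr (p+1) / (p+1))"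
    by (rule has_bochner_integral_of_has_integral_nonneg)
       (use assms in \<open>auto intro!: has_integral_powr_from_0\<close>)
  then have "integrable lborel (\<lambda>y::real. indicator {0..c} y * y powr p)"
    by (rule has_bochner_integral_iff[THEN iffD1, THEN conjunct1])
  then show ?thesis
    by (rule Bochner_Integration.integrable_bound) (auto simp: indicator_def)
qed

lemma integrable_powr_at_top:
  assumes "p < -1" "c > 0"
  shows "integrable lborel (\<lambda>y::real. indicator {c..} y * y powr p)"
proof -
  have "has_bochner_integral lborel (\<lambda>y::real. indicator {c..} y * y powr p) (- (c powr (p + 1)) / (p + 1))"
    by (rule has_bochner_integral_of_has_integral_nonneg)
       (use assms has_integral_powr_to_inf[of p c] in simp_all)
  then show ?thesis by (rule has_bochner_integral_iff[THEN iffD1, THEN conjunct1])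
qed

text \<open>The substitution \<open>t = u * y\<^sup>2\<close>, with inverse g, turns this into
  Euler's integral for Gamma at \<open>(q + 1) / 2\<close>.\<close>

lemma has_bochner_integral_powr_gauss:
  fixes q u :: real
  assumes q: "q > -1" and u: "u > 0"
  shows "has_bochner_integral lborel (\<lambda>y. indicator {0<..} y * (y powr q * exp (- u * y\<^sup>2)))
           (Gamma ((q + 1) / 2) / (2 * u powr ((q + 1) / 2)))"
proof -
  define s where "s = (q + 1) / 2"
  have s: "s > 0" using q by (simp add: s_def)
  define f where "f y = y powr q * exp (- u * y\<^sup>2)" for y :: real
  define g where "g t = sqrt (t / u)" for t :: real
  define g' where "g' t = 1 / (2 * sqrt (u * t))" for t :: real
  have fg: "f (g t) * g' t = (1 / (2 * u powr s)) * (t powr (s - 1) / exp t)" if "t > 0" for t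
  proof -
    have "f (g t) * g' t = (t / u) powr (q / 2) * exp (- t) / (2 * (u * t) powr (1/2))"
    proof -
      have "g t = (t / u) powr (1/2)" "u * (g t)\<^sup>2 = t" "sqrt (u * t) = (u * t) powr (1/2)"
        using that u by (simp_all add: g_def powr_half_sqrt)
      then show ?thesis by (simp add: f_def g'_def powr_powr)
    qed
    also have "\<dots> = t powr (q/2) / t powr (1/2) * exp (- t) / (2 * (u powr (q/2) * u powr (1/2)))"
      using that u by (simp add: powr_divide powr_mult)
    also have "\<dots> = t powr (s - 1) * exp (- t) / (2 * u powr s)"
      by (simp add: powr_diff[symmetric] powr_add[symmetric] s_def add_divide_distrib diff_divide_distrib)
    finally show ?thesis by (simp add: exp_minus field_simps)
  qed
  have G: "has_bochner_integral lborel (\<lambda>t. indicator {0..} t * (t powr (s - 1) / exp t)) (Gamma s)"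
    by (rule has_bochner_integral_of_has_integral_nonneg) (use s in \<open>auto intro!: Gamma_integral_real\<close>)
  have G': "has_bochner_integral lborel (\<lambda>t. indicator {0<..} t *\<^sub>R (f (g t) * g' t)) (Gamma s / (2 * u powr s))"
  proof -
    have "has_bochner_integral lborel (\<lambda>t. (1 / (2 * u powr s)) * (indicator {0..} t * (t powr (s - 1) / exp t)))
        ((1 / (2 * u powr s)) * Gamma s)"
      by (rule has_bochner_integral_mult_right[OF G])
    moreover have "AE t in lborel. (1 / (2 * u powr s)) * (indicator {0..} t * (t powr (s - 1) / exp t))
        = indicator {0<..} t *\<^sub>R (f (g t) * g' t)"
      using AE_lborel_singleton[of "0::real"]
    proof eventually_elim
      case (elim t)
      show ?case using fg[of t] elim by (cases "t > 0") (auto simp: indicator_def)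
    qed
    ultimately show ?thesis
      by (subst has_bochner_integral_cong_AE[symmetric])
         (auto simp: f_def g_def g'_def)
  qed
  \<comment> \<open>The substitution rule works on the open interval between the extended reals 0
    and \<infinity>, so it asks for the limits of g at both ends (p3 and p4) instead of values
    there.\<close>
  have ein: "einterval 0 \<infinity> = {0<..}" by (auto simp: einterval_def)
  have p1: "DERIV g x :> g' x" "isCont f (g x)" "isCont g' x" if "0 < ereal x" for x
  proof -
    have x: "0 < x" using that by simp
    show "DERIV g x :> g' x"
      unfolding g_def g'_def using x u
      by (auto intro!: derivative_eq_intros simp: real_sqrt_divide real_sqrt_mult field_simps)
    show "isCont f (g x)" unfolding f_def using x u
      by (intro continuous_intros) (auto simp: g_def)
    show "isCont g' x" unfolding g'_def using x u by (intro continuous_intros) auto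
  qed
  have p2: "0 \<le> g' x" if "0 \<le> ereal x" for x
    using that u by (simp add: g'_def)
  have "((\<lambda>x. ereal (g x)) \<longlongrightarrow> ereal (g 0)) (at_right 0)"
    unfolding g_def by (intro tendsto_intros) (use u in auto)
  then have p3: "((ereal \<circ> g \<circ> real_of_ereal) \<longlongrightarrow> 0) (at_right 0)"
    unfolding zero_ereal_def ereal_tendsto_simps1 by (simp add: o_def g_def zero_ereal_def)
  have "filterlim (\<lambda>x. sqrt (x / u)) at_top at_top"
    by (rule filterlim_compose[OF sqrt_at_top])
       (use filterlim_tendsto_pos_mult_at_top[OF tendsto_const, of "1/u" "\<lambda>x. x" at_top] u in
         \<open>simp add: filterlim_ident field_simps\<close>)
  then have p4: "((ereal \<circ> g \<circ> real_of_ereal) \<longlongrightarrow> \<infinity>) (at_left \<infinity>)"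
    unfolding ereal_tendsto_simps1 by (simp add: o_def g_def tendsto_PInfty_eq_at_top)
  have p5: "set_integrable lborel (einterval 0 \<infinity>) (\<lambda>x. f (g x) * g' x)"
    unfolding ein set_integrable_def using G' by (simp add: has_bochner_integral_iff)
  have f0: "0 \<le> f (g x)" for x by (simp add: f_def)
  note sub = interval_integral_substitution_nonneg[where a=0 and b=\<infinity>, OF _ p1 f0 p2 p3 p4 p5, simplified]
  have "integrable lborel (\<lambda>y. indicator {0<..} y * f y)"
    using sub(1) by (simp add: ein set_integrable_def)
  moreover have "(LINT y|lborel. indicator {0<..} y * f y) = Gamma s / (2 * u powr s)"
    using sub(2) G' by (simp add: interval_lebesgue_integral_def ein set_lebesgue_integral_def has_bochner_integral_iff)
  ultimately show ?thesis by (simp add: has_bochner_integral_iff f_def s_def)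
qed

lemma has_bochner_integral_mu_gauss:
  assumes "\<alpha> > -1" "u > 0"
  shows "has_bochner_integral (\<mu> \<alpha>) (\<lambda>y. y ^ (2 * k) * exp (- u * y\<^sup>2))
           (Gamma (real k + \<alpha> + 1) / (2 * u powr (real k + \<alpha> + 1)))"
proof -
  have m: "(\<lambda>y. y ^ (2 * k) * exp (- u * y\<^sup>2)) \<in> borel_measurable (\<mu> \<alpha>)"
    by (rule borel_measurable_mu) simp
  have eq: "(\<lambda>y. indicator {0<..} y *\<^sub>R (y powr (2 * \<alpha> + 1) *\<^sub>R (y ^ (2 * k) * exp (- u * y\<^sup>2)))) =
      (\<lambda>y. indicator {0<..} y * (y powr (2 * (real k + \<alpha>) + 1) * exp (- u * y\<^sup>2)))"
    by (rule ext) (auto simp: indicator_def powr_realpow[symmetric] powr_add[symmetric] algebra_simps)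
  have "(2 * (real k + \<alpha>) + 1 + 1) / 2 = real k + \<alpha> + 1" by simp
  then show ?thesis
    using has_bochner_integral_powr_gauss[of "2 * (real k + \<alpha>) + 1" u] assms
    unfolding has_bochner_integral_iff integrable_mu_iff[OF m] integral_mu[OF m] eq
    by (simp only:) simp
qed

lemma integrable_mu_powr_near_0:
  assumes "2 * \<alpha> + p > -2" "c \<ge> 0"
  shows "integrable (\<mu> \<alpha>) (\<lambda>y. indicator {0<..c} y * y powr p)"
proof -
  have "integrable lborel (\<lambda>y::real. indicator {0<..c} y * y powr (2 * \<alpha> + 1 + p))"
    by (rule integrable_powr_near_0) (use assms in auto)
  then show ?thesis
    by (subst integrable_mu_iff)
       (auto simp: borel_measurable_mu powr_add indicator_def if_distrib if_distribR cong: if_cong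
             elim!: Bochner_Integration.integrable_bound)
qed

lemma integrable_mu_powr_at_top:
  assumes "2 * \<alpha> + p < -2" "c > 0"
  shows "integrable (\<mu> \<alpha>) (\<lambda>y. indicator {c..} y * y powr p)"
proof -
  have "integrable lborel (\<lambda>y::real. indicator {c..} y * y powr (2 * \<alpha> + 1 + p))"
    by (rule integrable_powr_at_top) (use assms in auto)
  then show ?thesis using assms(2)
    by (subst integrable_mu_iff)
       (auto simp: borel_measurable_mu powr_add indicator_def if_distrib if_distribR cong: if_cong
             elim!: Bochner_Integration.integrable_bound)
qed

lemma integrable_mu_indicator:
  assumes "\<alpha> > -1"
  shows "integrable (\<mu> \<alpha>) (\<lambda>y. indicator {0<..c} y :: real)"
proof -
  have "integrable (\<mu> \<alpha>) (\<lambda>y. indicator {0<..max c 0} y * y powr 0)"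
    by (rule integrable_mu_powr_near_0) (use assms in auto)
  then show ?thesis
    by (rule Bochner_Integration.integrable_bound) (auto simp: indicator_def borel_measurable_mu)
qed

lemma L2_eq_sq_integrable: "L2 \<alpha> = sq_integrable (\<mu> \<alpha>)"
  by (simp add: L2_def sq_integrable_def)

lemma L2_norm_eq_sq_norm: "L2_norm \<alpha> = sq_norm (\<mu> \<alpha>)"
  by (rule ext) (simp add: L2_norm_def sq_norm_def)

section \<open>Bessel functions of the first kind\<close>

definition bessel_coeff :: "real \<Rightarrow> nat \<Rightarrow> real" where
  "bessel_coeff \<nu> k = (-1) ^ k * rGamma (real k + \<nu> + 1) / (fact k * 4 ^ k * 2 powr \<nu>)"

text \<open>The quotient of \<open>J_\<nu>(s)\<close> by \<open>s^\<nu>\<close> is even in s; this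
  is its power series in \<open>r = s\<^sup>2\<close>. In the variable r no real powers of the
  argument remain, and derivative and recurrence become identities between coefficients.\<close>

definition bessel_series :: "real \<Rightarrow> real \<Rightarrow> real" where
  "bessel_series \<nu> r = (\<Sum>k. bessel_coeff \<nu> k * r ^ k)"

lemma rGamma_step:
  assumes "\<nu> > -1"
  shows "rGamma (real k + \<nu> + 1) = (real k + \<nu> + 1) * rGamma (real k + \<nu> + 2)"
  using rGamma_plus1[of "real k + \<nu> + 1"] by (simp add: add.assoc)

lemma bessel_coeff_Suc: "bessel_coeff \<nu> (Suc k) = - bessel_coeff (\<nu> + 1) k / (2 * (real k + 1))"
proof -
  have "real (Suc k) + \<nu> + 1 = real k + (\<nu> + 1) + 1" by simp
  then show ?thesis
    unfolding bessel_coeff_def by (simp only:) (simp add: powr_add mult_ac add_ac)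
qed

lemma bessel_coeff_eq:
  assumes "\<nu> > -1"
  shows "bessel_coeff \<nu> k = 2 * (real k + \<nu> + 1) * bessel_coeff (\<nu> + 1) k"
proof -
  have "real k + (\<nu> + 1) + 1 = real k + \<nu> + 2" by simp
  then show ?thesis
    unfolding bessel_coeff_def rGamma_step[OF assms, of k] by (simp only:) (simp add: powr_add field_simps)
qed

lemma summable_bessel_series:
  assumes "\<nu> > -1"
  shows "summable (\<lambda>k. bessel_coeff \<nu> k * r ^ k)"
proof (rule summable_ratio_test[where c="1/2" and N="nat \<lceil>\<bar>r\<bar> + 2\<rceil>"])
  fix k assume k: "k \<ge> nat \<lceil>\<bar>r\<bar> + 2\<rceil>"
  then have k1: "real k \<ge> \<bar>r\<bar> + 2" by linarith
  define X where "X = (real k + 1) * (real k + \<nu> + 1)"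
  define q where "q = 4 * X"
  have "(real k + 1) * 1 \<le> X"
    unfolding X_def using k1 assms by (intro mult_left_mono) auto
  then have "4 * \<bar>r\<bar> \<le> q" unfolding q_def using k1 by simp
  have step: "bessel_coeff \<nu> k = - q * bessel_coeff \<nu> (Suc k)"
    using bessel_coeff_eq[OF assms, of k] by (simp add: bessel_coeff_Suc q_def X_def divide_simps) (simp add: algebra_simps)
  have "norm (bessel_coeff \<nu> (Suc k) * r ^ Suc k) * (2 * \<bar>r\<bar>) \<le> norm (bessel_coeff \<nu> (Suc k) * r ^ Suc k) * q"
    using \<open>4 * \<bar>r\<bar> \<le> q\<close> by (intro mult_left_mono) auto
  also have "\<dots> = norm (bessel_coeff \<nu> k * r ^ k) * \<bar>r\<bar>"
    using \<open>4 * \<bar>r\<bar> \<le> q\<close> unfolding step by (simp add: abs_mult)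
  finally have "\<bar>r\<bar> * (norm (bessel_coeff \<nu> (Suc k) * r ^ Suc k) * 2) \<le> \<bar>r\<bar> * norm (bessel_coeff \<nu> k * r ^ k)"
    by (simp add: mult_ac)
  then show "norm (bessel_coeff \<nu> (Suc k) * r ^ Suc k) \<le> 1/2 * norm (bessel_coeff \<nu> k * r ^ k)"
    by (cases "r = 0") auto
qed simp

lemma bessel_quot_eq_series:
  assumes "\<nu> > -1" "s > 0"
  shows "bessel_quot \<nu> s = bessel_series \<nu> (s\<^sup>2)"
proof -
  have "(-1) ^ k * rGamma (real k + \<nu> + 1) / fact k * (s / 2) powr (2 * real k + \<nu>)
      = bessel_coeff \<nu> k * (s\<^sup>2) ^ k * s powr \<nu>" for k
  proof -
    have "(s / 2) powr (2 * real k + \<nu>) = (s / 2) powr (real (2 * k)) * (s / 2) powr \<nu>"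
      by (simp add: powr_add)
    also have "\<dots> = (s\<^sup>2) ^ k / 4 ^ k * (s powr \<nu> / 2 powr \<nu>)"
      using assms(2) by (subst powr_realpow) (auto simp: power_divide power_mult powr_divide)
    finally show ?thesis by (simp add: bessel_coeff_def)
  qed
  then have "bessel_J \<nu> s = bessel_series \<nu> (s\<^sup>2) * s powr \<nu>"
    unfolding bessel_J_def bessel_series_def
    by (simp add: suminf_mult2[OF summable_bessel_series[OF assms(1)]])
  then show ?thesis using assms by (simp add: bessel_quot_def)
qed

lemma DERIV_bessel_series:
  assumes "\<nu> > -1"
  shows "(bessel_series \<nu> has_real_derivative - bessel_series (\<nu> + 1) r / 2) (at r)"
proof -
  have "diffs (bessel_coeff \<nu>) k = - (1/2) * bessel_coeff (\<nu> + 1) k" for k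
    by (simp add: diffs_def bessel_coeff_Suc divide_simps)
  then have "(\<Sum>k. diffs (bessel_coeff \<nu>) k * r ^ k) = (\<Sum>k. - (1/2) * (bessel_coeff (\<nu> + 1) k * r ^ k))"
    by (simp add: mult.assoc)
  also have "\<dots> = - (1/2) * bessel_series (\<nu> + 1) r"
    unfolding bessel_series_def by (rule suminf_mult[OF summable_bessel_series]) (use assms in simp)
  finally show ?thesis
    using termdiffs_strong_converges_everywhere[of "bessel_coeff \<nu>" r] summable_bessel_series[OF assms]
    unfolding bessel_series_def[abs_def] by simp
qed

text \<open>This is the recurrence \<open>J_\<nu>(s) + J_{\<nu>+2}(s) = 2 * (\<nu> + 1) / s *
  J_{\<nu>+1}(s)\<close> in normalised form, compared coefficient by coefficient.\<close>

lemma bessel_series_rec: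
  assumes "\<nu> > -1"
  shows "bessel_series \<nu> r = 2 * (\<nu> + 1) * bessel_series (\<nu> + 1) r - r * bessel_series (\<nu> + 2) r"
proof -
  have s2: "(\<lambda>k. bessel_coeff (\<nu> + 2) k * r ^ k) sums bessel_series (\<nu> + 2) r"
    unfolding bessel_series_def by (rule summable_sums[OF summable_bessel_series]) (use assms in simp)
  \<comment> \<open>The series of order \<nu> + 2 multiplied by r, shifted by one index and given a
    zero constant term, so that it can be subtracted termwise.\<close>
  define h where "h k = (case k of 0 \<Rightarrow> 0 | Suc j \<Rightarrow> bessel_coeff (\<nu> + 2) j * r ^ Suc j)" for k
  have "(\<lambda>k. h (Suc k)) sums (r * bessel_series (\<nu> + 2) r)"
    using sums_mult[OF s2, of r] by (simp add: h_def mult_ac)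
  then have h: "h sums (r * bessel_series (\<nu> + 2) r)"
    by (subst (asm) sums_Suc_iff) (simp add: h_def)
  have s1: "(\<lambda>k. 2 * (\<nu> + 1) * (bessel_coeff (\<nu> + 1) k * r ^ k)) sums (2 * (\<nu> + 1) * bessel_series (\<nu> + 1) r)"
    unfolding bessel_series_def by (intro sums_mult summable_sums[OF summable_bessel_series]) (use assms in simp)
  have "2 * (\<nu> + 1) * (bessel_coeff (\<nu> + 1) k * r ^ k) - h k = bessel_coeff \<nu> k * r ^ k" for k
  proof (cases k)
    case 0
    then show ?thesis using bessel_coeff_eq[OF assms, of 0] by (simp add: h_def)
  next
    case (Suc j)
    define D where "D = 2 * (real j + 1)"
    have "D > 0" by (simp add: D_def)
    then have "D \<noteq> 0" by simp
    moreover have "bessel_coeff (\<nu> + 1) (Suc j) = - bessel_coeff (\<nu> + 2) j / D"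
      using bessel_coeff_Suc[of "\<nu> + 1" j] by (simp add: add.assoc D_def)
    ultimately have "bessel_coeff (\<nu> + 2) j = - D * bessel_coeff (\<nu> + 1) (Suc j)" by simp
    moreover have "D = 2 * real k" using Suc by (simp add: D_def)
    ultimately have "bessel_coeff (\<nu> + 2) j = - (2 * real k * bessel_coeff (\<nu> + 1) k)"
      using Suc by (metis mult_minus_left)
    moreover have "h k = bessel_coeff (\<nu> + 2) j * r ^ k" using Suc by (simp add: h_def)
    ultimately show ?thesis using bessel_coeff_eq[OF assms, of k] by (simp add: algebra_simps)
  qed
  then have "(\<lambda>k. bessel_coeff \<nu> k * r ^ k) sums
      (2 * (\<nu> + 1) * bessel_series (\<nu> + 1) r - r * bessel_series (\<nu> + 2) r)"
    using sums_diff[OF s1 h] by simp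
  then show ?thesis unfolding bessel_series_def[of \<nu>] by (rule sums_unique[symmetric])
qed

lemma borel_measurable_bessel_quot [measurable]: "bessel_quot \<nu> \<in> borel_measurable borel"
  unfolding bessel_quot_def bessel_J_def by measurable

section \<open>The oscillator equation and the behaviour at infinity\<close>

text \<open>This is \<open>\<surd>s * J\<^sub>\<nu>(s)\<close>, which solves the oscillator equation \<open>u'' + u = (\<nu>\<^sup>2 - 1/4) u / s\<^sup>2\<close>.\<close>

definition bessel_osc :: "real \<Rightarrow> real \<Rightarrow> real" where
  "bessel_osc \<nu> s = s powr (\<nu> + 1/2) * bessel_quot \<nu> s"

definition bessel_osc_deriv :: "real \<Rightarrow> real \<Rightarrow> real" where
  "bessel_osc_deriv \<nu> s =
     (\<nu> + 1/2) * s powr (\<nu> - 1/2) * bessel_quot \<nu> s - s powr (\<nu> + 3/2) * bessel_quot (\<nu> + 1) s"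

lemma bessel_quot_eq_osc: "s > 0 \<Longrightarrow> bessel_quot \<nu> s = s powr (- \<nu> - 1/2) * bessel_osc \<nu> s"
  by (simp add: bessel_osc_def flip: mult.assoc powr_add)

lemma DERIV_bessel_quot:
  assumes "\<nu> > -1" "s > 0"
  shows "(bessel_quot \<nu> has_real_derivative - s * bessel_quot (\<nu> + 1) s) (at s)"
proof -
  have "((\<lambda>s. bessel_series \<nu> (s\<^sup>2)) has_real_derivative - s * bessel_quot (\<nu> + 1) s) (at s)"
  proof -
    have "((\<lambda>s. s\<^sup>2) has_real_derivative 2 * s) (at s)" by (auto intro!: derivative_eq_intros)
    from DERIV_chain2[OF DERIV_bessel_series[OF assms(1)] this] show ?thesis
      using assms by (simp add: bessel_quot_eq_series mult.commute)
  qed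
  moreover have "\<forall>\<^sub>F y in nhds s. bessel_quot \<nu> y = bessel_series \<nu> (y\<^sup>2)"
    using eventually_nhds_in_open[of "{0<..}" s] assms
    by (auto elim!: eventually_mono simp: bessel_quot_eq_series)
  ultimately show ?thesis by (subst DERIV_cong_ev[OF refl _ refl])
qed

lemma DERIV_bessel_osc:
  assumes "\<nu> > -1" "s > 0"
  shows "(bessel_osc \<nu> has_real_derivative bessel_osc_deriv \<nu> s) (at s)"
proof -
  have "\<nu> + 3/2 = (\<nu> + 1/2) + 1" by simp
  then have "s powr (\<nu> + 3/2) = s powr (\<nu> + 1/2) * s powr 1" by (metis powr_add)
  then have "s powr (\<nu> + 3/2) = s powr (\<nu> + 1/2) * s" using assms by simp
  then show ?thesis unfolding bessel_osc_def[abs_def] bessel_osc_deriv_def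
    using assms by (auto intro!: derivative_eq_intros DERIV_bessel_quot simp: field_simps)
qed

text \<open>Differentiation produces the orders \<nu>, \<nu> + 1 and \<nu> + 2; the last two occur
  exactly in the combination that the three-term recurrence collapses to order \<nu>.\<close>

lemma DERIV_bessel_osc_deriv:
  assumes "\<nu> > -1" "s > 0"
  shows "(bessel_osc_deriv \<nu> has_real_derivative ((\<nu>\<^sup>2 - 1/4) / s\<^sup>2 - 1) * bessel_osc \<nu> s) (at s)"
proof -
  define P where "P = s powr (\<nu> + 1/2)"
  define p0 where "p0 = bessel_quot \<nu> s"
  define p1 where "p1 = bessel_quot (\<nu> + 1) s"
  define p2 where "p2 = bessel_quot (\<nu> + 2) s"
  have "\<nu> + 3/2 = (\<nu> + 1/2) + 1" by simp
  then have "s powr (\<nu> + 3/2) = s powr (\<nu> + 1/2) * s powr 1" by (metis powr_add)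
  then have p3: "s powr (\<nu> + 3/2) = P * s" using assms by (simp add: P_def)
  have pw: "s powr (\<nu> - 1/2) = P / s" "s powr (\<nu> - 3/2) = P / s\<^sup>2" "s powr (\<nu> + 3/2) = P * s"
    using assms p3 powr_diff[of s "\<nu> + 1/2" 1] powr_diff[of s "\<nu> + 1/2" 2]
    by (simp_all add: P_def)
  have rec: "p0 = 2 * (\<nu> + 1) * p1 - s\<^sup>2 * p2"
    using bessel_series_rec[OF assms(1), of "s\<^sup>2"] assms by (simp add: p0_def p1_def p2_def bessel_quot_eq_series)
  have "(bessel_osc_deriv \<nu> has_real_derivative
      (\<nu> + 1/2) * ((\<nu> - 1/2) * s powr (\<nu> - 3/2)) * p0 + (\<nu> + 1/2) * s powr (\<nu> - 1/2) * (- s * p1)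
      - ((\<nu> + 3/2) * s powr (\<nu> + 1/2) * p1 + s powr (\<nu> + 3/2) * (- s * p2))) (at s)"
    unfolding bessel_osc_deriv_def[abs_def] using assms
    by (auto intro!: derivative_eq_intros DERIV_bessel_quot simp: p0_def p1_def p2_def add_ac field_simps)
  also have "(\<nu> + 1/2) * ((\<nu> - 1/2) * s powr (\<nu> - 3/2)) * p0 + (\<nu> + 1/2) * s powr (\<nu> - 1/2) * (- s * p1)
      - ((\<nu> + 3/2) * s powr (\<nu> + 1/2) * p1 + s powr (\<nu> + 3/2) * (- s * p2))
      = (\<nu>\<^sup>2 - 1/4) / s\<^sup>2 * (P * p0) - P * (2 * (\<nu> + 1) * p1 - s\<^sup>2 * p2)"
    unfolding pw P_def[symmetric] using assms by (simp add: field_simps power2_eq_square)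
  also have "\<dots> = ((\<nu>\<^sup>2 - 1/4) / s\<^sup>2 - 1) * (P * p0)" unfolding rec[symmetric] by (simp add: algebra_simps)
  finally show ?thesis by (simp add: bessel_osc_def P_def p0_def)
qed

text \<open>\<open>P s + B / s\<close> is nonincreasing and \<open>P s - B / s\<close>
  nondecreasing, since \<open>B / s\<close> has derivative \<open>- B / s\<^sup>2\<close>.
  Comparison by monotonicity avoids integrating P'.\<close>

lemma DERIV_bounded_by_inverse_square:
  fixes P :: "real \<Rightarrow> real"
  assumes "\<And>s. s \<ge> s0 \<Longrightarrow> (P has_real_derivative P' s) (at s)" "\<And>s. s \<ge> s0 \<Longrightarrow> \<bar>P' s\<bar> \<le> B / s\<^sup>2"
    and "s0 > 0" "s0 \<le> s" "s \<le> r"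
  shows "\<bar>P r - P s\<bar> \<le> B / s"
proof -
  have B: "B \<ge> 0" using order_trans[OF abs_ge_zero assms(2)[of s0]] assms(3) by (simp add: zero_le_divide_iff)
  have D: "((\<lambda>s. B / s) has_real_derivative - (B / y\<^sup>2)) (at y)" if "y \<ge> s0" for y
    using that assms(3) by (auto intro!: derivative_eq_intros simp: power2_eq_square)
  have "P r + B / r \<le> P s + B / s"
  proof (rule DERIV_nonpos_imp_nonincreasing[OF assms(5)])
    fix y assume "s \<le> y" "y \<le> r"
    then have y: "y \<ge> s0" using assms by simp
    have "((\<lambda>s. P s + B / s) has_real_derivative (P' y + - (B / y\<^sup>2))) (at y)"
      by (rule DERIV_add[OF assms(1)[OF y] D[OF y]])
    moreover have "P' y + - (B / y\<^sup>2) \<le> 0" using assms(2)[OF y] by linarith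
    ultimately show "\<exists>d. ((\<lambda>s. P s + B / s) has_real_derivative d) (at y) \<and> d \<le> 0" by blast
  qed
  moreover have "P s - B / s \<le> P r - B / r"
  proof (rule DERIV_nonneg_imp_nondecreasing[OF assms(5)])
    fix y assume "s \<le> y" "y \<le> r"
    then have y: "y \<ge> s0" using assms by simp
    have "((\<lambda>s. P s - B / s) has_real_derivative (P' y - - (B / y\<^sup>2))) (at y)"
      by (rule DERIV_diff[OF assms(1)[OF y] D[OF y]])
    moreover have "P' y - - (B / y\<^sup>2) \<ge> 0" using assms(2)[OF y] by linarith
    ultimately show "\<exists>d. ((\<lambda>s. P s - B / s) has_real_derivative d) (at y) \<and> d \<ge> 0" by blast
  qed
  moreover have "B / r \<ge> 0" using B assms by simp
  ultimately show ?thesis by linarith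
qed

text \<open>An energy estimate in Gronwall form: the energy
  \<open>(A s)\<^sup>2 + (A' s)\<^sup>2\<close> has derivative
  \<open>2 * \<kappa> * A s * A' s / s\<^sup>2\<close>, at most
  \<open>\<bar>\<kappa>\<bar> / s\<^sup>2\<close> times the energy. The factor
  \<open>exp (\<bar>\<kappa>\<bar> / s)\<close> absorbs precisely this growth, so V is
  nonincreasing.\<close>

lemma bounded_of_perturbed_oscillator:
  fixes A A' :: "real \<Rightarrow> real"
  assumes A: "\<And>s. s > 0 \<Longrightarrow> (A has_real_derivative A' s) (at s)"
    and A': "\<And>s. s > 0 \<Longrightarrow> (A' has_real_derivative (\<kappa> / s\<^sup>2 - 1) * A s) (at s)"
    and s0: "s0 > 0"
  shows "\<exists>M\<ge>0. \<forall>s\<ge>s0. \<bar>A s\<bar> \<le> M"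
proof -
  define V where "V s = ((A s)\<^sup>2 + (A' s)\<^sup>2) * exp (\<bar>\<kappa>\<bar> / s)" for s
  have mono: "V s \<le> V s0" if "s \<ge> s0" for s
  proof (rule DERIV_nonpos_imp_nonincreasing[OF that])
    fix y assume "s0 \<le> y" "y \<le> s"
    then have y: "y > 0" using s0 by simp
    define d where "d = (2 * A y * A' y + 2 * A' y * ((\<kappa> / y\<^sup>2 - 1) * A y)) * exp (\<bar>\<kappa>\<bar> / y)
       + ((A y)\<^sup>2 + (A' y)\<^sup>2) * (exp (\<bar>\<kappa>\<bar> / y) * (- (\<bar>\<kappa>\<bar> / y\<^sup>2)))"
    have "(V has_real_derivative d) (at y)"
      unfolding V_def[abs_def] d_def using y
      by (auto intro!: derivative_eq_intros A A' simp: power2_eq_square algebra_simps add_divide_distrib)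
    moreover have "d = exp (\<bar>\<kappa>\<bar> / y) / y\<^sup>2 * (2 * \<kappa> * A y * A' y - \<bar>\<kappa>\<bar> * ((A y)\<^sup>2 + (A' y)\<^sup>2))"
      unfolding d_def using y by (simp add: field_simps)
    moreover have "2 * \<kappa> * A y * A' y \<le> \<bar>\<kappa>\<bar> * ((A y)\<^sup>2 + (A' y)\<^sup>2)"
    proof -
      have "2 * \<kappa> * A y * A' y \<le> \<bar>2 * \<kappa> * A y * A' y\<bar>" by simp
      also have "\<dots> = \<bar>\<kappa>\<bar> * (2 * \<bar>A y\<bar> * \<bar>A' y\<bar>)" by (simp add: abs_mult)
      also have "\<dots> \<le> \<bar>\<kappa>\<bar> * ((A y)\<^sup>2 + (A' y)\<^sup>2)"
        using sum_squares_bound[of "\<bar>A y\<bar>" "\<bar>A' y\<bar>"] by (intro mult_left_mono) auto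
      finally show ?thesis .
    qed
    ultimately show "\<exists>d. (V has_real_derivative d) (at y) \<and> d \<le> 0"
      using mult_nonneg_nonpos[of "exp (\<bar>\<kappa>\<bar> / y) / y\<^sup>2" "2 * \<kappa> * A y * A' y - \<bar>\<kappa>\<bar> * ((A y)\<^sup>2 + (A' y)\<^sup>2)"] y
      by (intro exI[of _ d]) simp
  qed
  have "\<bar>A s\<bar> \<le> sqrt (V s0)" if "s \<ge> s0" for s
  proof -
    have "1 \<le> exp (\<bar>\<kappa>\<bar> / s)" using that s0 by simp
    then have "((A s)\<^sup>2 + (A' s)\<^sup>2) * 1 \<le> V s" unfolding V_def by (intro mult_left_mono) auto
    moreover have "(A s)\<^sup>2 \<le> (A s)\<^sup>2 + (A' s)\<^sup>2" by simp
    ultimately have "(A s)\<^sup>2 \<le> V s0" using mono[OF that] by (metis mult_1_right order_trans)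
    then show ?thesis using real_sqrt_le_mono by fastforce
  qed
  moreover have "sqrt (V s0) \<ge> 0" by (simp add: V_def)
  ultimately show ?thesis by blast
qed

text \<open>
  Variation of constants: \<open>P = A cos - A' sin\<close> and \<open>Q = A sin + A' cos\<close> have derivatives of order
  \<open>1 / s\<^sup>2\<close>.
\<close>

lemma perturbed_oscillator_asymptotics:
  fixes A A' :: "real \<Rightarrow> real"
  assumes A: "\<And>s. s > 0 \<Longrightarrow> (A has_real_derivative A' s) (at s)"
    and A': "\<And>s. s > 0 \<Longrightarrow> (A' has_real_derivative (\<kappa> / s\<^sup>2 - 1) * A s) (at s)"
  obtains \<rho> c where "\<And>s0. s0 > 0 \<Longrightarrow>
    \<exists>C\<ge>0. \<forall>s\<ge>s0. \<bar>A s - \<rho> * cos (s - c)\<bar> \<le> C / s \<and> \<bar>A' s + \<rho> * sin (s - c)\<bar> \<le> C / s"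
proof -
  define P where "P s = A s * cos s - A' s * sin s" for s
  define Q where "Q s = A s * sin s + A' s * cos s" for s
  have dP: "(P has_real_derivative - (\<kappa> / s\<^sup>2 * A s * sin s)) (at s)" if "s > 0" for s
    unfolding P_def[abs_def] using that
    by (auto intro!: derivative_eq_intros A A' simp: algebra_simps)
  have dQ: "(Q has_real_derivative (\<kappa> / s\<^sup>2 * A s * cos s)) (at s)" if "s > 0" for s
    unfolding Q_def[abs_def] using that
    by (auto intro!: derivative_eq_intros A A' simp: algebra_simps)
  have osc: "\<exists>B\<ge>0. \<forall>s\<ge>s0. \<forall>r\<ge>s. \<bar>P r - P s\<bar> \<le> B / s \<and> \<bar>Q r - Q s\<bar> \<le> B / s" if s0: "s0 > 0" for s0
  proof -
    obtain M where M: "M \<ge> 0" "\<And>s. s \<ge> s0 \<Longrightarrow> \<bar>A s\<bar> \<le> M"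
      using bounded_of_perturbed_oscillator[OF A A' s0] by auto
    have bound: "\<bar>\<kappa> / s\<^sup>2 * A s * w\<bar> \<le> \<bar>\<kappa>\<bar> * M / s\<^sup>2" if "s \<ge> s0" "\<bar>w\<bar> \<le> 1" for s w
    proof -
      have "\<bar>\<kappa> / s\<^sup>2 * A s * w\<bar> = \<bar>\<kappa>\<bar> / s\<^sup>2 * (\<bar>A s\<bar> * \<bar>w\<bar>)" by (simp add: abs_mult)
      also have "\<dots> \<le> \<bar>\<kappa>\<bar> / s\<^sup>2 * (M * 1)"
        using M that by (intro mult_left_mono mult_mono) auto
      finally show ?thesis by simp
    qed
    have "\<bar>P r - P s\<bar> \<le> \<bar>\<kappa>\<bar> * M / s" if "s \<ge> s0" "r \<ge> s" for r s
      by (rule DERIV_bounded_by_inverse_square[OF dP _ s0 that]) (use s0 bound in auto)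
    moreover have "\<bar>Q r - Q s\<bar> \<le> \<bar>\<kappa>\<bar> * M / s" if "s \<ge> s0" "r \<ge> s" for r s
      by (rule DERIV_bounded_by_inverse_square[OF dQ _ s0 that]) (use s0 bound in auto)
    ultimately show ?thesis using M(1) by (intro exI[of _ "\<bar>\<kappa>\<bar> * M"]) auto
  qed
  \<comment> \<open>One limit l must serve every starting point s0, each with its own constant B. It
    is found along the integers, and the rate is then read off from the oscillation bound valid
    beyond s0.\<close>
  have lim: "\<exists>l. \<forall>s0>0. \<forall>B. (\<forall>s\<ge>s0. \<forall>r\<ge>s. \<bar>f r - f s\<bar> \<le> B / s) \<longrightarrow> (\<forall>s\<ge>s0. \<bar>f s - l\<bar> \<le> B / s)"
    if f: "\<exists>B\<ge>0. \<forall>s\<ge>1. \<forall>r\<ge>s. \<bar>f r - f s\<bar> \<le> B / s" for f :: "real \<Rightarrow> real"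
  proof -
    obtain B where B: "B \<ge> 0" "\<And>s r. s \<ge> 1 \<Longrightarrow> r \<ge> s \<Longrightarrow> \<bar>f r - f s\<bar> \<le> B / s" using f by auto
    have "Cauchy (\<lambda>n. f (real n))"
    proof (rule metric_CauchyI)
      fix e :: real assume e: "e > 0"
      define N where "N = Suc (nat \<lceil>2 * B / e\<rceil>)"
      have N1: "real N \<ge> 1" and NB: "real N > 2 * B / e" unfolding N_def by linarith+
      have *: "\<bar>f (real n) - f (real N)\<bar> < e / 2" if "n \<ge> N" for n
      proof -
        have "\<bar>f (real n) - f (real N)\<bar> \<le> B / real N" using B(2) N1 that by auto
        also have "\<dots> < e / 2" using NB N1 e by (simp add: field_simps)
        finally show ?thesis .
      qed
      show "\<exists>M. \<forall>m\<ge>M. \<forall>n\<ge>M. dist (f (real m)) (f (real n)) < e"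
      proof (intro exI[of _ N] allI impI)
        fix m n assume "N \<le> m" "N \<le> n"
        then show "dist (f (real m)) (f (real n)) < e"
          using *[of m] *[of n] unfolding dist_real_def by linarith
      qed
    qed
    then obtain l where l: "(\<lambda>n. f (real n)) \<longlonglongrightarrow> l" using Cauchy_convergent convergent_def by blast
    show ?thesis
    proof (intro exI[of _ l] allI impI)
      fix s0 B' s :: real
      assume s0: "s0 > 0" and b: "\<forall>s\<ge>s0. \<forall>r\<ge>s. \<bar>f r - f s\<bar> \<le> B' / s" and s: "s \<ge> s0"
      have "(\<lambda>n. \<bar>f s - f (real n)\<bar>) \<longlonglongrightarrow> \<bar>f s - l\<bar>" by (intro tendsto_intros l)
      moreover have "\<forall>\<^sub>F n in sequentially. \<bar>f s - f (real n)\<bar> \<le> B' / s"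
        using eventually_ge_at_top[of "nat \<lceil>s\<rceil>"]
      proof eventually_elim
        case (elim n)
        then have "real n \<ge> s" by linarith
        then show ?case using b s by (simp add: abs_minus_commute)
      qed
      ultimately show "\<bar>f s - l\<bar> \<le> B' / s" by (rule tendsto_upperbound) simp
    qed
  qed
  obtain a where a: "\<And>s0 B s. s0 > 0 \<Longrightarrow> (\<forall>s\<ge>s0. \<forall>r\<ge>s. \<bar>P r - P s\<bar> \<le> B / s) \<Longrightarrow> s \<ge> s0 \<Longrightarrow> \<bar>P s - a\<bar> \<le> B / s"
    using lim[of P] osc[of 1] by (metis zero_less_one)
  obtain b where b: "\<And>s0 B s. s0 > 0 \<Longrightarrow> (\<forall>s\<ge>s0. \<forall>r\<ge>s. \<bar>Q r - Q s\<bar> \<le> B / s) \<Longrightarrow> s \<ge> s0 \<Longrightarrow> \<bar>Q s - b\<bar> \<le> B / s"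
    using lim[of Q] osc[of 1] by (metis zero_less_one)
  \<comment> \<open>Amplitude and phase are the polar coordinates of the limit (a, b) of (P,
    Q).\<close>
  obtain \<rho> c where \<rho>: "a = \<rho> * cos c" "b = \<rho> * sin c" using polar_Ex by blast
  have "\<exists>C\<ge>0. \<forall>s\<ge>s0. \<bar>A s - \<rho> * cos (s - c)\<bar> \<le> C / s \<and> \<bar>A' s + \<rho> * sin (s - c)\<bar> \<le> C / s"
    if s0: "s0 > 0" for s0
  proof -
    obtain B where B: "B \<ge> 0" "\<forall>s\<ge>s0. \<forall>r\<ge>s. \<bar>P r - P s\<bar> \<le> B / s" "\<forall>s\<ge>s0. \<forall>r\<ge>s. \<bar>Q r - Q s\<bar> \<le> B / s"
      using osc[OF s0] by blast
    have comb: "\<bar>(P s - a) * u + (Q s - b) * w\<bar> \<le> 2 * B / s" if "s \<ge> s0" "\<bar>u\<bar> \<le> 1" "\<bar>w\<bar> \<le> 1" for s u w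
    proof -
      have "\<bar>(P s - a) * u + (Q s - b) * w\<bar> \<le> \<bar>P s - a\<bar> * \<bar>u\<bar> + \<bar>Q s - b\<bar> * \<bar>w\<bar>"
        by (rule order_trans[OF abs_triangle_ineq]) (simp add: abs_mult)
      also have "\<dots> \<le> B / s * 1 + B / s * 1"
        using a[OF s0 B(2) that(1)] b[OF s0 B(3) that(1)] that B(1) s0
        by (intro add_mono mult_mono) auto
      finally show ?thesis by simp
    qed
    \<comment> \<open>The rotation by s is inverted: A and A' are recovered from P and Q, and the
      cosine from a and b, with the same coefficients.\<close>
    have "A s - \<rho> * cos (s - c) = (P s - a) * cos s + (Q s - b) * sin s" for s
    proof -
      have "P s * cos s + Q s * sin s = A s * (cos s * cos s + sin s * sin s)"
        by (simp add: P_def Q_def algebra_simps del: sin_cos_squared_add3)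
      then show ?thesis by (simp add: \<rho> cos_diff algebra_simps)
    qed
    moreover have "A' s + \<rho> * sin (s - c) = (P s - a) * (- sin s) + (Q s - b) * cos s" for s
    proof -
      have "- P s * sin s + Q s * cos s = A' s * (cos s * cos s + sin s * sin s)"
        by (simp add: P_def Q_def algebra_simps del: sin_cos_squared_add3)
      then show ?thesis by (simp add: \<rho> sin_diff algebra_simps)
    qed
    ultimately show ?thesis using B(1) comb by (intro exI[of _ "2 * B"] conjI allI impI) (simp, metis abs_cos_le_one abs_sin_le_one, metis abs_cos_le_one abs_sin_le_one abs_minus_cancel)
  qed
  then show ?thesis by (rule that)
qed

lemma bessel_osc_asymptotics:
  assumes "\<nu> > -1"
  obtains \<rho> c where "\<And>s0. s0 > 0 \<Longrightarrow>
    \<exists>C\<ge>0. \<forall>s\<ge>s0. \<bar>bessel_osc \<nu> s - \<rho> * cos (s - c)\<bar> \<le> C / s \<and> \<bar>bessel_osc_deriv \<nu> s + \<rho> * sin (s - c)\<bar> \<le> C / s"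
  using perturbed_oscillator_asymptotics[OF DERIV_bessel_osc[OF assms] DERIV_bessel_osc_deriv[OF assms]] by blast

section \<open>Size bounds and the transform of a Gaussian\<close>

lemma bessel_quot_bound_near_0:
  assumes "\<nu> > -1"
  shows "\<exists>C\<ge>0. \<forall>s. 0 < s \<and> s \<le> S \<longrightarrow> \<bar>bessel_quot \<nu> s\<bar> \<le> C"
proof -
  have "isCont (bessel_series \<nu>) r" for r
    by (rule DERIV_isCont[OF DERIV_bessel_series[OF assms]])
  then have "continuous_on UNIV (bessel_series \<nu>)"
    by (simp add: continuous_on_eq_continuous_at)
  then have "continuous_on {0..S} (\<lambda>s. bessel_series \<nu> (s\<^sup>2))"
    by (rule continuous_on_compose2) (auto intro: continuous_intros)
  from compact_imp_bounded[OF compact_continuous_image[OF this compact_Icc]]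
  obtain C where C: "\<forall>s\<in>{0..S}. \<bar>bessel_series \<nu> (s\<^sup>2)\<bar> \<le> C"
    by (auto simp: bounded_iff)
  have "\<bar>bessel_quot \<nu> s\<bar> \<le> \<bar>C\<bar>" if "0 < s \<and> s \<le> S" for s
    using bspec[OF C, of s] bessel_quot_eq_series[OF assms, of s] that by simp
  then show ?thesis by (intro exI[of _ "\<bar>C\<bar>"]) simp
qed

lemma bessel_osc_bound:
  assumes "\<nu> > -1" "s0 > 0"
  shows "\<exists>C\<ge>0. \<forall>s\<ge>s0. \<bar>bessel_osc \<nu> s\<bar> \<le> C"
  using bounded_of_perturbed_oscillator[OF DERIV_bessel_osc[OF assms(1)] DERIV_bessel_osc_deriv[OF assms(1)] assms(2)]
  by blast

lemma bessel_quot_bound_at_top: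
  assumes "\<nu> > -1" "s0 > 0"
  shows "\<exists>C\<ge>0. \<forall>s\<ge>s0. \<bar>bessel_quot \<nu> s\<bar> \<le> C * s powr (- \<nu> - 1/2)"
proof -
  obtain C where C: "C \<ge> 0" "\<forall>s\<ge>s0. \<bar>bessel_osc \<nu> s\<bar> \<le> C" using bessel_osc_bound[OF assms] by auto
  have "\<bar>bessel_quot \<nu> s\<bar> \<le> C * s powr (- \<nu> - 1/2)" if "s \<ge> s0" for s
    using bessel_quot_eq_osc[of s \<nu>] that C assms(2)
    by (auto simp: abs_mult mult.commute intro!: mult_right_mono)
  with C(1) show ?thesis by blast
qed

text \<open>Integrating term by term, the Gamma factor of each Gaussian moment cancels the
  \<open>rGamma\<close> of the Bessel coefficient and leaves the exponential series in
  \<open>- x\<^sup>2 / (4 * u)\<close>. The interchange is legitimate because the integrals of the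
  absolute values form the same series with the sign of the argument reversed.\<close>

lemma has_bochner_integral_gauss_bessel:
  assumes "\<alpha> > -1" "u > 0" "x > 0"
  shows "has_bochner_integral (\<mu> \<alpha>) (\<lambda>y. exp (- u * y\<^sup>2) * bessel_quot \<alpha> (x * y))
           ((2 * u) powr (- \<alpha> - 1) * exp (- x\<^sup>2 / (4 * u)))"
proof -
  define F where "F k y = bessel_coeff \<alpha> k * x ^ (2 * k) * (y ^ (2 * k) * exp (- u * y\<^sup>2))" for k y
  define I where "I k = bessel_coeff \<alpha> k * x ^ (2 * k) * (Gamma (real k + \<alpha> + 1) / (2 * u powr (real k + \<alpha> + 1)))" for k
  define E where "E = (2 * u) powr (- \<alpha> - 1)"
  have Gpos: "Gamma (real k + \<alpha> + 1) > 0" for k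
    by (rule Gamma_real_pos) (use assms in linarith)
  have F: "has_bochner_integral (\<mu> \<alpha>) (F k) (I k)" for k
    unfolding F_def I_def by (intro has_bochner_integral_mult_right has_bochner_integral_mu_gauss assms)
  have I: "I k = E * ((- x\<^sup>2 / (4 * u)) ^ k /\<^sub>R fact k)" for k
  proof -
    have G: "rGamma (real k + \<alpha> + 1) * Gamma (real k + \<alpha> + 1) = 1"
      using Gpos[of k] by (simp add: rGamma_inverse_Gamma)
    have "I k = (-1) ^ k * (rGamma (real k + \<alpha> + 1) * Gamma (real k + \<alpha> + 1)) * x ^ (2 * k) /
        (fact k * 4 ^ k * (2 powr \<alpha> * 2) * u powr (real k + \<alpha> + 1))"
      by (simp add: I_def bessel_coeff_def mult_ac)
    also have "\<dots> = (-1) ^ k * x ^ (2 * k) / (fact k * 4 ^ k * u ^ k * ((2 * u) powr (\<alpha> + 1)))"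
      unfolding G using assms by (simp add: powr_add powr_realpow powr_mult mult_ac)
    also have "\<dots> = E * ((- x\<^sup>2 / (4 * u)) ^ k /\<^sub>R fact k)"
    proof -
      have pw: "(- x\<^sup>2 / (4 * u)) ^ k = (-1) ^ k * x ^ (2 * k) / (4 ^ k * u ^ k)"
        by (simp add: power_divide power_mult_distrib power_mult power_minus[of "x\<^sup>2 / (4 * u)"])
      have E: "E = inverse ((2 * u) powr (\<alpha> + 1))"
        using powr_minus[of "2 * u" "\<alpha> + 1"] by (simp add: E_def)
      show ?thesis unfolding pw E real_scaleR_def by (simp add: divide_inverse mult_ac)
    qed
    finally show ?thesis .
  qed
  have absI: "(LINT y|\<mu> \<alpha>. norm (F k y)) = \<bar>I k\<bar>" for k
  proof -
    have ab: "\<bar>b\<bar> = sgn b * b" for b :: real by (simp add: sgn_if)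
    have "norm (F k y) = \<bar>bessel_coeff \<alpha> k\<bar> * (x ^ (2 * k) * (y ^ (2 * k) * exp (- u * y\<^sup>2)))" for y
      unfolding F_def real_norm_def abs_mult by (simp add: power_mult)
    then have "norm (F k y) = sgn (bessel_coeff \<alpha> k) * F k y" for y
      unfolding ab F_def by (simp only: mult.assoc)
    then have "(LINT y|\<mu> \<alpha>. norm (F k y)) = sgn (bessel_coeff \<alpha> k) * I k"
      using F[of k] by (simp add: has_bochner_integral_iff)
    also have "sgn (bessel_coeff \<alpha> k) * I k = \<bar>bessel_coeff \<alpha> k\<bar> * (x ^ (2 * k) * (Gamma (real k + \<alpha> + 1) / (2 * u powr (real k + \<alpha> + 1))))"
      unfolding ab I_def by (simp only: mult.assoc)
    also have "\<dots> = \<bar>I k\<bar>"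
      unfolding I_def abs_mult using Gpos[of k] assms by simp
    finally show ?thesis .
  qed
  have Feq: "F k y = exp (- u * y\<^sup>2) * (bessel_coeff \<alpha> k * ((x * y)\<^sup>2) ^ k)" for k y
  proof -
    have "((x * y)\<^sup>2) ^ k = x ^ (2 * k) * y ^ (2 * k)"
      by (simp add: power_mult_distrib flip: power_mult)
    then show ?thesis unfolding F_def by (simp only: mult_ac)
  qed
  have sumF: "(\<lambda>k. F k y) sums (exp (- u * y\<^sup>2) * bessel_quot \<alpha> (x * y))" if "y > 0" for y
  proof -
    have "bessel_quot \<alpha> (x * y) = bessel_series \<alpha> ((x * y)\<^sup>2)"
      by (rule bessel_quot_eq_series) (use that assms in auto)
    then show ?thesis unfolding Feq bessel_series_def
      by (simp only:) (intro sums_mult summable_sums summable_bessel_series assms)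
  qed
  \<comment> \<open>For \<alpha> > -1 the coefficients alternate in sign, so the series of absolute
    values is the Bessel series at the negative argument, which converges as well.\<close>
  have norm_sum: "summable (\<lambda>k. norm (F k y))" for y
  proof -
    have "summable (\<lambda>k. bessel_coeff \<alpha> k * (- ((x * y)\<^sup>2)) ^ k)" by (rule summable_bessel_series[OF assms(1)])
    moreover have "norm (F k y) = exp (- u * y\<^sup>2) * (bessel_coeff \<alpha> k * (- ((x * y)\<^sup>2)) ^ k)" for k
    proof -
      have "rGamma (real k + \<alpha> + 1) > 0"
        using Gpos[of k] by (simp add: rGamma_inverse_Gamma)
      then have "\<bar>bessel_coeff \<alpha> k\<bar> = bessel_coeff \<alpha> k * (-1) ^ k"
        by (simp add: bessel_coeff_def abs_mult power_mult_distrib[symmetric])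
      then show ?thesis
        unfolding Feq real_norm_def abs_mult power_minus[of "(x * y)\<^sup>2"] by simp
    qed
    ultimately show ?thesis by (simp add: summable_mult)
  qed
  have sI: "summable (\<lambda>k. \<bar>I k\<bar>)"
  proof -
    have "summable (\<lambda>k. (x\<^sup>2 / (4 * u)) ^ k /\<^sub>R fact k)" by (rule sums_summable[OF exp_converges])
    then have "summable (\<lambda>k. \<bar>E\<bar> * ((x\<^sup>2 / (4 * u)) ^ k /\<^sub>R fact k))" by (rule summable_mult)
    moreover have "\<bar>I k\<bar> = \<bar>E\<bar> * ((x\<^sup>2 / (4 * u)) ^ k /\<^sub>R fact k)" for k
      using assms by (simp add: I abs_mult power_abs abs_divide)
    ultimately show ?thesis by simp
  qed
  have prem: "\<And>k. integrable (\<mu> \<alpha>) (F k)" "AE y in \<mu> \<alpha>. summable (\<lambda>k. norm (F k y))"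
    "summable (\<lambda>k. LINT y|\<mu> \<alpha>. norm (F k y))"
    using F norm_sum sI absI by (auto simp: has_bochner_integral_iff)
  have "has_bochner_integral (\<mu> \<alpha>) (\<lambda>y. \<Sum>k. F k y) (\<Sum>k. I k)"
    using integrable_suminf[OF prem] integral_suminf[OF prem] F by (simp add: has_bochner_integral_iff)
  moreover have "(\<Sum>k. I k) = E * exp (- x\<^sup>2 / (4 * u))"
    using sums_mult[OF exp_converges[of "- x\<^sup>2 / (4 * u)"], of E] by (simp add: I sums_iff)
  ultimately show ?thesis
    using sumF by (subst has_bochner_integral_cong[of _ "\<mu> \<alpha>" _ "\<lambda>y. \<Sum>k. F k y"]) (auto simp: E_def sums_iff)
qed

section \<open>The Hankel transform as an isometry\<close>

lemma sq_norm_tendsto_integral: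
  assumes F: "\<And>n. F n \<in> sq_integrable M" and f: "f \<in> sq_integrable M" and g: "g \<in> sq_integrable M"
    and lim: "(\<lambda>n. sq_norm M (\<lambda>x. F n x - f x)) \<longlonglongrightarrow> 0"
  shows "(\<lambda>n. LINT x|M. F n x * g x) \<longlonglongrightarrow> (LINT x|M. f x * g x)"
proof (rule Lim_null_comparison[THEN LIM_zero_cancel])
  show "\<forall>\<^sub>F n in sequentially. norm ((LINT x|M. F n x * g x) - (LINT x|M. f x * g x))
      \<le> sq_norm M (\<lambda>x. F n x - f x) * sq_norm M g"
  proof (rule always_eventually, rule allI)
    fix n
    have "(LINT x|M. F n x * g x) - (LINT x|M. f x * g x) = (LINT x|M. (F n x - f x) * g x)"
      unfolding left_diff_distrib
      by (rule Bochner_Integration.integral_diff[symmetric]) (intro sq_integrable_mult_integrable F f g)+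
    then show "norm ((LINT x|M. F n x * g x) - (LINT x|M. f x * g x))
      \<le> sq_norm M (\<lambda>x. F n x - f x) * sq_norm M g"
      using cmod_integral_mult_le[OF sq_integrable_diff[OF F[of n] f] g] by simp
  qed
  show "(\<lambda>n. sq_norm M (\<lambda>x. F n x - f x) * sq_norm M g) \<longlonglongrightarrow> 0"
    using tendsto_mult_right[OF lim, of "sq_norm M g"] by simp
qed

text \<open>Families with the same Gram matrix have combinations of the same norm, since the squared
  norm is a quadratic form in that matrix. The families are real and only the coefficients complex,
  hence the conjugate appears on a alone.\<close>

lemma sq_norm_sum_eq:
  fixes u :: "nat \<Rightarrow> 'a \<Rightarrow> real" and v :: "nat \<Rightarrow> 'b \<Rightarrow> real" and a :: "nat \<Rightarrow> complex"
  assumes "\<And>j k. integrable M (\<lambda>x. u j x * u k x)" "\<And>j k. integrable M' (\<lambda>x. v j x * v k x)"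
    and "\<And>j k. (LINT x|M. u j x * u k x) = (LINT x|M'. v j x * v k x)"
  shows "integrable M (\<lambda>x. (cmod (\<Sum>k\<in>A. a k * of_real (u k x)))\<^sup>2)"
    "sq_norm M (\<lambda>x. \<Sum>k\<in>A. a k * of_real (u k x)) = sq_norm M' (\<lambda>x. \<Sum>k\<in>A. a k * of_real (v k x))"
proof -
  have expand: "(cmod (\<Sum>k\<in>A. a k * of_real (w k)))\<^sup>2 = (\<Sum>j\<in>A. \<Sum>k\<in>A. Re (a j * cnj (a k)) * (w j * w k))"
    for w :: "nat \<Rightarrow> real"
  proof -
    have "complex_of_real ((cmod (\<Sum>k\<in>A. a k * of_real (w k)))\<^sup>2)
        = (\<Sum>j\<in>A. a j * of_real (w j)) * cnj (\<Sum>k\<in>A. a k * of_real (w k))"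
      by (rule complex_norm_square)
    also have "\<dots> = (\<Sum>j\<in>A. \<Sum>k\<in>A. (a j * cnj (a k)) * of_real (w j * w k))"
      by (simp add: cnj_sum sum_product mult_ac)
    finally have "Re (complex_of_real ((cmod (\<Sum>k\<in>A. a k * of_real (w k)))\<^sup>2))
        = Re (\<Sum>j\<in>A. \<Sum>k\<in>A. (a j * cnj (a k)) * of_real (w j * w k))" by simp
    then show ?thesis by (simp add: Re_sum del: of_real_mult)
  qed
  show "integrable M (\<lambda>x. (cmod (\<Sum>k\<in>A. a k * of_real (u k x)))\<^sup>2)"
    unfolding expand by (intro Bochner_Integration.integrable_sum integrable_mult_right assms)
  have "(LINT x|M. (cmod (\<Sum>k\<in>A. a k * of_real (u k x)))\<^sup>2)
      = (LINT x|M'. (cmod (\<Sum>k\<in>A. a k * of_real (v k x)))\<^sup>2)"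
    unfolding expand using assms by simp
  then show "sq_norm M (\<lambda>x. \<Sum>k\<in>A. a k * of_real (u k x)) = sq_norm M' (\<lambda>x. \<Sum>k\<in>A. a k * of_real (v k x))"
    by (simp add: sq_norm_def)
qed

lemma hankel_integral_measurable:
  assumes "f \<in> borel_measurable (\<mu> \<alpha>)"
  shows "hankel_integral \<alpha> f \<in> borel_measurable (\<mu> \<alpha>)"
proof -
  interpret sigma_finite_measure "\<mu> \<alpha>" by (rule sigma_finite_mu)
  note [measurable] = assms measurable_ident_mu
  note [measurable_cong] = sets_mu
  show ?thesis
    unfolding hankel_integral_def hankel_integrand_def
    by (rule borel_measurable_lebesgue_integral) measurable
qed

lemma bessel_trunc_sq_integrable:
  assumes "\<alpha> > -1" "\<nu> > -1" "x > 0"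
  shows "(\<lambda>y. complex_of_real (indicator {0<..N} y * bessel_quot \<nu> (x * y))) \<in> sq_integrable (\<mu> \<alpha>)"
proof -
  obtain C where C: "C \<ge> 0" "\<And>s. 0 < s \<and> s \<le> x * N \<Longrightarrow> \<bar>bessel_quot \<nu> s\<bar> \<le> C"
    using bessel_quot_bound_near_0[OF assms(2), of "x * N"] by blast
  show ?thesis
  proof (rule sq_integrable_bound)
    show "(\<lambda>y. complex_of_real (indicator {0<..N} y * bessel_quot \<nu> (x * y))) \<in> borel_measurable (\<mu> \<alpha>)"
      by (rule borel_measurable_mu) measurable
    show "integrable (\<mu> \<alpha>) (\<lambda>y. C\<^sup>2 * indicator {0<..N} y)"
      by (intro integrable_mult_right integrable_mu_indicator assms)
    have "(cmod (complex_of_real (indicator {0<..N} y * bessel_quot \<nu> (x * y))))\<^sup>2 \<le> C\<^sup>2 * indicator {0<..N} y" for y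
    proof (cases "y \<in> {0<..N}")
      case True
      then have "\<bar>bessel_quot \<nu> (x * y)\<bar> \<le> C" by (intro C) (use assms in auto)
      then show ?thesis using True abs_le_square_iff[of "bessel_quot \<nu> (x * y)" C] C(1) by simp
    qed simp
    then show "AE y in \<mu> \<alpha>. (cmod (complex_of_real (indicator {0<..N} y * bessel_quot \<nu> (x * y))))\<^sup>2 \<le> C\<^sup>2 * indicator {0<..N} y"
      by (intro AE_I2)
  qed
qed

text \<open>If f vanishes beyond N, its Hankel integral is a pairing of f with a square integrable
  function. So it converges absolutely at every x > 0 and depends continuously on f in mean square
  for a fixed N.\<close>

lemma
  assumes "\<alpha> > -1" "f \<in> sq_integrable (\<mu> \<alpha>)" "\<And>y. y > N \<Longrightarrow> f y = 0" "x > 0"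
  shows hankel_integrand_integrable_bounded_support: "integrable (\<mu> \<alpha>) (hankel_integrand \<alpha> f x)"
    and hankel_integral_bounded_support:
      "hankel_integral \<alpha> f x = (LINT y|\<mu> \<alpha>. f y * complex_of_real (indicator {0<..N} y * bessel_quot \<alpha> (x * y)))"
proof -
  have eq: "hankel_integrand \<alpha> f x y = f y * complex_of_real (indicator {0<..N} y * bessel_quot \<alpha> (x * y))"
    if "y \<in> space (\<mu> \<alpha>)" for y
    using assms(3)[of y] that by (cases "y \<le> N") (auto simp: hankel_integrand_def)
  show "integrable (\<mu> \<alpha>) (hankel_integrand \<alpha> f x)"
    using sq_integrable_mult_integrable[OF assms(2) bessel_trunc_sq_integrable[OF assms(1,1,4), of N]]
    by (subst Bochner_Integration.integrable_cong[OF refl eq])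
  show "hankel_integral \<alpha> f x = (LINT y|\<mu> \<alpha>. f y * complex_of_real (indicator {0<..N} y * bessel_quot \<alpha> (x * y)))"
    unfolding hankel_integral_def by (rule Bochner_Integration.integral_cong[OF refl eq])
qed

lemma hankel_integral_diff:
  assumes "integrable (\<mu> \<alpha>) (hankel_integrand \<alpha> f x)" "integrable (\<mu> \<alpha>) (hankel_integrand \<alpha> g x)"
  shows "hankel_integral \<alpha> (\<lambda>y. f y - g y) x = hankel_integral \<alpha> f x - hankel_integral \<alpha> g x"
  using assms unfolding hankel_integral_def hankel_integrand_def left_diff_distrib
  by (rule Bochner_Integration.integral_diff)

text \<open>A property of single functions; comparing two of them requires it of their difference
  too. Absolute convergence is asked at every x > 0, which makes the integral subtractive at each
  point.\<close>

definition hankel_isometric :: "real \<Rightarrow> (real \<Rightarrow> complex) \<Rightarrow> bool" where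
  "hankel_isometric \<alpha> f \<longleftrightarrow> f \<in> sq_integrable (\<mu> \<alpha>) \<and> hankel_integral \<alpha> f \<in> sq_integrable (\<mu> \<alpha>) \<and>
     sq_norm (\<mu> \<alpha>) (hankel_integral \<alpha> f) = sq_norm (\<mu> \<alpha>) f \<and>
     (\<forall>x>0. integrable (\<mu> \<alpha>) (hankel_integrand \<alpha> f x))"

lemma hankel_isometric_diff:
  assumes "hankel_isometric \<alpha> f" "hankel_isometric \<alpha> g" "hankel_isometric \<alpha> (\<lambda>y. f y - g y)"
  shows "sq_norm (\<mu> \<alpha>) (\<lambda>x. hankel_integral \<alpha> f x - hankel_integral \<alpha> g x) = sq_norm (\<mu> \<alpha>) (\<lambda>y. f y - g y)"
proof -
  have "sq_norm (\<mu> \<alpha>) (\<lambda>x. hankel_integral \<alpha> f x - hankel_integral \<alpha> g x)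
      = sq_norm (\<mu> \<alpha>) (hankel_integral \<alpha> (\<lambda>y. f y - g y))"
  proof (rule sq_norm_cong_AE)
    show "AE x in \<mu> \<alpha>. hankel_integral \<alpha> f x - hankel_integral \<alpha> g x = hankel_integral \<alpha> (\<lambda>y. f y - g y) x"
      by (rule AE_I2) (use assms hankel_integral_diff in \<open>auto simp: hankel_isometric_def\<close>)
    show "(\<lambda>x. hankel_integral \<alpha> f x - hankel_integral \<alpha> g x) \<in> borel_measurable (\<mu> \<alpha>)"
      using assms by (intro borel_measurable_diff sq_integrable_measurable) (auto simp: hankel_isometric_def)
    show "hankel_integral \<alpha> (\<lambda>y. f y - g y) \<in> borel_measurable (\<mu> \<alpha>)"
      using assms by (intro sq_integrable_measurable) (auto simp: hankel_isometric_def)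
  qed
  with assms(3) show ?thesis by (simp add: hankel_isometric_def)
qed

text \<open>The induction step of the density argument, applied twice: from Gaussians to continuous
  functions of bounded support, and from these to bounded measurable ones. Pointwise convergence of
  the integrals is what names the limit of the images.\<close>

lemma hankel_isometric_limit:
  assumes F: "\<And>n. hankel_isometric \<alpha> (F n)" "\<And>m n. hankel_isometric \<alpha> (\<lambda>y. F m y - F n y)"
    and f: "f \<in> sq_integrable (\<mu> \<alpha>)" and int: "\<And>x. x > 0 \<Longrightarrow> integrable (\<mu> \<alpha>) (hankel_integrand \<alpha> f x)"
    and lim: "(\<lambda>n. sq_norm (\<mu> \<alpha>) (\<lambda>y. F n y - f y)) \<longlonglongrightarrow> 0"
    and ptw: "\<And>x. x > 0 \<Longrightarrow> (\<lambda>n. hankel_integral \<alpha> (F n) x) \<longlonglongrightarrow> hankel_integral \<alpha> f x"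
  shows "hankel_isometric \<alpha> f"
proof -
  have "AE x in \<mu> \<alpha>. (\<lambda>n. hankel_integral \<alpha> (F n) x) \<longlonglongrightarrow> hankel_integral \<alpha> f x"
    by (rule AE_I2) (use ptw in simp)
  moreover have "hankel_integral \<alpha> f \<in> borel_measurable (\<mu> \<alpha>)"
    by (rule hankel_integral_measurable[OF sq_integrable_measurable[OF f]])
  moreover have "F n \<in> sq_integrable (\<mu> \<alpha>)" "hankel_integral \<alpha> (F n) \<in> sq_integrable (\<mu> \<alpha>)"
    "sq_norm (\<mu> \<alpha>) (hankel_integral \<alpha> (F n)) = sq_norm (\<mu> \<alpha>) (F n)" for n
    using F(1)[of n] by (auto simp: hankel_isometric_def)
  moreover note hankel_isometric_diff[OF F(1) F(1) F(2)]
  ultimately have "hankel_integral \<alpha> f \<in> sq_integrable (\<mu> \<alpha>)"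
    "sq_norm (\<mu> \<alpha>) (hankel_integral \<alpha> f) = sq_norm (\<mu> \<alpha>) f"
    using sq_norm_isometric_limit(1,2)[of F "\<mu> \<alpha>" f "\<lambda>n. hankel_integral \<alpha> (F n)" "\<mu> \<alpha>" "hankel_integral \<alpha> f"]
      f lim by blast+
  then show ?thesis using f int by (simp add: hankel_isometric_def)
qed

section \<open>The isometry on Gaussians\<close>

text \<open>The span of the functions \<open>exp (- c * y\<^sup>2)\<close> for c = 1, 2, ...,
  written as polynomials in \<open>exp (- y\<^sup>2)\<close> without constant term. The extracted
  factor provides the decay at infinity.\<close>

definition gauss_poly :: "complex poly \<Rightarrow> real \<Rightarrow> complex" where
  "gauss_poly p y = of_real (exp (- y\<^sup>2)) * poly p (of_real (exp (- y\<^sup>2)))"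

lemma gauss_poly_eq_sum:
  "gauss_poly p y = (\<Sum>k\<le>degree p. coeff p k * of_real (exp (- (real k + 1) * y\<^sup>2)))"
proof -
  have "exp (- y\<^sup>2) * exp (- y\<^sup>2) ^ k = exp (- (real k + 1) * y\<^sup>2)" for k
    by (simp add: exp_of_nat_mult[symmetric] exp_add[symmetric] algebra_simps)
  then have "complex_of_real (exp (- y\<^sup>2)) * of_real (exp (- y\<^sup>2)) ^ k = of_real (exp (- (real k + 1) * y\<^sup>2))" for k
    by (metis of_real_mult of_real_power)
  then show ?thesis
    unfolding gauss_poly_def poly_altdef sum_distrib_left
    by (intro sum.cong refl) (metis mult.left_commute)
qed

lemma gauss_poly_diff: "gauss_poly p y - gauss_poly q y = gauss_poly (p - q) y"
  by (simp add: gauss_poly_def algebra_simps)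

text \<open>The transform sends \<open>u k\<close> to \<open>v k\<close>, and both families have the
  Gram entries \<open>Gamma (\<alpha> + 1) / (2 * (c j + c k) powr (\<alpha> + 1))\<close>.\<close>

lemma hankel_isometric_gauss_poly:
  assumes \<alpha>: "\<alpha> > -1"
  shows "hankel_isometric \<alpha> (gauss_poly p)"
proof -
  define c where "c k = real k + 1" for k
  define u where "u k y = exp (- c k * y\<^sup>2)" for k and y :: real
  define v where "v k x = (2 * c k) powr (- \<alpha> - 1) * exp (- x\<^sup>2 / (4 * c k))" for k and x :: real
  have c: "c k > 0" for k by (simp add: c_def)
  have uu: "has_bochner_integral (\<mu> \<alpha>) (\<lambda>y. u j y * u k y) (Gamma (\<alpha> + 1) / (2 * (c j + c k) powr (\<alpha> + 1)))" for j k
    using has_bochner_integral_mu_gauss[OF \<alpha>, of "c j + c k" 0] c[of j] c[of k]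
    by (simp add: u_def algebra_simps flip: exp_add)
  have vv: "has_bochner_integral (\<mu> \<alpha>) (\<lambda>x. v j x * v k x) (Gamma (\<alpha> + 1) / (2 * (c j + c k) powr (\<alpha> + 1)))" for j k
  proof -
    define d where "d = 1 / (4 * c j) + 1 / (4 * c k)"
    have d: "d > 0" unfolding d_def using c by (intro add_pos_pos) simp_all
    define K where "K = (2 * c j) powr (- \<alpha> - 1) * (2 * c k) powr (- \<alpha> - 1)"
    have "has_bochner_integral (\<mu> \<alpha>) (\<lambda>x. K * (x ^ (2 * 0) * exp (- d * x\<^sup>2))) (K * (Gamma (real 0 + \<alpha> + 1) / (2 * d powr (real 0 + \<alpha> + 1))))"
      by (intro has_bochner_integral_mult_right has_bochner_integral_mu_gauss \<alpha> d)
    moreover have "K * (x ^ (2 * 0) * exp (- d * x\<^sup>2)) = v j x * v k x" for x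
    proof -
      have "exp (- d * x\<^sup>2) = exp (- x\<^sup>2 / (4 * c j)) * exp (- x\<^sup>2 / (4 * c k))"
        by (simp add: d_def exp_add[symmetric] algebra_simps)
      then show ?thesis by (simp add: K_def v_def)
    qed
    moreover have "K * (Gamma (real 0 + \<alpha> + 1) / (2 * d powr (real 0 + \<alpha> + 1))) = Gamma (\<alpha> + 1) / (2 * (c j + c k) powr (\<alpha> + 1))"
    proof -
      \<comment> \<open>The identity behind the isometry: the exponents of the transformed Gaussians
        add up to d, and their prefactors supply exactly the factors \<open>2 * c j\<close> and
        \<open>2 * c k\<close> that turn d back into \<open>c j + c k\<close>.\<close>
      have "c j + c k = 2 * c j * (2 * c k) * d"
        using c[of j] c[of k] by (simp add: d_def field_simps)
      then have "(c j + c k) powr (\<alpha> + 1) = (2 * c j * (2 * c k) * d) powr (\<alpha> + 1)" by simp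
      also have "\<dots> = (2 * c j) powr (\<alpha> + 1) * (2 * c k) powr (\<alpha> + 1) * d powr (\<alpha> + 1)"
      proof -
        have "(2 * c j * (2 * c k) * d) powr (\<alpha> + 1) = (2 * c j * (2 * c k)) powr (\<alpha> + 1) * d powr (\<alpha> + 1)"
          by (rule powr_mult)
        also have "(2 * c j * (2 * c k)) powr (\<alpha> + 1) = (2 * c j) powr (\<alpha> + 1) * (2 * c k) powr (\<alpha> + 1)"
          by (rule powr_mult)
        finally show ?thesis .
      qed
      finally have S: "(c j + c k) powr (\<alpha> + 1) = (2 * c j) powr (\<alpha> + 1) * (2 * c k) powr (\<alpha> + 1) * d powr (\<alpha> + 1)" .
      have Keq: "K = inverse ((2 * c j) powr (\<alpha> + 1)) * inverse ((2 * c k) powr (\<alpha> + 1))"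
        using powr_minus[of "2 * c j" "\<alpha> + 1"] powr_minus[of "2 * c k" "\<alpha> + 1"] by (simp add: K_def)
      show ?thesis unfolding S Keq by (simp add: field_simps)
    qed
    ultimately show ?thesis by simp
  qed
  define A where "A = {..degree p}"
  have gp: "gauss_poly p y = (\<Sum>k\<in>A. coeff p k * of_real (u k y))" for y
    unfolding gauss_poly_eq_sum A_def u_def c_def ..
  have int1: "has_bochner_integral (\<mu> \<alpha>) (\<lambda>y. (\<Sum>k\<in>A. coeff p k * of_real (u k y)) * of_real (bessel_quot \<alpha> (x * y)))
      (\<Sum>k\<in>A. coeff p k * of_real (v k x))" if x: "x > 0" for x
  proof -
    have "has_bochner_integral (\<mu> \<alpha>) (\<lambda>y. \<Sum>k\<in>A. coeff p k * of_real (u k y * bessel_quot \<alpha> (x * y)))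
      (\<Sum>k\<in>A. coeff p k * of_real (v k x))"
      unfolding u_def v_def
      by (intro has_bochner_integral_sum has_bochner_integral_mult_right has_bochner_integral_of_real
            has_bochner_integral_gauss_bessel \<alpha> c x)
    then show ?thesis by (simp add: sum_distrib_right mult.assoc)
  qed
  have Hp: "hankel_integral \<alpha> (gauss_poly p) x = (\<Sum>k\<in>A. coeff p k * of_real (v k x))" if "x > 0" for x
    using int1[OF that] by (simp add: hankel_integral_def hankel_integrand_def gp has_bochner_integral_iff)
  have Ip: "integrable (\<mu> \<alpha>) (hankel_integrand \<alpha> (gauss_poly p) x)" if "x > 0" for x
    using int1[OF that] by (simp add: hankel_integrand_def[abs_def] gp has_bochner_integral_iff)
  have gm: "gauss_poly p \<in> borel_measurable (\<mu> \<alpha>)"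
    unfolding gp[abs_def] u_def by (rule borel_measurable_mu) measurable
  have eq: "integrable (\<mu> \<alpha>) (\<lambda>y. u j y * u k y)" "integrable (\<mu> \<alpha>) (\<lambda>y. v j y * v k y)"
    "(LINT y|\<mu> \<alpha>. u j y * u k y) = (LINT y|\<mu> \<alpha>. v j y * v k y)" for j k
    using uu[of j k] vv[of j k] by (auto simp: has_bochner_integral_iff)
  note U = sq_norm_sum_eq[of "\<mu> \<alpha>" u "\<mu> \<alpha>" v, OF eq]
  note V = sq_norm_sum_eq[of "\<mu> \<alpha>" v "\<mu> \<alpha>" u, OF eq(2,1) eq(3)[symmetric]]
  have fL: "gauss_poly p \<in> sq_integrable (\<mu> \<alpha>)"
    unfolding sq_integrable_def using gm U(1)[where A=A and a="coeff p"] by (simp add: gp)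
  have Hm: "hankel_integral \<alpha> (gauss_poly p) \<in> borel_measurable (\<mu> \<alpha>)"
    by (rule hankel_integral_measurable[OF gm])
  have Hae: "AE x in \<mu> \<alpha>. hankel_integral \<alpha> (gauss_poly p) x = (\<Sum>k\<in>A. coeff p k * of_real (v k x))"
    by (rule AE_I2) (use Hp in simp)
  have vm: "(\<lambda>x. \<Sum>k\<in>A. coeff p k * of_real (v k x)) \<in> borel_measurable (\<mu> \<alpha>)"
    unfolding v_def by (rule borel_measurable_mu) measurable
  have HL: "hankel_integral \<alpha> (gauss_poly p) \<in> sq_integrable (\<mu> \<alpha>)"
    by (rule sq_integrable_bound[OF Hm V(1)[where A=A and a="coeff p"]]) (use Hae in \<open>eventually_elim, simp\<close>)
  have "sq_norm (\<mu> \<alpha>) (hankel_integral \<alpha> (gauss_poly p)) = sq_norm (\<mu> \<alpha>) (\<lambda>x. \<Sum>k\<in>A. coeff p k * of_real (v k x))"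
    by (rule sq_norm_cong_AE[OF Hae Hm vm])
  also have "\<dots> = sq_norm (\<mu> \<alpha>) (gauss_poly p)"
    using U(2)[where A=A and a="coeff p"] by (simp add: gp[abs_def])
  finally show ?thesis using fL HL Ip by (simp add: hankel_isometric_def)
qed

section \<open>From Gaussians to bounded functions of bounded support\<close>

lemma polynomial_function_complex_poly:
  assumes "polynomial_function (g :: real \<Rightarrow> complex)"
  obtains p where "\<And>x. g x = poly p (of_real x)"
proof -
  have re: "real_polynomial_function (Re \<circ> g)" "real_polynomial_function (Im \<circ> g)"
    using assms bounded_linear_Re bounded_linear_Im unfolding polynomial_function_def by blast+
  obtain a n where a: "Re \<circ> g = (\<lambda>x. \<Sum>i\<le>n. a i * x ^ i)" using re(1) real_polynomial_function_iff_sum by blast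
  obtain b m where b: "Im \<circ> g = (\<lambda>x. \<Sum>i\<le>m. b i * x ^ i)" using re(2) real_polynomial_function_iff_sum by blast
  define p where "p = (\<Sum>i\<le>n. monom (complex_of_real (a i)) i) + [:\<i>:] * (\<Sum>i\<le>m. monom (complex_of_real (b i)) i)"
  have "g x = poly p (of_real x)" for x
  proof -
    have "g x = of_real (Re (g x)) + \<i> * of_real (Im (g x))" by (rule complex_eq)
    also have "Re (g x) = (\<Sum>i\<le>n. a i * x ^ i)" using fun_cong[OF a, of x] by simp
    also have "Im (g x) = (\<Sum>i\<le>m. b i * x ^ i)" using fun_cong[OF b, of x] by simp
    finally show ?thesis by (simp add: p_def poly_sum poly_monom)
  qed
  then show ?thesis by (rule that)
qed

text \<open>
  In the variable \<open>s = exp(-y\<^sup>2)\<close> this is the Weierstrass theorem on \<open>[0,1]\<close> for \<open>f(y) * exp(y\<^sup>2)\<close>.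
\<close>

lemma gauss_poly_approx:
  fixes f :: "real \<Rightarrow> complex"
  assumes cont: "continuous_on UNIV f" and supp: "\<And>y. y \<ge> N \<Longrightarrow> f y = 0" and N: "N > 0" and e: "e > 0"
  shows "\<exists>p. \<forall>y>0. cmod (gauss_poly p y - f y) \<le> e * exp (- y\<^sup>2)"
proof -
  define \<eta> where "\<eta> = exp (- N\<^sup>2)"
  \<comment> \<open>\<open>sqrt (- ln s)\<close> inverts \<open>s = exp (- y\<^sup>2)\<close>.
    Replacing s by \<open>max s \<eta>\<close> avoids the singularity at s = 0 and changes nothing:
    for s \<le> \<eta> the value is f N divided by \<eta>, which is 0.\<close>
  define F where "F s = f (sqrt (- ln (max s \<eta>))) / of_real (max s \<eta>)" for s
  have \<eta>: "\<eta> > 0" by (simp add: \<eta>_def)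
  have "continuous_on {0..1} F"
    unfolding F_def
    by (intro continuous_on_divide continuous_on_compose2[OF cont] continuous_intros) (use \<eta> in \<open>auto simp: max_def\<close>)
  from Stone_Weierstrass_polynomial_function[OF compact_Icc this e]
  obtain g where g: "polynomial_function g" "\<And>s. s \<in> {0..1} \<Longrightarrow> cmod (F s - g s) < e" by blast
  obtain p where p: "\<And>x. g x = poly p (of_real x)" using polynomial_function_complex_poly[OF g(1)] by blast
  have "cmod (gauss_poly p y - f y) \<le> e * exp (- y\<^sup>2)" if y: "y > 0" for y
  proof -
    define s where "s = exp (- y\<^sup>2)"
    have s: "s \<in> {0..1}" "s > 0" by (auto simp: s_def)
    have "f y = of_real s * F s"
    proof (cases "y < N")
      case True
      then have "y\<^sup>2 \<le> N\<^sup>2" using y by (intro power_mono) auto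
      then have "max s \<eta> = s" by (simp add: s_def \<eta>_def)
      moreover have "sqrt (- ln s) = y" using y by (simp add: s_def)
      ultimately show ?thesis using s(2) by (simp add: F_def)
    next
      case False
      then have "N\<^sup>2 \<le> y\<^sup>2" using N by (intro power_mono) auto
      then have "max s \<eta> = \<eta>" by (simp add: s_def \<eta>_def)
      moreover have "sqrt (- ln \<eta>) = N" using N by (simp add: \<eta>_def)
      ultimately show ?thesis using supp[of y] supp[of N] False by (simp add: F_def)
    qed
    then have "gauss_poly p y - f y = of_real s * (g s - F s)"
      by (simp add: gauss_poly_def s_def p right_diff_distrib)
    then have "cmod (gauss_poly p y - f y) = s * cmod (F s - g s)"
      using s by (simp add: norm_mult norm_minus_commute)
    also have "\<dots> \<le> s * e" using g(2)[OF s(1)] s(2) by (intro mult_left_mono) auto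
    finally show ?thesis by (simp add: s_def mult.commute)
  qed
  then show ?thesis by blast
qed

lemma sq_integrable_bounded_support:
  assumes "\<alpha> > -1" "f \<in> borel_measurable (\<mu> \<alpha>)" "\<And>y. cmod (f y) \<le> K" "\<And>y. y > N \<Longrightarrow> f y = 0"
  shows "f \<in> sq_integrable (\<mu> \<alpha>)"
proof (rule sq_integrable_bound[OF assms(2)])
  show "integrable (\<mu> \<alpha>) (\<lambda>y. K\<^sup>2 * indicator {0<..N} y)"
    by (intro integrable_mult_right integrable_mu_indicator assms)
  show "AE y in \<mu> \<alpha>. (cmod (f y))\<^sup>2 \<le> K\<^sup>2 * indicator {0<..N} y"
  proof (rule AE_I2)
    fix y assume "y \<in> space (\<mu> \<alpha>)"
    then show "(cmod (f y))\<^sup>2 \<le> K\<^sup>2 * indicator {0<..N} y"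
      using assms(3)[of y] assms(4)[of y] by (cases "y \<le> N") (auto intro!: power_mono)
  qed
qed

text \<open>The Gaussian weight in the approximation error does two jobs: it is square integrable,
  which gives convergence in norm, and it is integrable against
  \<open>\<bar>bessel_quot \<alpha> (x * y)\<bar>\<close>, which gives convergence of the Hankel
  integrals at each x.\<close>

lemma hankel_isometric_continuous:
  assumes \<alpha>: "\<alpha> > -1" and cont: "continuous_on UNIV f" and supp: "\<And>y. y \<ge> N \<Longrightarrow> f y = 0" and N: "N > 0"
    and bound: "\<And>y. cmod (f y) \<le> K"
  shows "hankel_isometric \<alpha> f"
proof -
  have "\<exists>p. \<forall>y>0. cmod (gauss_poly p y - f y) \<le> inverse (real (Suc n)) * exp (- y\<^sup>2)" for n
    by (rule gauss_poly_approx[OF cont supp N]) simp_all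
  then obtain P where P: "\<And>n y. y > 0 \<Longrightarrow> cmod (gauss_poly (P n) y - f y) \<le> inverse (real (Suc n)) * exp (- y\<^sup>2)"
    by metis
  have fm: "f \<in> borel_measurable (\<mu> \<alpha>)"
    by (rule borel_measurable_mu) (simp add: borel_measurable_continuous_onI cont)
  have fL: "f \<in> sq_integrable (\<mu> \<alpha>)"
    by (rule sq_integrable_bounded_support[OF \<alpha> fm bound, where N=N]) (use supp in auto)
  have int: "integrable (\<mu> \<alpha>) (hankel_integrand \<alpha> f x)" if "x > 0" for x
    by (rule hankel_integrand_integrable_bounded_support[OF \<alpha> fL _ that, where N=N]) (use supp in auto)
  have g1: "hankel_isometric \<alpha> (gauss_poly p)" for p by (rule hankel_isometric_gauss_poly[OF \<alpha>])
  have gL: "gauss_poly p \<in> sq_integrable (\<mu> \<alpha>)" for p using g1 by (simp add: hankel_isometric_def)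
  define E where "E = (\<lambda>y. complex_of_real (exp (- y\<^sup>2)))"
  have EL: "E \<in> sq_integrable (\<mu> \<alpha>)"
    using gL[of 1] by (simp add: E_def gauss_poly_def[abs_def])
  have "(\<lambda>n. inverse (real (Suc n)) * sq_norm (\<mu> \<alpha>) E) \<longlonglongrightarrow> 0 * sq_norm (\<mu> \<alpha>) E"
    by (intro tendsto_intros LIMSEQ_inverse_real_of_nat)
  then have lim0: "(\<lambda>n. inverse (real (Suc n)) * sq_norm (\<mu> \<alpha>) E) \<longlonglongrightarrow> 0" by simp
  have lim: "(\<lambda>n. sq_norm (\<mu> \<alpha>) (\<lambda>y. gauss_poly (P n) y - f y)) \<longlonglongrightarrow> 0"
  proof (rule tendsto_sandwich[OF _ _ tendsto_const lim0])
    have "sq_norm (\<mu> \<alpha>) (\<lambda>y. gauss_poly (P n) y - f y) \<le> inverse (real (Suc n)) * sq_norm (\<mu> \<alpha>) E" for n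
    proof -
      have "sq_norm (\<mu> \<alpha>) (\<lambda>y. gauss_poly (P n) y - f y) \<le> sq_norm (\<mu> \<alpha>) (\<lambda>y. of_real (inverse (real (Suc n))) * E y)"
      proof (rule sq_norm_mono)
        show "(\<lambda>y. gauss_poly (P n) y - f y) \<in> borel_measurable (\<mu> \<alpha>)"
          by (intro sq_integrable_measurable sq_integrable_diff gL fL)
        show "AE y in \<mu> \<alpha>. cmod (gauss_poly (P n) y - f y) \<le> cmod (of_real (inverse (real (Suc n))) * E y)"
          by (rule AE_I2) (use P[of _ n] in \<open>simp add: norm_mult E_def del: of_nat_Suc of_real_inverse\<close>)
      qed (intro sq_integrable_cmult EL)
      then show ?thesis by (simp add: sq_norm_cmult norm_inverse del: of_nat_Suc)
    qed
    then show "\<forall>\<^sub>F n in sequentially. sq_norm (\<mu> \<alpha>) (\<lambda>y. gauss_poly (P n) y - f y) \<le> inverse (real (Suc n)) * sq_norm (\<mu> \<alpha>) E"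
      by simp
  qed simp
  show ?thesis
  proof (rule hankel_isometric_limit[where F="\<lambda>n. gauss_poly (P n)", OF g1 _ fL int lim])
    show "hankel_isometric \<alpha> (\<lambda>y. gauss_poly (P m) y - gauss_poly (P n) y)" for m n
      using g1[of "P m - P n"] by (simp add: gauss_poly_diff)
  next
    fix x :: real assume x: "x > 0"
    define I where "I = (LINT y|\<mu> \<alpha>. exp (- y\<^sup>2) * \<bar>bessel_quot \<alpha> (x * y)\<bar>)"
    have Iint: "integrable (\<mu> \<alpha>) (\<lambda>y. exp (- y\<^sup>2) * \<bar>bessel_quot \<alpha> (x * y)\<bar>)"
    proof -
      have "integrable (\<mu> \<alpha>) (\<lambda>y. exp (- 1 * y\<^sup>2) * bessel_quot \<alpha> (x * y))"
        using has_bochner_integral_gauss_bessel[OF \<alpha> zero_less_one x] by (simp add: has_bochner_integral_iff)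
      from integrable_abs[OF this] show ?thesis by (simp add: abs_mult)
    qed
    have gint: "integrable (\<mu> \<alpha>) (hankel_integrand \<alpha> (gauss_poly (P n)) x)" for n
      using g1 x by (simp add: hankel_isometric_def)
    have est: "cmod (hankel_integral \<alpha> (gauss_poly (P n)) x - hankel_integral \<alpha> f x) \<le> inverse (real (Suc n)) * I" for n
    proof -
      have "hankel_integral \<alpha> (gauss_poly (P n)) x - hankel_integral \<alpha> f x
          = (LINT y|\<mu> \<alpha>. hankel_integrand \<alpha> (gauss_poly (P n)) x y - hankel_integrand \<alpha> f x y)"
        unfolding hankel_integral_def by (rule Bochner_Integration.integral_diff[symmetric, OF gint int[OF x]])
      also have "cmod \<dots> \<le> (LINT y|\<mu> \<alpha>. inverse (real (Suc n)) * (exp (- y\<^sup>2) * \<bar>bessel_quot \<alpha> (x * y)\<bar>))"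
      proof (rule Bochner_Integration.integral_norm_bound_integral)
        fix y assume "y \<in> space (\<mu> \<alpha>)"
        then have "cmod (gauss_poly (P n) y - f y) * \<bar>bessel_quot \<alpha> (x * y)\<bar>
            \<le> (inverse (real (Suc n)) * exp (- y\<^sup>2)) * \<bar>bessel_quot \<alpha> (x * y)\<bar>"
          by (intro mult_right_mono P) auto
        then show "cmod (hankel_integrand \<alpha> (gauss_poly (P n)) x y - hankel_integrand \<alpha> f x y)
            \<le> inverse (real (Suc n)) * (exp (- y\<^sup>2) * \<bar>bessel_quot \<alpha> (x * y)\<bar>)"
          by (simp add: hankel_integrand_def left_diff_distrib[symmetric] norm_mult mult.assoc del: of_nat_Suc)
      qed (intro Bochner_Integration.integrable_diff gint int x integrable_mult_right Iint)+
      also have "\<dots> = inverse (real (Suc n)) * I" by (simp add: I_def)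
      finally show ?thesis .
    qed
    have "(\<lambda>n. inverse (real (Suc n)) * I) \<longlonglongrightarrow> 0 * I"
      by (intro tendsto_intros LIMSEQ_inverse_real_of_nat)
    then have "(\<lambda>n. hankel_integral \<alpha> (gauss_poly (P n)) x - hankel_integral \<alpha> f x) \<longlonglongrightarrow> 0"
      using Lim_null_comparison[OF always_eventually[OF allI[OF est]]] by simp
    then show "(\<lambda>n. hankel_integral \<alpha> (gauss_poly (P n)) x) \<longlonglongrightarrow> hankel_integral \<alpha> f x"
      by (rule LIM_zero_cancel)
  qed
qed

text \<open>A measurable function is almost everywhere a limit of continuous functions g n, without
  control of size or support. Nearest-point projection onto the disc of radius K restores the bound,
  and the ramp \<kappa>, descending on [N, N + 1], restores the support; both are continuous and
  leave the limit unchanged.\<close>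

lemma continuous_approx_bounded_support:
  fixes f :: "real \<Rightarrow> complex"
  assumes fm: "f \<in> borel_measurable (\<mu> \<alpha>)" and bound: "\<And>y. cmod (f y) \<le> K"
    and supp: "\<And>y. y > N \<Longrightarrow> f y = 0" and K: "K \<ge> 0"
  shows "\<exists>F. (\<forall>n. continuous_on UNIV (F n)) \<and> (\<forall>n y. cmod (F n y) \<le> K) \<and>
    (\<forall>n y. y \<ge> N + 1 \<longrightarrow> F n y = 0) \<and> (AE y in \<mu> \<alpha>. (\<lambda>n. F n y) \<longlonglongrightarrow> f y)"
proof -
  have "f \<in> borel_measurable (restrict_space lborel {0<..})"
    using fm by (subst measurable_cong_sets[OF _ refl, of _ "\<mu> \<alpha>"]) (simp_all add: sets_mu sets_restrict_space)
  then have "(\<lambda>y. indicator {0<..} y *\<^sub>R f y) \<in> borel_measurable lborel"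
    by (subst (asm) borel_measurable_restrict_space_iff) auto
  from measurable_completion[OF this]
  have "(\<lambda>y. indicator {0<..} y *\<^sub>R f y) measurable_on UNIV"
    by (rule lebesgue_measurable_imp_measurable_on) simp
  then obtain Z g where Z: "negligible Z" and g: "\<And>n. continuous_on UNIV (g n)"
    and lim: "\<And>y. y \<notin> Z \<Longrightarrow> (\<lambda>n. g n y) \<longlonglongrightarrow> indicator {0<..} y *\<^sub>R f y"
    unfolding measurable_on_def by auto
  define cl where "cl = closest_point (cball (0::complex) K)"
  have ne: "cball (0::complex) K \<noteq> {}" using K by simp
  have cl_cont: "isCont cl z" for z
    unfolding cl_def by (rule continuous_at_closest_point[OF convex_cball closed_cball ne])
  have cl_cont_on: "continuous_on UNIV cl"
    using cl_cont by (simp add: continuous_on_eq_continuous_at)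
  have cl_bound: "cmod (cl z) \<le> K" for z
    using closest_point_in_set[OF closed_cball ne, of z] by (simp add: cl_def)
  define \<kappa> where "\<kappa> y = max 0 (min 1 (N + 1 - y))" for y :: real
  have \<kappa>: "0 \<le> \<kappa> y" "\<kappa> y \<le> 1" "y \<ge> N + 1 \<Longrightarrow> \<kappa> y = 0" "y \<le> N \<Longrightarrow> \<kappa> y = 1" for y by (auto simp: \<kappa>_def)
  define F where "F n y = of_real (\<kappa> y) * cl (g n y)" for n y
  have "continuous_on UNIV (F n)" for n
    unfolding F_def \<kappa>_def by (intro continuous_intros continuous_on_compose2[OF cl_cont_on g]) auto
  moreover have "cmod (F n y) \<le> K" for n y
    using mult_mono[OF \<kappa>(2)[of y] cl_bound[of "g n y"]] \<kappa>(1)[of y] by (simp add: F_def norm_mult)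
  moreover have "F n y = 0" if "y \<ge> N + 1" for n y using \<kappa>(3)[OF that] by (simp add: F_def)
  moreover have "AE y in \<mu> \<alpha>. (\<lambda>n. F n y) \<longlonglongrightarrow> f y"
  proof -
    have "AE y in lebesgue. y \<notin> Z" using Z by (simp add: AE_not_in negligible_iff_null_sets)
    then have "AE y in lborel. y \<notin> Z" by (simp add: AE_completion_iff)
    then show ?thesis unfolding AE_mu_iff
    proof eventually_elim
      case (elim y)
      show ?case
      proof
        assume y: "0 < y"
        have "(\<lambda>n. cl (g n y)) \<longlonglongrightarrow> cl (f y)"
          using lim[OF elim] y by (intro isCont_tendsto_compose[OF cl_cont]) simp
        moreover have "cl (f y) = f y" unfolding cl_def by (rule closest_point_self) (use bound in simp)
        ultimately have "(\<lambda>n. F n y) \<longlonglongrightarrow> of_real (\<kappa> y) * f y"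
          unfolding F_def by (intro tendsto_intros) simp
        moreover have "of_real (\<kappa> y) * f y = f y" using \<kappa>(4)[of y] supp[of y] by (cases "y \<le> N") auto
        ultimately show "(\<lambda>n. F n y) \<longlonglongrightarrow> f y" by simp
      qed
    qed
  qed
  ultimately show ?thesis by (intro exI[of _ F]) simp
qed

text \<open>The common bound K and the common support in (0, N + 1] dominate the approximation in
  mean square; the Hankel integrals then converge as pairings with one fixed square integrable
  function.\<close>

lemma hankel_isometric_bounded_support:
  assumes \<alpha>: "\<alpha> > -1" and fm: "f \<in> borel_measurable (\<mu> \<alpha>)" and bound: "\<And>y. cmod (f y) \<le> K"
    and supp: "\<And>y. y > N \<Longrightarrow> f y = 0" and N: "N > 0"
  shows "hankel_isometric \<alpha> f"
proof -
  have K: "K \<ge> 0" using order_trans[OF norm_ge_zero bound[of 0]] .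
  obtain F where F: "\<And>n. continuous_on UNIV (F n)" "\<And>n y. cmod (F n y) \<le> K" "\<And>n y. y \<ge> N + 1 \<Longrightarrow> F n y = 0"
    "AE y in \<mu> \<alpha>. (\<lambda>n. F n y) \<longlonglongrightarrow> f y"
    using continuous_approx_bounded_support[OF fm bound supp K] by blast
  have supp': "f y = 0" if "y > N + 1" for y using supp[of y] that by simp
  have fL: "f \<in> sq_integrable (\<mu> \<alpha>)" by (rule sq_integrable_bounded_support[OF \<alpha> fm bound supp])
  have int: "integrable (\<mu> \<alpha>) (hankel_integrand \<alpha> f x)" if "x > 0" for x
    by (rule hankel_integrand_integrable_bounded_support[OF \<alpha> fL supp that])
  have iso: "hankel_isometric \<alpha> (F n)" for n
    by (rule hankel_isometric_continuous[OF \<alpha> F(1) _ _ F(2), where N="N + 1"]) (use N F(3) in simp_all)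
  have FL: "F n \<in> sq_integrable (\<mu> \<alpha>)" for n using iso by (simp add: hankel_isometric_def)
  have iso2: "hankel_isometric \<alpha> (\<lambda>y. F m y - F n y)" for m n
  proof (rule hankel_isometric_continuous[OF \<alpha>, where N="N + 1"])
    show "cmod (F m y - F n y) \<le> K + K" for y
      using norm_triangle_ineq4[of "F m y" "F n y"] F(2)[of m y] F(2)[of n y] by linarith
  qed (use F N in \<open>auto intro: continuous_on_diff\<close>)
  have lim: "(\<lambda>n. sq_norm (\<mu> \<alpha>) (\<lambda>y. F n y - f y)) \<longlonglongrightarrow> 0"
  proof (rule sq_norm_dominated_convergence[OF _ fm _ _ F(4)])
    show "F n \<in> borel_measurable (\<mu> \<alpha>)" for n by (rule sq_integrable_measurable[OF FL])
    show "integrable (\<mu> \<alpha>) (\<lambda>y. (K + K)\<^sup>2 * indicator {0<..N + 1} y)"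
      by (intro integrable_mult_right integrable_mu_indicator \<alpha>)
    show "AE y in \<mu> \<alpha>. (cmod (F n y - f y))\<^sup>2 \<le> (K + K)\<^sup>2 * indicator {0<..N + 1} y" for n
    proof (rule AE_I2)
      fix y assume y: "y \<in> space (\<mu> \<alpha>)"
      have "cmod (F n y - f y) \<le> K + K"
        using norm_triangle_ineq4[of "F n y" "f y"] F(2)[of n y] bound[of y] by linarith
      then have "(cmod (F n y - f y))\<^sup>2 \<le> (K + K)\<^sup>2" by (intro power_mono) auto
      then show "(cmod (F n y - f y))\<^sup>2 \<le> (K + K)\<^sup>2 * indicator {0<..N + 1} y"
        using y F(3)[of y n] supp'[of y] by (cases "y \<le> N + 1") auto
    qed
  qed
  show ?thesis
  proof (rule hankel_isometric_limit[OF iso iso2 fL int lim])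
    fix x :: real assume x: "x > 0"
    show "(\<lambda>n. hankel_integral \<alpha> (F n) x) \<longlonglongrightarrow> hankel_integral \<alpha> f x"
    proof -
      have "hankel_integral \<alpha> (F n) x
          = (LINT y|\<mu> \<alpha>. F n y * complex_of_real (indicator {0<..N + 1} y * bessel_quot \<alpha> (x * y)))" for n
        by (rule hankel_integral_bounded_support[OF \<alpha> FL _ x]) (simp add: F(3))
      moreover have "hankel_integral \<alpha> f x
          = (LINT y|\<mu> \<alpha>. f y * complex_of_real (indicator {0<..N + 1} y * bessel_quot \<alpha> (x * y)))"
        by (rule hankel_integral_bounded_support[OF \<alpha> fL supp' x])
      ultimately show ?thesis
        using sq_norm_tendsto_integral[OF FL fL bessel_trunc_sq_integrable[OF \<alpha> \<alpha> x, of "N + 1"] lim] by simp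
    qed
  qed
qed

section \<open>Extension to all square integrable functions\<close>

text \<open>Cutting both the argument and the value makes every measurable function bounded with
  bounded support. The cut in the value is not linear, so differences of cutoffs have to be treated
  as functions in their own right.\<close>

definition cutoff :: "nat \<Rightarrow> (real \<Rightarrow> complex) \<Rightarrow> real \<Rightarrow> complex" where
  "cutoff n f y = (if y \<le> real n \<and> cmod (f y) \<le> real n then f y else 0)"

lemma cutoff_measurable:
  "f \<in> borel_measurable (\<mu> \<alpha>) \<Longrightarrow> cutoff n f \<in> borel_measurable (\<mu> \<alpha>)"
proof -
  assume f: "f \<in> borel_measurable (\<mu> \<alpha>)"
  have "(\<lambda>z. z * of_real (indicator {..real n} (cmod z))) \<in> borel_measurable borel" by measurable
  note * = measurable_compose[OF f this]
  have "(\<lambda>y. of_real (indicator {..real n} y) * (f y * of_real (indicator {..real n} (cmod (f y))))) \<in> borel_measurable (\<mu> \<alpha>)"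
    by (rule borel_measurable_times[OF borel_measurable_mu *]) measurable
  moreover have "of_real (indicator {..real n} y) * (f y * of_real (indicator {..real n} (cmod (f y)))) = cutoff n f y" for y
    by (simp add: cutoff_def indicator_def)
  ultimately show ?thesis by (simp add: cutoff_def[abs_def])
qed

lemma cutoff_tendsto: "(\<lambda>n. cutoff n f y) \<longlonglongrightarrow> f y"
proof (rule tendsto_eventually)
  show "\<forall>\<^sub>F n in sequentially. cutoff n f y = f y"
    using eventually_ge_at_top[of "nat \<lceil>max y (cmod (f y))\<rceil>"]
  proof eventually_elim
    case (elim n)
    then have "max y (cmod (f y)) \<le> real n" by linarith
    then show ?case by (simp add: cutoff_def)
  qed
qed

lemma hankel_isometric_cutoff:
  assumes "\<alpha> > -1" "f \<in> borel_measurable (\<mu> \<alpha>)"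
  shows "hankel_isometric \<alpha> (cutoff n f)"
  by (rule hankel_isometric_bounded_support[OF assms(1) cutoff_measurable[OF assms(2)], where K="real n" and N="real n + 1"])
     (auto simp: cutoff_def)

lemma hankel_isometric_cutoff_diff:
  assumes "\<alpha> > -1" "f \<in> borel_measurable (\<mu> \<alpha>)" "g \<in> borel_measurable (\<mu> \<alpha>)"
  shows "hankel_isometric \<alpha> (\<lambda>y. cutoff n f y - cutoff m g y)"
proof (rule hankel_isometric_bounded_support[OF assms(1), where K="real n + real m" and N="real n + real m + 1"])
  show "cmod (cutoff n f y - cutoff m g y) \<le> real n + real m" for y
    by (rule order_trans[OF norm_triangle_ineq4]) (auto simp: cutoff_def)
  show "(\<lambda>y. cutoff n f y - cutoff m g y) \<in> borel_measurable (\<mu> \<alpha>)"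
    by (intro borel_measurable_diff cutoff_measurable assms)
qed (auto simp: cutoff_def)

lemma cutoff_sq_norm_tendsto:
  assumes f: "f \<in> sq_integrable (\<mu> \<alpha>)"
  shows "(\<lambda>n. sq_norm (\<mu> \<alpha>) (\<lambda>y. cutoff n f y - f y)) \<longlonglongrightarrow> 0"
proof (rule sq_norm_dominated_convergence[OF _ _ sq_integrableD[OF f]])
  show "AE y in \<mu> \<alpha>. (cmod (cutoff n f y - f y))\<^sup>2 \<le> (cmod (f y))\<^sup>2" for n
    by (rule AE_I2) (simp add: cutoff_def)
  show "AE y in \<mu> \<alpha>. (\<lambda>n. cutoff n f y) \<longlonglongrightarrow> f y"
    by (rule AE_I2) (rule cutoff_tendsto)
qed (intro cutoff_measurable sq_integrable_measurable f)+

lemma hankel_extension_exists: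
  assumes \<alpha>: "\<alpha> > -1" and f: "f \<in> sq_integrable (\<mu> \<alpha>)"
  shows "\<exists>h\<in>sq_integrable (\<mu> \<alpha>). (\<lambda>n. sq_norm (\<mu> \<alpha>) (\<lambda>x. hankel_integral \<alpha> (cutoff n f) x - h x)) \<longlonglongrightarrow> 0"
proof -
  have m: "f \<in> borel_measurable (\<mu> \<alpha>)" by (rule sq_integrable_measurable[OF f])
  note iso = hankel_isometric_cutoff[OF \<alpha> m] and iso2 = hankel_isometric_cutoff_diff[OF \<alpha> m m]
  have L: "cutoff n f \<in> sq_integrable (\<mu> \<alpha>)" "hankel_integral \<alpha> (cutoff n f) \<in> sq_integrable (\<mu> \<alpha>)" for n
    using iso[of n] by (auto simp: hankel_isometric_def)
  have "\<exists>N. \<forall>m\<ge>N. \<forall>n\<ge>N. sq_norm (\<mu> \<alpha>) (\<lambda>x. hankel_integral \<alpha> (cutoff m f) x - hankel_integral \<alpha> (cutoff n f) x) < e"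
    if "e > 0" for e
    unfolding hankel_isometric_diff[OF iso iso iso2]
    by (rule sq_norm_Cauchy[OF L(1) f cutoff_sq_norm_tendsto[OF f] that])
  from sq_integrable_complete[OF L(2) this] show ?thesis by blast
qed

text \<open>T f is a mean-square limit of the Hankel integrals of the cutoffs. For the clause on
  convergent integrals, the integrand of f itself dominates those of its cutoffs, so they converge
  pointwise to the Hankel integral, which must then be T f. After this, \<open>hankel\<close> is
  used only through its specification.\<close>

theorem isometric_hankel_extension_exists:
  assumes \<alpha>: "\<alpha> > -1"
  shows "\<exists>T. isometric_hankel_extension \<alpha> T"
proof -
  define T where "T f = (SOME h. h \<in> sq_integrable (\<mu> \<alpha>) \<and>
      (\<lambda>n. sq_norm (\<mu> \<alpha>) (\<lambda>x. hankel_integral \<alpha> (cutoff n f) x - h x)) \<longlonglongrightarrow> 0)" for f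
  have T: "T f \<in> sq_integrable (\<mu> \<alpha>)"
    "(\<lambda>n. sq_norm (\<mu> \<alpha>) (\<lambda>x. hankel_integral \<alpha> (cutoff n f) x - T f x)) \<longlonglongrightarrow> 0"
    if "f \<in> sq_integrable (\<mu> \<alpha>)" for f
    using someI_ex[OF hankel_extension_exists[OF \<alpha> that, unfolded Bex_def]] unfolding T_def by blast+
  have HL: "cutoff n f \<in> sq_integrable (\<mu> \<alpha>)" "hankel_integral \<alpha> (cutoff n f) \<in> sq_integrable (\<mu> \<alpha>)"
    if "f \<in> sq_integrable (\<mu> \<alpha>)" for n f
    using hankel_isometric_cutoff[OF \<alpha> sq_integrable_measurable[OF that], of n] by (auto simp: hankel_isometric_def)
  have diff_tendsto: "(\<lambda>n. sq_norm M (\<lambda>x. (F n x - G n x) - (f x - g x))) \<longlonglongrightarrow> 0"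
    if "\<And>n. F n \<in> sq_integrable M" "\<And>n. G n \<in> sq_integrable M" "f \<in> sq_integrable M" "g \<in> sq_integrable M"
      "(\<lambda>n. sq_norm M (\<lambda>x. F n x - f x)) \<longlonglongrightarrow> 0" "(\<lambda>n. sq_norm M (\<lambda>x. G n x - g x)) \<longlonglongrightarrow> 0"
    for F G :: "nat \<Rightarrow> real \<Rightarrow> complex" and f g M
  proof (rule tendsto_sandwich[OF _ _ tendsto_const])
    show "(\<lambda>n. sq_norm M (\<lambda>x. F n x - f x) + sq_norm M (\<lambda>x. G n x - g x)) \<longlonglongrightarrow> 0"
      using tendsto_add[OF that(5,6)] by simp
    have "sq_norm M (\<lambda>x. (F n x - G n x) - (f x - g x)) \<le> sq_norm M (\<lambda>x. F n x - f x) + sq_norm M (\<lambda>x. G n x - g x)" for n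
    proof -
      have "sq_norm M (\<lambda>x. (F n x - f x) + (g x - G n x)) \<le> sq_norm M (\<lambda>x. F n x - f x) + sq_norm M (\<lambda>x. g x - G n x)"
        by (intro sq_norm_add_le sq_integrable_diff that)
      moreover have "(F n x - G n x) - (f x - g x) = (F n x - f x) + (g x - G n x)" for x by simp
      ultimately show ?thesis by (simp only: sq_norm_minus_commute[of M g])
    qed
    then show "\<forall>\<^sub>F n in sequentially. sq_norm M (\<lambda>x. (F n x - G n x) - (f x - g x))
        \<le> sq_norm M (\<lambda>x. F n x - f x) + sq_norm M (\<lambda>x. G n x - g x)" by simp
  qed simp
  have iso: "sq_norm (\<mu> \<alpha>) (\<lambda>x. T f x - T g x) = sq_norm (\<mu> \<alpha>) (\<lambda>x. f x - g x)"
    if f: "f \<in> sq_integrable (\<mu> \<alpha>)" and g: "g \<in> sq_integrable (\<mu> \<alpha>)" for f g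
  proof (rule LIMSEQ_unique)
    note fm = sq_integrable_measurable[OF f] and gm = sq_integrable_measurable[OF g]
    show "(\<lambda>n. sq_norm (\<mu> \<alpha>) (\<lambda>x. hankel_integral \<alpha> (cutoff n f) x - hankel_integral \<alpha> (cutoff n g) x))
        \<longlonglongrightarrow> sq_norm (\<mu> \<alpha>) (\<lambda>x. T f x - T g x)"
      by (rule sq_norm_tendsto[OF _ _ diff_tendsto]; intro sq_integrable_diff HL T f g)
    have "sq_norm (\<mu> \<alpha>) (\<lambda>x. hankel_integral \<alpha> (cutoff n f) x - hankel_integral \<alpha> (cutoff n g) x)
        = sq_norm (\<mu> \<alpha>) (\<lambda>x. cutoff n f x - cutoff n g x)" for n
      by (intro hankel_isometric_diff hankel_isometric_cutoff hankel_isometric_cutoff_diff \<alpha> fm gm)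
    moreover have "(\<lambda>n. sq_norm (\<mu> \<alpha>) (\<lambda>x. cutoff n f x - cutoff n g x)) \<longlonglongrightarrow> sq_norm (\<mu> \<alpha>) (\<lambda>x. f x - g x)"
      by (rule sq_norm_tendsto[OF _ _ diff_tendsto]; intro sq_integrable_diff HL f g cutoff_sq_norm_tendsto)
    ultimately show "(\<lambda>n. sq_norm (\<mu> \<alpha>) (\<lambda>x. hankel_integral \<alpha> (cutoff n f) x - hankel_integral \<alpha> (cutoff n g) x))
        \<longlonglongrightarrow> sq_norm (\<mu> \<alpha>) (\<lambda>x. f x - g x)" by simp
  qed
  have agree: "AE x in \<mu> \<alpha>. T f x = hankel_integral \<alpha> f x"
    if f: "f \<in> sq_integrable (\<mu> \<alpha>)" and ae: "AE x in \<mu> \<alpha>. integrable (\<mu> \<alpha>) (hankel_integrand \<alpha> f x)" for f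
  proof (rule sq_norm_limit_AE_unique[OF HL(2)[OF f] T[OF f]])
    note fm = sq_integrable_measurable[OF f]
    show "AE x in \<mu> \<alpha>. (\<lambda>n. hankel_integral \<alpha> (cutoff n f) x) \<longlonglongrightarrow> hankel_integral \<alpha> f x"
      using ae
    proof eventually_elim
      case (elim x)
      show ?case unfolding hankel_integral_def
      proof (rule integral_dominated_convergence[OF _ _ integrable_norm[OF elim]])
        show "hankel_integrand \<alpha> f x \<in> borel_measurable (\<mu> \<alpha>)" using elim by (rule borel_measurable_integrable)
        show "hankel_integrand \<alpha> (cutoff n f) x \<in> borel_measurable (\<mu> \<alpha>)" for n
          unfolding hankel_integrand_def
          by (intro borel_measurable_times cutoff_measurable fm borel_measurable_mu) measurable
        show "AE y in \<mu> \<alpha>. (\<lambda>n. hankel_integrand \<alpha> (cutoff n f) x y) \<longlonglongrightarrow> hankel_integrand \<alpha> f x y"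
          unfolding hankel_integrand_def by (intro AE_I2 tendsto_intros cutoff_tendsto)
        show "AE y in \<mu> \<alpha>. norm (hankel_integrand \<alpha> (cutoff n f) x y) \<le> norm (hankel_integrand \<alpha> f x y)" for n
          by (rule AE_I2) (simp add: hankel_integrand_def cutoff_def)
      qed
    qed
  qed
  show ?thesis
    unfolding isometric_hankel_extension_def L2_eq_sq_integrable L2_norm_eq_sq_norm
    using T(1) iso agree by (intro exI[of _ T]) blast
qed

lemma isometric_hankel_extension_hankel:
  "\<alpha> > -1 \<Longrightarrow> isometric_hankel_extension \<alpha> (hankel \<alpha>)"
  unfolding hankel_def by (rule someI_ex[OF isometric_hankel_extension_exists])

lemma hankel_sq_integrable:
  "\<alpha> > -1 \<Longrightarrow> f \<in> sq_integrable (\<mu> \<alpha>) \<Longrightarrow> hankel \<alpha> f \<in> sq_integrable (\<mu> \<alpha>)"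
  using isometric_hankel_extension_hankel
  by (simp add: isometric_hankel_extension_def L2_eq_sq_integrable)

lemma hankel_isometry:
  "\<alpha> > -1 \<Longrightarrow> f \<in> sq_integrable (\<mu> \<alpha>) \<Longrightarrow> g \<in> sq_integrable (\<mu> \<alpha>) \<Longrightarrow>
    sq_norm (\<mu> \<alpha>) (\<lambda>x. hankel \<alpha> f x - hankel \<alpha> g x) = sq_norm (\<mu> \<alpha>) (\<lambda>x. f x - g x)"
  using isometric_hankel_extension_hankel
  by (simp add: isometric_hankel_extension_def L2_eq_sq_integrable L2_norm_eq_sq_norm)

lemma hankel_eq_hankel_integral:
  "\<alpha> > -1 \<Longrightarrow> f \<in> sq_integrable (\<mu> \<alpha>) \<Longrightarrow> (AE x in \<mu> \<alpha>. integrable (\<mu> \<alpha>) (hankel_integrand \<alpha> f x)) \<Longrightarrow>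
    AE x in \<mu> \<alpha>. hankel \<alpha> f x = hankel_integral \<alpha> f x"
  using isometric_hankel_extension_hankel
  by (simp add: isometric_hankel_extension_def L2_eq_sq_integrable)

section \<open>Oscillatory integrals\<close>

lemma borel_measurable_mu_indicator:
  fixes f :: "real \<Rightarrow> 'b::real_normed_vector"
  assumes "f \<in> borel_measurable (\<mu> \<alpha>)"
  shows "(\<lambda>z. indicator {0<..} z *\<^sub>R f z) \<in> borel_measurable borel"
proof -
  have "f \<in> borel_measurable (restrict_space borel {0<..})"
    using assms by (subst measurable_cong_sets[OF sets_mu[symmetric] refl])
  then show ?thesis by (subst (asm) borel_measurable_restrict_space_iff) auto
qed

lemma has_integral_powr_interval:
  fixes \<sigma> s r :: real
  assumes "\<sigma> \<noteq> 0" "0 < s" "s \<le> r"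
  shows "((\<lambda>y. y powr (- \<sigma> - 1)) has_integral (s powr - \<sigma> - r powr - \<sigma>) / \<sigma>) {s..r}"
proof -
  have "((\<lambda>y. y powr (- \<sigma> - 1)) has_integral (- (r powr - \<sigma>) / \<sigma> - - (s powr - \<sigma>) / \<sigma>)) {s..r}"
  proof (rule fundamental_theorem_of_calculus[OF assms(3)])
    fix y assume "y \<in> {s..r}"
    then have "((\<lambda>y. - (y powr - \<sigma>) / \<sigma>) has_real_derivative y powr (- \<sigma> - 1)) (at y)"
      using assms by (auto intro!: derivative_eq_intros)
    then show "((\<lambda>y. - (y powr - \<sigma>) / \<sigma>) has_vector_derivative y powr (- \<sigma> - 1)) (at y within {s..r})"
      by (simp add: has_real_derivative_iff_has_vector_derivative has_vector_derivative_at_within)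
  qed
  then show ?thesis by (simp add: diff_divide_distrib)
qed

text \<open>Integration by parts, integrating the cosine.\<close>

lemma oscillatory_integral_bound:
  fixes F F' :: "real \<Rightarrow> real"
  assumes dF: "\<And>y. y \<ge> A \<Longrightarrow> (F has_real_derivative F' y) (at y)"
    and F: "\<And>y. y \<ge> A \<Longrightarrow> \<bar>F y\<bar> \<le> M * y powr - \<sigma>"
    and F': "\<And>y. y \<ge> A \<Longrightarrow> \<bar>F' y\<bar> \<le> M * y powr (- \<sigma> - 1)"
    and \<sigma>: "\<sigma> > 0" and w: "w \<noteq> 0" and A: "0 < A" "A \<le> s" "s \<le> r"
  shows "\<bar>integral {s..r} (\<lambda>y. F y * cos (w * y + c))\<bar> \<le> (2 + 1 / \<sigma>) * M * s powr - \<sigma> / \<bar>w\<bar>"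
proof -
  have M: "M \<ge> 0"
  proof -
    have "0 \<le> M * A powr - \<sigma>" using order_trans[OF abs_ge_zero F[of A]] by simp
    then show ?thesis using A by (simp add: zero_le_mult_iff)
  qed
  define S where "S y = sin (w * y + c) / w" for y
  have S: "\<bar>S y\<bar> \<le> 1 / \<bar>w\<bar>" for y by (simp add: S_def divide_right_mono)
  define I where "I = integral {s..r} (\<lambda>y. F y * cos (w * y + c))"
  define \<Delta> where "\<Delta> = F r * S r - F s * S s"
  have dS: "(S has_real_derivative cos (w * y + c)) (at y)" for y
    unfolding S_def[abs_def] using w by (auto intro!: derivative_eq_intros)
  have 1: "((\<lambda>y. F' y * S y + F y * cos (w * y + c)) has_integral \<Delta>) {s..r}"
    unfolding \<Delta>_def
  proof (rule fundamental_theorem_of_calculus[OF A(3)])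
    fix y assume "y \<in> {s..r}"
    then have "y \<ge> A" using A by simp
    from DERIV_mult[OF dF[OF this] dS[of y]]
    show "((\<lambda>y. F y * S y) has_vector_derivative F' y * S y + F y * cos (w * y + c)) (at y within {s..r})"
      by (simp add: has_real_derivative_iff_has_vector_derivative has_vector_derivative_at_within add.commute mult.commute)
  qed
  have "continuous_on {s..r} F"
    using A by (intro continuous_at_imp_continuous_on ballI DERIV_isCont[OF dF]) auto
  then have "(\<lambda>y. F y * cos (w * y + c)) integrable_on {s..r}"
    by (intro integrable_continuous_real continuous_intros)
  then have "((\<lambda>y. F y * cos (w * y + c)) has_integral I) {s..r}"
    unfolding I_def by (rule integrable_integral)
  from has_integral_diff[OF 1 this] have 2: "((\<lambda>y. F' y * S y) has_integral (\<Delta> - I)) {s..r}" by simp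
  have s0: "0 < s" using A by simp
  have 3: "((\<lambda>y. (M / \<bar>w\<bar>) * y powr (- \<sigma> - 1)) has_integral (M / \<bar>w\<bar>) * ((s powr - \<sigma> - r powr - \<sigma>) / \<sigma>)) {s..r}"
    by (intro has_integral_mult_right has_integral_powr_interval) (use \<sigma> s0 A in auto)
  have "norm (integral {s..r} (\<lambda>y. F' y * S y)) \<le> integral {s..r} (\<lambda>y. (M / \<bar>w\<bar>) * y powr (- \<sigma> - 1))"
  proof (rule Henstock_Kurzweil_Integration.integral_norm_bound_integral)
    fix y assume "y \<in> {s..r}"
    then have "\<bar>F' y\<bar> * \<bar>S y\<bar> \<le> (M * y powr (- \<sigma> - 1)) * (1 / \<bar>w\<bar>)"
      using A M by (intro mult_mono F' S) auto
    then show "norm (F' y * S y) \<le> (M / \<bar>w\<bar>) * y powr (- \<sigma> - 1)" by (simp add: abs_mult)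
  qed (use 2 3 in \<open>auto simp: has_integral_integrable_integral\<close>)
  then have "\<bar>\<Delta> - I\<bar> \<le> (M / \<bar>w\<bar>) * ((s powr - \<sigma> - r powr - \<sigma>) / \<sigma>)"
    using 2 3 by (simp add: has_integral_integrable_integral)
  also have "\<dots> \<le> (M / \<bar>w\<bar>) * (s powr - \<sigma> / \<sigma>)"
    using M \<sigma> by (intro mult_left_mono divide_right_mono) auto
  finally have a: "\<bar>\<Delta> - I\<bar> \<le> (M / \<bar>w\<bar>) * (s powr - \<sigma> / \<sigma>)" .
  have FS: "\<bar>F y * S y\<bar> \<le> (M / \<bar>w\<bar>) * s powr - \<sigma>" if "s \<le> y" for y
  proof -
    have "\<bar>F y * S y\<bar> \<le> (M * y powr - \<sigma>) * (1 / \<bar>w\<bar>)"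
      unfolding abs_mult using that A M by (intro mult_mono F S) auto
    also have "\<dots> \<le> (M * s powr - \<sigma>) * (1 / \<bar>w\<bar>)"
      using that A M \<sigma> by (intro mult_right_mono mult_left_mono powr_mono2') auto
    finally show ?thesis by simp
  qed
  \<comment> \<open>The two boundary terms account for the 2 in the constant, the integral of F' for
    the \<open>1 / \<sigma>\<close>.\<close>
  have "\<bar>I\<bar> \<le> \<bar>\<Delta> - I\<bar> + \<bar>F r * S r\<bar> + \<bar>F s * S s\<bar>" unfolding \<Delta>_def by linarith
  also have "\<dots> \<le> (M / \<bar>w\<bar>) * (s powr - \<sigma> / \<sigma>) + (M / \<bar>w\<bar>) * s powr - \<sigma> + (M / \<bar>w\<bar>) * s powr - \<sigma>"
    using a FS[of r] FS[of s] A by (intro add_mono) auto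
  also have "\<dots> = (2 + 1 / \<sigma>) * M * s powr - \<sigma> / \<bar>w\<bar>"
    by (simp add: algebra_simps add_divide_distrib)
  finally show ?thesis by (simp add: I_def)
qed

lemma tendsto_at_top_of_powr_Cauchy:
  fixes I :: "real \<Rightarrow> real"
  assumes I: "\<And>s r. 1 \<le> s \<Longrightarrow> s \<le> r \<Longrightarrow> \<bar>I r - I s\<bar> \<le> K * s powr - \<sigma>" and \<sigma>: "\<sigma> > 0"
  shows "\<exists>L. (I \<longlongrightarrow> L) at_top"
proof -
  have K0: "((\<lambda>s. K * s powr - \<sigma>) \<longlongrightarrow> 0) at_top"
    using tendsto_mult_right_zero[OF tendsto_neg_powr[OF _ filterlim_ident]] \<sigma> by auto
  have "Cauchy (\<lambda>n. I (real n))"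
  proof (rule metric_CauchyI)
    fix e :: real assume "e > 0"
    then have "\<forall>\<^sub>F s in at_top. K * s powr - \<sigma> < e / 2 \<and> s \<ge> 1"
      by (intro eventually_conj order_tendstoD(2)[OF K0] eventually_ge_at_top) simp
    then obtain s0 where s0: "\<And>s. s \<ge> s0 \<Longrightarrow> K * s powr - \<sigma> < e / 2 \<and> s \<ge> 1"
      by (auto simp: eventually_at_top_linorder)
    define N where "N = nat \<lceil>max s0 0\<rceil>"
    have N: "real N \<ge> s0" unfolding N_def by linarith
    show "\<exists>M. \<forall>m\<ge>M. \<forall>n\<ge>M. dist (I (real m)) (I (real n)) < e"
    proof (intro exI[of _ N] allI impI)
      fix m n assume "N \<le> m" "N \<le> n"
      then have "\<bar>I (real m) - I (real N)\<bar> < e / 2" "\<bar>I (real n) - I (real N)\<bar> < e / 2"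
        using I[of "real N"] s0[OF N] le_less_trans of_nat_le_iff by meson+
      then show "dist (I (real m)) (I (real n)) < e" unfolding dist_real_def by linarith
    qed
  qed
  then obtain L where L: "(\<lambda>n. I (real n)) \<longlonglongrightarrow> L" using Cauchy_convergent convergent_def by blast
  have bound: "\<bar>I s - L\<bar> \<le> K * s powr - \<sigma>" if s: "s \<ge> 1" for s
  proof (rule tendsto_upperbound)
    show "(\<lambda>n. \<bar>I s - I (real n)\<bar>) \<longlonglongrightarrow> \<bar>I s - L\<bar>" by (intro tendsto_intros L)
    show "\<forall>\<^sub>F n in sequentially. \<bar>I s - I (real n)\<bar> \<le> K * s powr - \<sigma>"
      using eventually_ge_at_top[of "nat \<lceil>s\<rceil>"]
    proof eventually_elim
      case (elim n)
      then have "s \<le> real n" by linarith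
      from I[OF s this] show ?case by (simp add: abs_minus_commute)
    qed
  qed simp
  have "((\<lambda>s. I s - L) \<longlongrightarrow> 0) at_top"
  proof (rule Lim_null_comparison[OF _ K0])
    show "\<forall>\<^sub>F s in at_top. norm (I s - L) \<le> K * s powr - \<sigma>"
      using eventually_ge_at_top[of "1::real"] by eventually_elim (use bound in auto)
  qed
  then show ?thesis using LIM_zero_cancel by blast
qed

section \<open>Singularities at vanishing frequency\<close>

text \<open>An envelope, uniform in the upper limit and the phase, for the integral of
  \<open>y powr - \<sigma>\<close> times a cosine of frequency w. The exponent \<delta> - 1 exceeds
  -1, so the singularity is integrable. At w = 0 the value is 0 by the convention of
  \<open>powr\<close>, which is why the estimates assume w \<noteq> 0.\<close>

definition singular_bound :: "real \<Rightarrow> real \<Rightarrow> real" where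
  "singular_bound \<delta> w = (if \<bar>w\<bar> < 1 then \<bar>w\<bar> powr (\<delta> - 1) else 1 / \<bar>w\<bar>)"

lemma singular_bound_nonneg [simp]: "singular_bound \<delta> w \<ge> 0"
  by (simp add: singular_bound_def)

lemma singular_bound_minus [simp]: "singular_bound \<delta> (- w) = singular_bound \<delta> w"
  by (simp add: singular_bound_def)

text \<open>For small w the range is split at \<open>1 / \<bar>w\<bar>\<close>: up to there the
  cosine hardly oscillates and is bounded by 1, beyond it integration by parts applies. Both parts
  are of order \<open>\<bar>w\<bar> powr (\<delta> - 1)\<close>. Weakening \<sigma> to some \<delta>
  \<le> 1/2 avoids distinguishing \<sigma> below, at and above 1.\<close>

lemma cos_powr_integral_bound:
  assumes \<sigma>: "\<sigma> > 0" and \<delta>: "0 < \<delta>" "\<delta> \<le> 1/2" "\<delta> \<le> \<sigma>"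
  shows "\<exists>C\<ge>0. \<forall>w c r. w \<noteq> 0 \<longrightarrow> \<bar>integral {1..r} (\<lambda>y. y powr - \<sigma> * cos (w * y + c))\<bar> \<le> C * singular_bound \<delta> w"
proof -
  define M where "M = 1 + \<sigma>"
  define C0 where "C0 = (2 + 1 / \<sigma>) * M"
  have C0: "C0 \<ge> 0" using \<sigma> by (simp add: C0_def M_def)
  have tail: "\<bar>integral {s..r} (\<lambda>y. y powr - \<sigma> * cos (w * y + c))\<bar> \<le> C0 * s powr - \<sigma> / \<bar>w\<bar>"
    if "w \<noteq> 0" "1 \<le> s" "s \<le> r" for w c s r
    unfolding C0_def
  proof (rule oscillatory_integral_bound[where A=1])
    fix y :: real assume y: "y \<ge> 1"
    show "((\<lambda>y. y powr - \<sigma>) has_real_derivative - \<sigma> * y powr (- \<sigma> - 1)) (at y)"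
      using y by (auto intro!: derivative_eq_intros)
    show "\<bar>y powr - \<sigma>\<bar> \<le> M * y powr - \<sigma>"
      using \<sigma> by (simp add: M_def distrib_right)
    show "\<bar>- \<sigma> * y powr (- \<sigma> - 1)\<bar> \<le> M * y powr (- \<sigma> - 1)"
      using \<sigma> by (simp add: M_def abs_mult distrib_right)
  qed (use that \<sigma> in auto)
  have head: "\<bar>integral {1..r} (\<lambda>y. y powr - \<sigma> * cos (w * y + c))\<bar> \<le> 2 * q powr (1 - \<delta>)"
    if "1 \<le> r" "r \<le> q" for w c r q
  proof -
    have i1: "(\<lambda>y. y powr - \<sigma> * cos (w * y + c)) integrable_on {1..r}"
      by (intro integrable_continuous_real continuous_intros) auto
    \<comment> \<open>The exponent is -\<delta>, written as an instance of the power integral with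
      the negative parameter \<delta> - 1 in place of \<sigma>.\<close>
    have i2: "((\<lambda>y. y powr (- (\<delta> - 1) - 1)) has_integral (1 powr - (\<delta> - 1) - r powr - (\<delta> - 1)) / (\<delta> - 1)) {1..r}"
      by (rule has_integral_powr_interval) (use \<delta> that in auto)
    have "norm (integral {1..r} (\<lambda>y. y powr - \<sigma> * cos (w * y + c))) \<le> integral {1..r} (\<lambda>y. y powr (- (\<delta> - 1) - 1))"
    proof (rule Henstock_Kurzweil_Integration.integral_norm_bound_integral[OF i1])
      show "(\<lambda>y. y powr (- (\<delta> - 1) - 1)) integrable_on {1..r}" using i2 by blast
      fix y assume y: "y \<in> {1..r}"
      have "y powr - \<sigma> * \<bar>cos (w * y + c)\<bar> \<le> y powr - \<delta> * 1"
        using y \<delta> by (intro mult_mono powr_mono) auto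
      then show "norm (y powr - \<sigma> * cos (w * y + c)) \<le> y powr (- (\<delta> - 1) - 1)" by (simp add: abs_mult)
    qed
    also have "\<dots> = (r powr (1 - \<delta>) - 1) / (1 - \<delta>)"
      using integral_unique[OF i2] \<delta> by (simp add: field_simps)
    also have "\<dots> \<le> r powr (1 - \<delta>) / (1 - \<delta>)" using \<delta> by (intro divide_right_mono) auto
    \<comment> \<open>Here \<delta> \<le> 1/2 enters; it yields the constant 2, independent of
      \<delta>.\<close>
    also have "\<dots> \<le> r powr (1 - \<delta>) / (1 / 2)" using \<delta> by (intro divide_left_mono) auto
    also have "\<dots> \<le> 2 * q powr (1 - \<delta>)" using that \<delta> by (simp add: powr_mono2)
    finally show ?thesis by simp
  qed
  have "\<bar>integral {1..r} (\<lambda>y. y powr - \<sigma> * cos (w * y + c))\<bar> \<le> (2 + C0) * singular_bound \<delta> w" if w: "w \<noteq> 0" for w c r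
  proof (cases "1 \<le> r")
    case False
    then show ?thesis using C0 by simp
  next
    case r: True
    show ?thesis
    proof (cases "\<bar>w\<bar> < 1")
      case False
      have "\<bar>integral {1..r} (\<lambda>y. y powr - \<sigma> * cos (w * y + c))\<bar> \<le> C0 * (1 / \<bar>w\<bar>)"
        using tail[OF w _ r] by simp
      also have "\<dots> \<le> (2 + C0) * (1 / \<bar>w\<bar>)" by (intro mult_right_mono) auto
      finally show ?thesis using False by (simp add: singular_bound_def)
    next
      case True
      define q where "q = 1 / \<bar>w\<bar>"
      have q: "q \<ge> 1" using True w by (simp add: q_def)
      have qd: "q powr (1 - \<delta>) = \<bar>w\<bar> powr (\<delta> - 1)"
        using w powr_minus_divide[of "\<bar>w\<bar>" "1 - \<delta>"] by (simp add: q_def powr_divide)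
      have sb: "singular_bound \<delta> w = \<bar>w\<bar> powr (\<delta> - 1)" using True by (simp add: singular_bound_def)
      show ?thesis
      proof (cases "r \<le> q")
        case True
        have "0 \<le> C0 * \<bar>w\<bar> powr (\<delta> - 1)" using C0 by simp
        then show ?thesis using head[OF r True, of w c] unfolding qd sb by (simp add: distrib_right)
      next
        case False
        have ii: "(\<lambda>y. y powr - \<sigma> * cos (w * y + c)) integrable_on {1..r}"
          by (intro integrable_continuous_real continuous_intros) auto
        have "integral {1..r} (\<lambda>y. y powr - \<sigma> * cos (w * y + c))
            = integral {1..q} (\<lambda>y. y powr - \<sigma> * cos (w * y + c)) + integral {q..r} (\<lambda>y. y powr - \<sigma> * cos (w * y + c))"
          by (rule Henstock_Kurzweil_Integration.integral_combine[symmetric, OF _ _ ii]) (use q False in auto)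
        moreover have "\<bar>integral {1..q} (\<lambda>y. y powr - \<sigma> * cos (w * y + c))\<bar> \<le> 2 * \<bar>w\<bar> powr (\<delta> - 1)"
          using head[OF q order_refl, of w c] unfolding qd .
        moreover have "\<bar>integral {q..r} (\<lambda>y. y powr - \<sigma> * cos (w * y + c))\<bar> \<le> C0 * \<bar>w\<bar> powr (\<delta> - 1)"
        proof -
          have "\<bar>integral {q..r} (\<lambda>y. y powr - \<sigma> * cos (w * y + c))\<bar> \<le> C0 * q powr - \<sigma> / \<bar>w\<bar>"
            using tail[OF w q] False by simp
          also have "\<dots> = C0 * (q powr - \<sigma> * q)" by (simp add: q_def)
          also have "q powr - \<sigma> * q = q powr (1 - \<sigma>)"
            using q powr_add[of q "- \<sigma>" 1] by simp
          also have "C0 * q powr (1 - \<sigma>) \<le> C0 * q powr (1 - \<delta>)"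
            using q \<delta> C0 by (intro mult_left_mono powr_mono) auto
          finally show ?thesis unfolding qd .
        qed
        ultimately show ?thesis unfolding sb by (simp add: distrib_right)
      qed
    qed
  qed
  then show ?thesis using C0 by (intro exI[of _ "2 + C0"]) auto
qed

lemma borel_measurable_singular_bound [measurable]: "singular_bound \<delta> \<in> borel_measurable borel"
  unfolding singular_bound_def[abs_def] by measurable

lemma nn_integral_singular_bound_near_0:
  assumes "\<delta> > 0"
  shows "(\<integral>\<^sup>+w. ennreal (indicator {-1<..<1} w * \<bar>w\<bar> powr (\<delta> - 1)) \<partial>lborel) < \<infinity>"
proof -
  have int: "integrable lborel (\<lambda>w::real. indicator {0<..1} w * w powr (\<delta> - 1))"
    by (rule integrable_powr_near_0) (use assms in auto)
  have int': "integrable lborel (\<lambda>w::real. indicator {0<..1} (- w) * (- w) powr (\<delta> - 1))"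
    using lborel_integrable_real_affine[OF int, of "-1" 0] by simp
  have "integrable lborel (\<lambda>w::real. indicator {-1<..<1} w * \<bar>w\<bar> powr (\<delta> - 1))"
  proof (rule Bochner_Integration.integrable_bound[OF Bochner_Integration.integrable_add[OF int int']])
    show "AE w in lborel. norm (indicator {-1<..<1} w * \<bar>w\<bar> powr (\<delta> - 1))
        \<le> norm (indicator {0<..1} w * w powr (\<delta> - 1) + indicator {0<..1} (- w) * (- w) powr (\<delta> - 1))"
      by (rule AE_I2) (auto simp: indicator_def abs_if)
  qed measurable
  then show ?thesis
    by (simp add: integrable_iff_bounded)
qed

text \<open>The square of \<open>z powr (- \<alpha> - 1/2)\<close> cancels the density, so
  multiplication by it carries square integrability for Lebesgue measure on the half-line over to
  \<open>\<mu> \<alpha>\<close>.\<close>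

lemma sq_integrable_powr_times:
  assumes h: "h \<in> borel_measurable borel" and int: "integrable lborel (\<lambda>z. indicator {0<..} z * (h z)\<^sup>2)"
  shows "(\<lambda>z. complex_of_real (z powr (- \<alpha> - 1/2) * h z)) \<in> sq_integrable (\<mu> \<alpha>)"
proof -
  note [measurable] = h
  have m: "(\<lambda>z. complex_of_real (z powr (- \<alpha> - 1/2) * h z)) \<in> borel_measurable (\<mu> \<alpha>)"
    by (rule borel_measurable_mu) measurable
  have m2: "(\<lambda>z. (cmod (complex_of_real (z powr (- \<alpha> - 1/2) * h z)))\<^sup>2) \<in> borel_measurable (\<mu> \<alpha>)"
    by (rule borel_measurable_mu) measurable
  have "indicator {0<..} z *\<^sub>R (z powr (2 * \<alpha> + 1) *\<^sub>R (cmod (complex_of_real (z powr (- \<alpha> - 1/2) * h z)))\<^sup>2)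
      = indicator {0<..} z * (h z)\<^sup>2" for z :: real
  proof (cases "z > 0")
    case True
    have "z powr (2 * \<alpha> + 1) * (z powr (- \<alpha> - 1/2))\<^sup>2 = 1"
      using True by (simp add: power2_eq_square flip: powr_add)
    then show ?thesis using True by (simp add: norm_mult power_mult_distrib flip: mult.assoc)
  qed simp
  then have "integrable (\<mu> \<alpha>) (\<lambda>z. (cmod (complex_of_real (z powr (- \<alpha> - 1/2) * h z)))\<^sup>2)"
    unfolding integrable_mu_iff[OF m2] by (simp only: int)
  then show ?thesis using m by (simp add: sq_integrable_def)
qed

text \<open>The bound is split into h1 near its singularity and h2 away from it. h2 is square
  integrable and is paired with f for every x. h1 is integrable but for \<delta> \<le> 1/2 not
  square integrable; there the convolution of h1 with the integrable function g, the density of the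
  squared modulus of f, is finite for almost every x. The sign s covers both z + x and z -
  x.\<close>

lemma AE_singular_bound_integrable:
  assumes f: "f \<in> sq_integrable (\<mu> \<alpha>)" and \<delta>: "\<delta> > 0" and s: "\<bar>s\<bar> = 1"
  shows "AE x in lborel. integrable (\<mu> \<alpha>) (\<lambda>z. z powr (- \<alpha> - 1/2) * singular_bound \<delta> (z + s * x + q) * cmod (f z))"
proof -
  define h1 where "h1 w = indicator {-1<..<1} w * \<bar>w\<bar> powr (\<delta> - 1)" for w :: real
  define h2 where "h2 w = (if \<bar>w\<bar> < 1 then 0 else 1 / \<bar>w\<bar>)" for w :: real
  have [measurable]: "h1 \<in> borel_measurable borel" "h2 \<in> borel_measurable borel"
    unfolding h1_def[abs_def] h2_def[abs_def] by measurable
  have sb: "singular_bound \<delta> w = h1 w + h2 w" for w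
    by (auto simp: singular_bound_def h1_def h2_def indicator_def abs_less_iff)
  have fm: "f \<in> borel_measurable (\<mu> \<alpha>)" by (rule sq_integrable_measurable[OF f])
  define g where "g z = indicator {0<..} z *\<^sub>R (z powr (2 * \<alpha> + 1) *\<^sub>R (cmod (f z))\<^sup>2)" for z
  have f2m: "(\<lambda>z. (cmod (f z))\<^sup>2) \<in> borel_measurable (\<mu> \<alpha>)" using fm by measurable
  have gint: "integrable lborel g"
    using sq_integrableD[OF f] unfolding integrable_mu_iff[OF f2m] g_def .
  then have gm [measurable]: "g \<in> borel_measurable borel" by simp
  have g0: "g z \<ge> 0" for z by (simp add: g_def)
  have h10: "h1 w \<ge> 0" for w by (simp add: h1_def)
  define Kh where "Kh = (\<integral>\<^sup>+w. ennreal (h1 w) \<partial>lborel)"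
  have Kh: "Kh < \<infinity>" unfolding Kh_def h1_def by (rule nn_integral_singular_bound_near_0[OF \<delta>])
  have shift: "(\<integral>\<^sup>+x. ennreal (h1 (p + s * x)) \<partial>lborel) = Kh" for p
    using nn_integral_real_affine[of "\<lambda>w. ennreal (h1 w)" s p] s by (auto simp: Kh_def)
  have shift': "(\<integral>\<^sup>+z. ennreal (h1 (z + p)) \<partial>lborel) = Kh" for p
    using nn_integral_real_affine[of "\<lambda>w. ennreal (h1 w)" 1 p] by (simp add: Kh_def add.commute)
  have "(\<integral>\<^sup>+x. \<integral>\<^sup>+z. ennreal (g z * h1 (z + s * x + q)) \<partial>lborel \<partial>lborel)
      = (\<integral>\<^sup>+z. \<integral>\<^sup>+x. ennreal (g z * h1 (z + s * x + q)) \<partial>lborel \<partial>lborel)"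
    by (rule lborel_pair.Fubini') measurable
  also have "\<dots> = (\<integral>\<^sup>+z. ennreal (g z) * Kh \<partial>lborel)"
  proof (rule nn_integral_cong)
    fix z
    have "(\<integral>\<^sup>+x. ennreal (g z * h1 (z + s * x + q)) \<partial>lborel) = (\<integral>\<^sup>+x. ennreal (g z) * ennreal (h1 ((z + q) + s * x)) \<partial>lborel)"
      by (rule nn_integral_cong) (simp add: ennreal_mult g0 h10 add_ac)
    also have "\<dots> = ennreal (g z) * (\<integral>\<^sup>+x. ennreal (h1 ((z + q) + s * x)) \<partial>lborel)"
      by (rule nn_integral_cmult) measurable
    finally show "(\<integral>\<^sup>+x. ennreal (g z * h1 (z + s * x + q)) \<partial>lborel) = ennreal (g z) * Kh" by (simp only: shift)
  qed
  also have "\<dots> = (\<integral>\<^sup>+z. ennreal (g z) \<partial>lborel) * Kh"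
    by (rule nn_integral_multc) measurable
  also have "\<dots> < \<infinity>"
    using gint Kh g0 by (simp add: nn_integral_eq_integral ennreal_mult_less_top)
  finally have "AE x in lborel. (\<integral>\<^sup>+z. ennreal (g z * h1 (z + s * x + q)) \<partial>lborel) \<noteq> \<infinity>"
    by (intro nn_integral_PInf_AE) (auto simp: less_top)
  then show ?thesis
  proof eventually_elim
    case (elim x)
    define p where "p = s * x + q"
    have gh: "integrable lborel (\<lambda>z. g z * h1 (z + p))"
      using elim g0 h10 by (intro integrableI_bounded) (auto simp: p_def add.assoc less_top)
    have hh: "integrable lborel (\<lambda>z. h1 (z + p))"
      using Kh h10 shift'[of p] by (intro integrableI_bounded) auto
    have i1: "integrable (\<mu> \<alpha>) (\<lambda>z. z powr (- \<alpha> - 1/2) * h1 (z + p) * cmod (f z))"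
    proof -
      have m: "(\<lambda>z. z powr (- \<alpha> - 1/2) * h1 (z + p) * cmod (f z)) \<in> borel_measurable (\<mu> \<alpha>)"
        by (rule borel_measurable_times[OF borel_measurable_mu measurable_compose[OF fm borel_measurable_norm]]) measurable
      have "integrable lborel (\<lambda>z. indicator {0<..} z *\<^sub>R (z powr (2 * \<alpha> + 1) *\<^sub>R (z powr (- \<alpha> - 1/2) * h1 (z + p) * cmod (f z))))"
      proof (rule Bochner_Integration.integrable_bound[OF Bochner_Integration.integrable_add[OF gh hh]])
        show "(\<lambda>z. indicator {0<..} z *\<^sub>R (z powr (2 * \<alpha> + 1) *\<^sub>R (z powr (- \<alpha> - 1/2) * h1 (z + p) * cmod (f z)))) \<in> borel_measurable lborel"
          unfolding measurable_lborel1 measurable_lborel2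
          by (rule borel_measurable_mu_indicator, rule borel_measurable_scaleR[OF borel_measurable_mu m]) measurable
        have "indicator {0<..} z * (z powr (2 * \<alpha> + 1) * (z powr (- \<alpha> - 1/2) * h1 (z + p) * cmod (f z))) \<le> g z * h1 (z + p) + h1 (z + p)" for z
        proof (cases "z > 0")
          case True
          define b where "b = z powr (\<alpha> + 1/2) * cmod (f z)"
          have "z powr (2 * \<alpha> + 1) * z powr (- \<alpha> - 1/2) = z powr (\<alpha> + 1/2)"
            by (simp flip: powr_add)
          then have "z powr (2 * \<alpha> + 1) * (z powr (- \<alpha> - 1/2) * h1 (z + p) * cmod (f z)) = b * h1 (z + p)"
            by (simp add: b_def flip: mult.assoc)
          \<comment> \<open>Trading b for its square plus 1 leaves the convolution with g, finite at
            this x, and the integrable function h1 itself.\<close>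
          also have "\<dots> \<le> (b\<^sup>2 + 1) * h1 (z + p)"
          proof (rule mult_right_mono[OF _ h10])
            have "0 \<le> b" by (simp add: b_def)
            then show "b \<le> b\<^sup>2 + 1" using sum_squares_bound[of b 1] by simp
          qed
          also have "b\<^sup>2 = g z"
            using True by (simp add: b_def g_def power_mult_distrib power2_eq_square[of "z powr (\<alpha> + 1/2)"] flip: powr_add)
          finally show ?thesis using True by (simp add: distrib_right)
        qed (use g0 h10 in simp)
        then show "AE z in lborel. norm (indicator {0<..} z *\<^sub>R (z powr (2 * \<alpha> + 1) *\<^sub>R (z powr (- \<alpha> - 1/2) * h1 (z + p) * cmod (f z))))
            \<le> norm (g z * h1 (z + p) + h1 (z + p))"
          using g0 h10 by (intro AE_I2) (simp add: abs_mult)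
      qed
      then show ?thesis unfolding integrable_mu_iff[OF m] .
    qed
    have i2: "integrable (\<mu> \<alpha>) (\<lambda>z. z powr (- \<alpha> - 1/2) * h2 (z + p) * cmod (f z))"
    proof -
      have tail: "integrable lborel (\<lambda>w::real. indicator {1..} w * w powr (-2))"
        by (rule integrable_powr_at_top) auto
      have tail': "integrable lborel (\<lambda>w::real. indicator {1..} (- w) * (- w) powr (-2))"
        using lborel_integrable_real_affine[OF tail, of "-1" 0] by simp
      have "integrable lborel (\<lambda>w. (h2 w)\<^sup>2)"
      proof (rule Bochner_Integration.integrable_bound[OF Bochner_Integration.integrable_add[OF tail tail']])
        show "AE w in lborel. norm ((h2 w)\<^sup>2) \<le> norm (indicator {1..} w * w powr (-2) + indicator {1..} (- w) * (- w) powr (-2))"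
          by (rule AE_I2) (auto simp: h2_def indicator_def abs_if powr_minus power_divide inverse_eq_divide)
      qed measurable
      from lborel_integrable_real_affine[OF this, of 1 p]
      have "integrable lborel (\<lambda>z. (h2 (z + p))\<^sup>2)" by (simp add: add.commute)
      from integrable_mult_indicator[OF _ this, of "{0<..}"]
      have "(\<lambda>z. complex_of_real (z powr (- \<alpha> - 1/2) * h2 (z + p))) \<in> sq_integrable (\<mu> \<alpha>)"
        by (intro sq_integrable_powr_times) simp_all
      from integrable_norm[OF sq_integrable_mult_integrable[OF this f]]
      show ?thesis
        by (simp add: norm_mult abs_mult) (simp add: h2_def)
    qed
    from Bochner_Integration.integrable_add[OF i1 i2]
    show ?case by (simp add: sb p_def algebra_simps)
  qed
qed

section \<open>Leading term and remainder of a product of Bessel functions\<close>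

lemma oscillatory_integral_convergent:
  fixes F F' :: "real \<Rightarrow> real"
  assumes dF: "\<And>y. y \<ge> 1 \<Longrightarrow> (F has_real_derivative F' y) (at y)"
    and F: "\<And>y. y \<ge> 1 \<Longrightarrow> \<bar>F y\<bar> \<le> M * y powr - \<sigma>"
    and F': "\<And>y. y \<ge> 1 \<Longrightarrow> \<bar>F' y\<bar> \<le> M * y powr (- \<sigma> - 1)"
    and \<sigma>: "\<sigma> > 0" and w: "w \<noteq> 0"
  shows "\<exists>L. ((\<lambda>r. integral {1..r} (\<lambda>y. F y * cos (w * y + c))) \<longlongrightarrow> L) at_top"
proof (rule tendsto_at_top_of_powr_Cauchy[OF _ \<sigma>])
  fix s r :: real assume sr: "1 \<le> s" "s \<le> r"
  have "continuous_on {1..r} F"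
    by (intro continuous_at_imp_continuous_on ballI DERIV_isCont[OF dF]) auto
  then have int: "(\<lambda>y. F y * cos (w * y + c)) integrable_on {1..r}"
    by (intro integrable_continuous_real continuous_intros)
  have "integral {1..r} (\<lambda>y. F y * cos (w * y + c)) - integral {1..s} (\<lambda>y. F y * cos (w * y + c))
      = integral {s..r} (\<lambda>y. F y * cos (w * y + c))"
    using Henstock_Kurzweil_Integration.integral_combine[OF sr int] by simp
  then show "\<bar>integral {1..r} (\<lambda>y. F y * cos (w * y + c)) - integral {1..s} (\<lambda>y. F y * cos (w * y + c))\<bar>
      \<le> ((2 + 1 / \<sigma>) * M / \<bar>w\<bar>) * s powr - \<sigma>"
    using oscillatory_integral_bound[where F=F and F'=F' and A=1, OF dF F F' \<sigma> w _ sr] by simp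
qed

text \<open>Only the existence of amplitude and phase is established; classically they are
  \<open>sqrt (2 / pi)\<close> and \<open>pi * \<nu> / 2 + pi / 4\<close>. The bound holds from any
  s0 > 0 on, so it covers s = t * y and s = x * y for all y \<ge> 1. The derivative is included
  because the error term is later integrated by parts.\<close>

definition bessel_phase :: "real \<Rightarrow> real \<Rightarrow> real \<Rightarrow> bool" where
  "bessel_phase \<nu> \<rho> c \<longleftrightarrow> (\<forall>s0>0. \<exists>C\<ge>0. \<forall>s\<ge>s0.
     \<bar>bessel_osc \<nu> s - \<rho> * cos (s - c)\<bar> \<le> C / s \<and> \<bar>bessel_osc_deriv \<nu> s + \<rho> * sin (s - c)\<bar> \<le> C / s)"

lemma bessel_phase_exists:
  assumes "\<nu> > -1"
  shows "\<exists>\<rho> c. bessel_phase \<nu> \<rho> c"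
  using bessel_osc_asymptotics[OF assms] unfolding bessel_phase_def by metis

text \<open>Starting at y = 1 keeps the power away from its possible singularity at 0; the product
  of Bessel functions on (0, 1) is bounded and goes to the remainder.\<close>

definition leading_term :: "real \<Rightarrow> real \<Rightarrow> real \<Rightarrow> real \<Rightarrow> real \<Rightarrow> real \<Rightarrow> real \<Rightarrow> real" where
  "leading_term p t c' x c \<kappa> y = (if y \<ge> 1 then \<kappa> * y powr p * (cos (t * y - c') * cos (x * y - c)) else 0)"

lemma borel_measurable_leading_term [measurable]: "leading_term p t c' x c \<kappa> \<in> borel_measurable borel"
  unfolding leading_term_def[abs_def] by measurable

text \<open>For y \<ge> 1 the error is telescoped as \<open>(a - a') * b + a' * (b - b')\<close>;
  each difference gains a factor \<open>1 / y\<close> over the product of the powers, whose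
  exponents -\<nu> - 1/2 and -\<alpha> - 1/2 add up to p.\<close>

lemma bessel_product_remainder_bound:
  assumes \<alpha>: "\<alpha> > -1" and \<nu>: "\<nu> > -1" and ph: "bessel_phase \<nu> \<rho>' c'" "bessel_phase \<alpha> \<rho> c"
    and t: "t > 0" and x: "x > 0"
    and \<kappa>: "\<kappa> = \<rho>' * \<rho> * t powr (- \<nu> - 1/2) * x powr (- \<alpha> - 1/2)"
    and p: "p = - \<nu> - \<alpha> - 1"
  shows "\<exists>C\<ge>0. \<forall>y>0.
    \<bar>bessel_quot \<nu> (t * y) * bessel_quot \<alpha> (x * y) - leading_term p t c' x c \<kappa> y\<bar>
      \<le> C * (if y < 1 then 1 else y powr (p - 1))"
proof -
  obtain C1 where C1: "C1 \<ge> 0" "\<And>s. s \<ge> t \<Longrightarrow> \<bar>bessel_osc \<nu> s - \<rho>' * cos (s - c')\<bar> \<le> C1 / s"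
    using ph(1) t unfolding bessel_phase_def by blast
  obtain C2 where C2: "C2 \<ge> 0" "\<And>s. s \<ge> x \<Longrightarrow> \<bar>bessel_osc \<alpha> s - \<rho> * cos (s - c)\<bar> \<le> C2 / s"
    using ph(2) x unfolding bessel_phase_def by blast
  obtain B where B: "B \<ge> 0" "\<And>s. s \<ge> x \<Longrightarrow> \<bar>bessel_osc \<alpha> s\<bar> \<le> B"
    using bessel_osc_bound[OF \<alpha> x] by blast
  obtain D1 where D1: "D1 \<ge> 0" "\<And>s. 0 < s \<and> s \<le> t \<Longrightarrow> \<bar>bessel_quot \<nu> s\<bar> \<le> D1"
    using bessel_quot_bound_near_0[OF \<nu>] by blast
  obtain D2 where D2: "D2 \<ge> 0" "\<And>s. 0 < s \<and> s \<le> x \<Longrightarrow> \<bar>bessel_quot \<alpha> s\<bar> \<le> D2"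
    using bessel_quot_bound_near_0[OF \<alpha>] by blast
  define T where "T = t powr (- \<nu> - 1/2) * x powr (- \<alpha> - 1/2)"
  have T: "T \<ge> 0" by (simp add: T_def)
  define K where "K = C1 / t * B + \<bar>\<rho>'\<bar> * (C2 / x)"
  have K: "K \<ge> 0" using C1 C2 B t x by (simp add: K_def)
  have large: "\<bar>bessel_quot \<nu> (t * y) * bessel_quot \<alpha> (x * y) - leading_term p t c' x c \<kappa> y\<bar> \<le> T * K * y powr (p - 1)"
    if y: "y \<ge> 1" for y
  proof -
    define a where "a = bessel_osc \<nu> (t * y)"
    define b where "b = bessel_osc \<alpha> (x * y)"
    define a' where "a' = \<rho>' * cos (t * y - c')"
    define b' where "b' = \<rho> * cos (x * y - c)"
    have "y powr (- \<nu> - 1/2) * y powr (- \<alpha> - 1/2) = y powr p"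
      by (simp add: p flip: powr_add)
    then have "(t * y) powr (- \<nu> - 1/2) * (x * y) powr (- \<alpha> - 1/2) = T * y powr p"
      by (simp add: T_def powr_mult mult_ac)
    then have "bessel_quot \<nu> (t * y) * bessel_quot \<alpha> (x * y) = T * y powr p * (a * b)"
      using bessel_quot_eq_osc[of "t * y" \<nu>] bessel_quot_eq_osc[of "x * y" \<alpha>] t x y
      by (simp add: a_def b_def)
    moreover have "leading_term p t c' x c \<kappa> y = T * y powr p * (a' * b')"
      using y by (simp add: leading_term_def \<kappa> T_def a'_def b'_def)
    ultimately have *: "bessel_quot \<nu> (t * y) * bessel_quot \<alpha> (x * y) - leading_term p t c' x c \<kappa> y
        = T * y powr p * ((a - a') * b + a' * (b - b'))" by (simp add: algebra_simps)
    have "\<bar>(a - a') * b + a' * (b - b')\<bar> \<le> K / y"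
    proof -
      have "\<bar>(a - a') * b + a' * (b - b')\<bar> \<le> \<bar>a - a'\<bar> * \<bar>b\<bar> + \<bar>a'\<bar> * \<bar>b - b'\<bar>"
        by (rule order_trans[OF abs_triangle_ineq]) (simp add: abs_mult)
      also have "\<dots> \<le> C1 / (t * y) * B + \<bar>\<rho>'\<bar> * (C2 / (x * y))"
      proof (intro add_mono mult_mono)
        show "\<bar>a - a'\<bar> \<le> C1 / (t * y)" unfolding a_def a'_def by (rule C1) (use t y in simp)
        show "\<bar>b\<bar> \<le> B" unfolding b_def by (rule B) (use x y in simp)
        show "\<bar>b - b'\<bar> \<le> C2 / (x * y)" unfolding b_def b'_def by (rule C2) (use x y in simp)
        show "\<bar>a'\<bar> \<le> \<bar>\<rho>'\<bar>" unfolding a'_def abs_mult by (simp add: mult_left_le)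
      qed (use C1 C2 B t x y in auto)
      also have "\<dots> = K / y" using t x y by (simp add: K_def field_simps)
      finally show ?thesis .
    qed
    then have "\<bar>bessel_quot \<nu> (t * y) * bessel_quot \<alpha> (x * y) - leading_term p t c' x c \<kappa> y\<bar> \<le> T * y powr p * (K / y)"
    proof -
      assume "\<bar>(a - a') * b + a' * (b - b')\<bar> \<le> K / y"
      then have "T * y powr p * \<bar>(a - a') * b + a' * (b - b')\<bar> \<le> T * y powr p * (K / y)"
        using T by (intro mult_left_mono) auto
      moreover have "\<bar>T * y powr p * ((a - a') * b + a' * (b - b'))\<bar> = T * y powr p * \<bar>(a - a') * b + a' * (b - b')\<bar>"
        using T unfolding abs_mult by simp
      ultimately show "\<bar>bessel_quot \<nu> (t * y) * bessel_quot \<alpha> (x * y) - leading_term p t c' x c \<kappa> y\<bar> \<le> T * y powr p * (K / y)"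
        by (simp only: *)
    qed
    also have "\<dots> = T * K * y powr (p - 1)"
      using y by (simp add: powr_diff)
    finally show ?thesis .
  qed
  have small: "\<bar>bessel_quot \<nu> (t * y) * bessel_quot \<alpha> (x * y) - leading_term p t c' x c \<kappa> y\<bar> \<le> D1 * D2"
    if y: "0 < y" "y < 1" for y
    using y t x D1(1) D2(1) by (simp add: leading_term_def abs_mult) (intro mult_mono D1 D2; simp)
  show ?thesis
  proof (intro exI[of _ "T * K + D1 * D2"] conjI allI impI)
    show "0 \<le> T * K + D1 * D2" using T K D1 D2 by simp
    fix y :: real assume y: "0 < y"
    show "\<bar>bessel_quot \<nu> (t * y) * bessel_quot \<alpha> (x * y) - leading_term p t c' x c \<kappa> y\<bar>
      \<le> (T * K + D1 * D2) * (if y < 1 then 1 else y powr (p - 1))"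
    proof (cases "y < 1")
      case True
      have "0 \<le> T * K" using T K by simp
      then show ?thesis using small[OF y True] True by simp
    next
      case False
      have "0 \<le> D1 * D2 * y powr (p - 1)" using D1 D2 by simp
      then show ?thesis using large[of y] False by (simp add: distrib_right)
    qed
  qed
qed

text \<open>Counting exponents with the density: the squared remainder is of order
  \<open>y powr (- 2 * \<nu> - 3)\<close> and the Hankel integrand of order
  \<open>y powr (- \<nu> - 3/2)\<close>. The latter is integrable at infinity exactly for \<nu> >
  -1/2.\<close>

lemma
  assumes \<alpha>: "\<alpha> > -1" and \<nu>: "\<nu> > -1/2" and p: "p = - \<nu> - \<alpha> - 1"
    and r: "r \<in> borel_measurable borel" and C: "C \<ge> 0"
    and bound: "\<And>y. y > 0 \<Longrightarrow> \<bar>r y\<bar> \<le> C * (if y < 1 then 1 else y powr (p - 1))"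
  shows remainder_sq_integrable: "(\<lambda>y. complex_of_real (r y)) \<in> sq_integrable (\<mu> \<alpha>)"
    and remainder_hankel_integrable:
      "z > 0 \<Longrightarrow> integrable (\<mu> \<alpha>) (hankel_integrand \<alpha> (\<lambda>y. complex_of_real (r y)) z)"
proof -
  note [measurable] = r
  show "(\<lambda>y. complex_of_real (r y)) \<in> sq_integrable (\<mu> \<alpha>)"
  proof (rule sq_integrable_bound)
    show "(\<lambda>y. complex_of_real (r y)) \<in> borel_measurable (\<mu> \<alpha>)"
      by (rule borel_measurable_mu) measurable
    show "integrable (\<mu> \<alpha>) (\<lambda>y. C\<^sup>2 * indicator {0<..1} y + C\<^sup>2 * (indicator {1..} y * y powr (2 * (p - 1))))"
      by (intro Bochner_Integration.integrable_add integrable_mult_right integrable_mu_indicator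
            integrable_mu_powr_at_top \<alpha>) (use \<nu> in \<open>simp_all add: p\<close>)
    have "(cmod (complex_of_real (r y)))\<^sup>2 \<le> C\<^sup>2 * indicator {0<..1} y + C\<^sup>2 * (indicator {1..} y * y powr (2 * (p - 1)))"
      if y: "y > 0" for y
    proof -
      have "\<bar>r y\<bar>\<^sup>2 \<le> (C * (if y < 1 then 1 else y powr (p - 1)))\<^sup>2"
        by (intro power_mono bound y) simp
      moreover have "(y powr (p - 1))\<^sup>2 = y powr (2 * (p - 1))"
        by (simp add: power2_eq_square flip: powr_add)
      ultimately show ?thesis using y
        by (cases "y < 1")
           (auto simp: power_mult_distrib indicator_def intro: order_trans[of _ "C\<^sup>2" "2 * C\<^sup>2"])
    qed
    then show "AE y in \<mu> \<alpha>. (cmod (complex_of_real (r y)))\<^sup>2 \<le> C\<^sup>2 * indicator {0<..1} y + C\<^sup>2 * (indicator {1..} y * y powr (2 * (p - 1)))"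
      by (intro AE_I2) simp
  qed
  show "integrable (\<mu> \<alpha>) (hankel_integrand \<alpha> (\<lambda>y. complex_of_real (r y)) z)" if z: "z > 0"
  proof -
    obtain D1 where D1: "D1 \<ge> 0" "\<And>s. 0 < s \<and> s \<le> z \<Longrightarrow> \<bar>bessel_quot \<alpha> s\<bar> \<le> D1"
      using bessel_quot_bound_near_0[OF \<alpha>] by blast
    obtain D2 where D2: "D2 \<ge> 0" "\<And>s. s \<ge> z \<Longrightarrow> \<bar>bessel_quot \<alpha> s\<bar> \<le> D2 * s powr (- \<alpha> - 1/2)"
      using bessel_quot_bound_at_top[OF \<alpha> z] by blast
    define D where "D = C * (D2 * z powr (- \<alpha> - 1/2))"
    have D: "D \<ge> 0" using C D2 by (simp add: D_def)
    have exponent: "2 * \<alpha> + (p - 1 - \<alpha> - 1/2) < -2" unfolding p using \<nu> by argo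
    show ?thesis
    proof (rule Bochner_Integration.integrable_bound)
      show "integrable (\<mu> \<alpha>) (\<lambda>y. (C * D1) * indicator {0<..1} y + D * (indicator {1..} y * y powr (p - 1 - \<alpha> - 1/2)))"
        by (intro Bochner_Integration.integrable_add integrable_mult_right integrable_mu_indicator
              integrable_mu_powr_at_top \<alpha> exponent) simp
      show "hankel_integrand \<alpha> (\<lambda>y. complex_of_real (r y)) z \<in> borel_measurable (\<mu> \<alpha>)"
        unfolding hankel_integrand_def[abs_def] by (rule borel_measurable_mu) measurable
      have "\<bar>r y\<bar> * \<bar>bessel_quot \<alpha> (z * y)\<bar> \<le> (C * D1) * indicator {0<..1} y + D * (indicator {1..} y * y powr (p - 1 - \<alpha> - 1/2))"
        if y: "y > 0" for y
      proof (cases "y < 1")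
        case True
        then have "\<bar>r y\<bar> * \<bar>bessel_quot \<alpha> (z * y)\<bar> \<le> C * D1"
          using bound[OF y] y z C by (intro mult_mono D1) auto
        then show ?thesis using True y by simp
      next
        case False
        have "\<bar>r y\<bar> * \<bar>bessel_quot \<alpha> (z * y)\<bar> \<le> (C * y powr (p - 1)) * (D2 * (z * y) powr (- \<alpha> - 1/2))"
          using bound[OF y] False z C by (intro mult_mono D2) auto
        also have "\<dots> = D * (y powr (p - 1) * y powr (- \<alpha> - 1/2))"
          by (simp add: powr_mult D_def mult_ac)
        also have "y powr (p - 1) * y powr (- \<alpha> - 1/2) = y powr (p - 1 - \<alpha> - 1/2)"
          by (simp add: algebra_simps flip: powr_add)
        finally have "\<bar>r y\<bar> * \<bar>bessel_quot \<alpha> (z * y)\<bar> \<le> 0 + D * y powr (p - 1 - \<alpha> - 1/2)" by simp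
        also have "\<dots> \<le> (C * D1) * indicator {0<..1} y + D * y powr (p - 1 - \<alpha> - 1/2)"
          using C D1(1) by (intro add_right_mono) simp
        finally show ?thesis using False by simp
      qed
      then show "AE y in \<mu> \<alpha>. norm (hankel_integrand \<alpha> (\<lambda>y. complex_of_real (r y)) z y)
          \<le> norm ((C * D1) * indicator {0<..1} y + D * (indicator {1..} y * y powr (p - 1 - \<alpha> - 1/2)))"
        using C D1(1) D
        by (intro AE_I2) (simp add: hankel_integrand_def norm_mult)
    qed
  qed
qed

text \<open>The error will be evaluated at s = z * y with z arbitrarily small, so the asymptotics
  must be extended down to s = 0. There \<open>bessel_osc \<alpha> s\<close> behaves like
  \<open>s powr (\<alpha> + 1/2)\<close>, which is unbounded if \<alpha> < -1/2; \<theta> measures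
  this. The factor s at the derivative anticipates the chain rule in y.\<close>

lemma bessel_osc_remainder_bound:
  assumes \<alpha>: "\<alpha> > -1" and ph: "bessel_phase \<alpha> \<rho> c" and \<theta>: "\<theta> = max 0 (- \<alpha> - 1/2)"
  shows "\<exists>C\<ge>0. (\<forall>s>0. \<bar>bessel_osc \<alpha> s - \<rho> * cos (s - c)\<bar> \<le> C * (1 + s powr - \<theta>) \<and>
      s * \<bar>bessel_osc_deriv \<alpha> s + \<rho> * sin (s - c)\<bar> \<le> C * (1 + s powr - \<theta>)) \<and>
    (\<forall>s\<ge>1. \<bar>bessel_osc \<alpha> s - \<rho> * cos (s - c)\<bar> \<le> C / s)"
proof -
  obtain C1 where C1: "C1 \<ge> 0" "\<And>s. s \<ge> 1 \<Longrightarrow> \<bar>bessel_osc \<alpha> s - \<rho> * cos (s - c)\<bar> \<le> C1 / s"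
    "\<And>s. s \<ge> 1 \<Longrightarrow> \<bar>bessel_osc_deriv \<alpha> s + \<rho> * sin (s - c)\<bar> \<le> C1 / s"
    using ph unfolding bessel_phase_def by (meson zero_less_one)
  obtain D1 where D1: "D1 \<ge> 0" "\<And>s. 0 < s \<and> s \<le> 1 \<Longrightarrow> \<bar>bessel_quot \<alpha> s\<bar> \<le> D1"
    using bessel_quot_bound_near_0[OF \<alpha>] by blast
  obtain D2 where D2: "D2 \<ge> 0" "\<And>s. 0 < s \<and> s \<le> 1 \<Longrightarrow> \<bar>bessel_quot (\<alpha> + 1) s\<bar> \<le> D2"
    using bessel_quot_bound_near_0[of "\<alpha> + 1"] \<alpha> by auto
  define K where "K = \<bar>\<alpha> + 1/2\<bar> * D1 + D1 + D2 + \<bar>\<rho>\<bar>"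
  have K: "K \<ge> 0" "D1 \<le> K" "\<bar>\<rho>\<bar> \<le> K" "\<bar>\<alpha> + 1/2\<bar> * D1 + D2 \<le> K" using D1 D2 by (auto simp: K_def)
  have small: "\<bar>bessel_osc \<alpha> s - \<rho> * cos (s - c)\<bar> \<le> K * (1 + s powr - \<theta>)"
    "s * \<bar>bessel_osc_deriv \<alpha> s + \<rho> * sin (s - c)\<bar> \<le> K * (1 + s powr - \<theta>)" if s: "0 < s" "s \<le> 1" for s
  proof -
    have pw: "s powr (\<alpha> + 1/2) \<le> s powr - \<theta>" "s powr (\<alpha> + 5/2) \<le> s powr - \<theta>"
      using s \<alpha> by (intro powr_mono'; simp add: \<theta>)+
    have "\<bar>bessel_osc \<alpha> s - \<rho> * cos (s - c)\<bar> \<le> \<bar>bessel_osc \<alpha> s\<bar> + \<bar>\<rho>\<bar> * \<bar>cos (s - c)\<bar>"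
      by (rule order_trans[OF abs_triangle_ineq4]) (simp add: abs_mult)
    also have "\<dots> \<le> s powr - \<theta> * D1 + \<bar>\<rho>\<bar> * 1"
      unfolding bessel_osc_def abs_mult using s D1 pw by (intro add_mono mult_mono) auto
    also have "\<dots> \<le> s powr - \<theta> * K + K * 1" using K by (intro add_mono mult_left_mono) auto
    finally show "\<bar>bessel_osc \<alpha> s - \<rho> * cos (s - c)\<bar> \<le> K * (1 + s powr - \<theta>)" by (simp add: algebra_simps)
    have "s * s powr (\<alpha> - 1/2) = s powr (1 + (\<alpha> - 1/2))" "s * s powr (\<alpha> + 3/2) = s powr (1 + (\<alpha> + 3/2))"
      using s unfolding powr_add by simp_all
    then have "s * s powr (\<alpha> - 1/2) = s powr (\<alpha> + 1/2)" "s * s powr (\<alpha> + 3/2) = s powr (\<alpha> + 5/2)"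
      by (simp_all add: algebra_simps)
    moreover have "s * bessel_osc_deriv \<alpha> s = (\<alpha> + 1/2) * ((s * s powr (\<alpha> - 1/2)) * bessel_quot \<alpha> s)
        - (s * s powr (\<alpha> + 3/2)) * bessel_quot (\<alpha> + 1) s"
      unfolding bessel_osc_deriv_def by (simp add: algebra_simps)
    ultimately have "s * bessel_osc_deriv \<alpha> s = (\<alpha> + 1/2) * (s powr (\<alpha> + 1/2) * bessel_quot \<alpha> s) - s powr (\<alpha> + 5/2) * bessel_quot (\<alpha> + 1) s"
      by (simp only:)
    then have "\<bar>s * bessel_osc_deriv \<alpha> s\<bar> \<le> \<bar>\<alpha> + 1/2\<bar> * (s powr (\<alpha> + 1/2) * \<bar>bessel_quot \<alpha> s\<bar>) + s powr (\<alpha> + 5/2) * \<bar>bessel_quot (\<alpha> + 1) s\<bar>"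
      by (simp only:) (rule order_trans[OF abs_triangle_ineq4], simp add: abs_mult)
    also have "\<dots> \<le> \<bar>\<alpha> + 1/2\<bar> * (s powr - \<theta> * D1) + s powr - \<theta> * D2"
      using s D1 D2 pw by (intro add_mono mult_left_mono mult_mono) auto
    also have "\<dots> = s powr - \<theta> * (\<bar>\<alpha> + 1/2\<bar> * D1 + D2)" by (simp add: algebra_simps)
    also have "\<dots> \<le> s powr - \<theta> * K" using K by (intro mult_left_mono) auto
    finally have a: "\<bar>s * bessel_osc_deriv \<alpha> s\<bar> \<le> s powr - \<theta> * K" .
    have b: "\<bar>s * (\<rho> * sin (s - c))\<bar> \<le> 1 * (K * 1)"
      unfolding abs_mult using s K by (intro mult_mono) auto
    have "s * \<bar>bessel_osc_deriv \<alpha> s + \<rho> * sin (s - c)\<bar> = \<bar>s * bessel_osc_deriv \<alpha> s + s * (\<rho> * sin (s - c))\<bar>"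
      using s by (simp add: abs_mult flip: distrib_left)
    also have "\<dots> \<le> s powr - \<theta> * K + 1 * (K * 1)"
      by (rule order_trans[OF abs_triangle_ineq add_mono[OF a b]])
    finally show "s * \<bar>bessel_osc_deriv \<alpha> s + \<rho> * sin (s - c)\<bar> \<le> K * (1 + s powr - \<theta>)" by (simp add: algebra_simps)
  qed
  have large: "\<bar>bessel_osc \<alpha> s - \<rho> * cos (s - c)\<bar> \<le> C1 * (1 + s powr - \<theta>)"
    "s * \<bar>bessel_osc_deriv \<alpha> s + \<rho> * sin (s - c)\<bar> \<le> C1 * (1 + s powr - \<theta>)" if s: "1 \<le> s" for s
  proof -
    have ge: "C1 * 1 \<le> C1 * (1 + s powr - \<theta>)" using C1(1) by (intro mult_left_mono) auto
    have "C1 / s \<le> C1 * 1" using mult_left_mono[OF s C1(1)] s by (simp add: divide_le_eq)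
    then show "\<bar>bessel_osc \<alpha> s - \<rho> * cos (s - c)\<bar> \<le> C1 * (1 + s powr - \<theta>)" using C1(2)[OF s] ge by linarith
    have "s * \<bar>bessel_osc_deriv \<alpha> s + \<rho> * sin (s - c)\<bar> \<le> s * (C1 / s)"
      using s by (intro mult_left_mono C1(3)) auto
    also have "\<dots> = C1 * 1" using s by simp
    finally show "s * \<bar>bessel_osc_deriv \<alpha> s + \<rho> * sin (s - c)\<bar> \<le> C1 * (1 + s powr - \<theta>)" using ge by linarith
  qed
  show ?thesis
  proof (intro exI[of _ "K + C1"] conjI allI impI)
    show "0 \<le> K + C1" using K C1 by simp
    fix s :: real
    have mono: "K * u \<le> (K + C1) * u" "C1 * u \<le> (K + C1) * u" if "u \<ge> 0" for u
      using that K(1) C1(1) by (auto intro!: mult_right_mono)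
    show "\<bar>bessel_osc \<alpha> s - \<rho> * cos (s - c)\<bar> \<le> (K + C1) * (1 + s powr - \<theta>)" if "0 < s"
      using small(1)[of s] large(1)[of s] mono[of "1 + s powr - \<theta>"] that by (cases "s \<le> 1") (auto intro: order_trans)
    show "s * \<bar>bessel_osc_deriv \<alpha> s + \<rho> * sin (s - c)\<bar> \<le> (K + C1) * (1 + s powr - \<theta>)" if "0 < s"
      using small(2)[of s] large(2)[of s] mono[of "1 + s powr - \<theta>"] that by (cases "s \<le> 1") (auto intro: order_trans)
    show "\<bar>bessel_osc \<alpha> s - \<rho> * cos (s - c)\<bar> \<le> (K + C1) / s" if "1 \<le> s"
      using C1(2)[OF that] mono(2)[of "1 / s"] that by (auto intro: order_trans)
  qed
qed

lemma cos_times_cos_times_cos: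
  fixes p q r :: real
  shows "cos p * cos q * cos r = (cos (p + q + r) + cos (p + q - r) + cos (p - q + r) + cos (p - q - r)) / 4"
proof -
  have "cos p * cos q * cos r = (cos (p - q) * cos r + cos (p + q) * cos r) / 2"
    by (simp add: cos_times_cos add_divide_distrib distrib_right)
  also have "\<dots> = (cos (p + q + r) + cos (p + q - r) + cos (p - q + r) + cos (p - q - r)) / 4"
    unfolding cos_times_cos by (simp add: field_simps)
  finally show ?thesis .
qed

text \<open>The envelope in z for the contribution of the asymptotic error of the third Bessel
  factor. For \<alpha> > -1 the relevant \<theta> lies in [0, 1/2), so it is square integrable both
  at 0 and at infinity.\<close>

definition decay_bound :: "real \<Rightarrow> real \<Rightarrow> real" where
  "decay_bound \<theta> z = (if z < 1 then z powr - \<theta> else 1 / z)"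

text \<open>
  The two shifted frequencies \<open>x \<plusminus> t\<close> and the four frequencies \<open>z \<plusminus> x \<plusminus> t\<close> are the oscillations of the
  product of the three leading cosines; only the latter can vanish as \<open>z\<close> varies.
\<close>

lemma leading_oscillatory_integral:
  fixes c c' t x :: real
  assumes \<alpha>: "\<alpha> > -1" and \<sigma>: "\<sigma> > 0" and \<delta>: "0 < \<delta>" "\<delta> \<le> 1/2" "\<delta> \<le> \<sigma>"
    and ph: "bessel_phase \<alpha> \<rho> c" and t: "t > 0" and x: "x > 0" and xt: "x \<noteq> t"
    and \<theta>: "\<theta> = max 0 (- \<alpha> - 1/2)"
  defines "J \<equiv> \<lambda>z r. integral {1..r} (\<lambda>y. y powr - \<sigma> * (cos (t * y - c') * cos (x * y - c)) * bessel_osc \<alpha> (z * y))"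
  shows "\<exists>C\<ge>0. \<forall>z>0. z \<noteq> x + t \<and> z \<noteq> x - t \<and> z \<noteq> t - x \<longrightarrow>
    (\<forall>r. \<bar>J z r\<bar> \<le> C * (decay_bound \<theta> z + singular_bound \<delta> (z + x + t) + singular_bound \<delta> (z + x - t)
            + singular_bound \<delta> (z - x + t) + singular_bound \<delta> (z - x - t))) \<and>
    (\<exists>L. (J z \<longlongrightarrow> L) at_top)"
proof -
  \<comment> \<open>E is the error of the cosine asymptotics in the factor depending on z. In the
    part P coming from E the frequencies do not involve z, which enters through the size of E only;
    the cosine itself yields Q.\<close>
  define E where "E s = bessel_osc \<alpha> s - \<rho> * cos (s - c)" for s
  define E' where "E' s = bessel_osc_deriv \<alpha> s + \<rho> * sin (s - c)" for s
  obtain C where C: "C \<ge> 0" "\<And>s. s > 0 \<Longrightarrow> \<bar>E s\<bar> \<le> C * (1 + s powr - \<theta>)"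
      "\<And>s. s > 0 \<Longrightarrow> s * \<bar>E' s\<bar> \<le> C * (1 + s powr - \<theta>)" "\<And>s. s \<ge> 1 \<Longrightarrow> \<bar>E s\<bar> \<le> C / s"
    using bessel_osc_remainder_bound[OF \<alpha> ph \<theta>] unfolding E_def E'_def by blast
  have dE: "(E has_real_derivative E' s) (at s)" if "s > 0" for s
    unfolding E_def[abs_def] E'_def using DERIV_bessel_osc[OF \<alpha> that]
    by (auto intro!: derivative_eq_intros)
  have \<theta>0: "\<theta> \<ge> 0" by (simp add: \<theta>)
  define F where "F z y = y powr - \<sigma> * E (z * y)" for z y
  define F' where "F' z y = - \<sigma> * y powr (- \<sigma> - 1) * E (z * y) + y powr - \<sigma> * (z * E' (z * y))" for z y
  define M where "M z = C * (1 + \<sigma>) * (1 + z powr - \<theta>)" for z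
  have F: "(F z has_real_derivative F' z y) (at y)" "\<bar>F z y\<bar> \<le> M z * y powr - \<sigma>"
      "\<bar>F' z y\<bar> \<le> M z * y powr (- \<sigma> - 1)" if z: "z > 0" and y: "y \<ge> 1" for z y
  proof -
    have zy: "z * y > 0" using z y by simp
    have "((\<lambda>y. E (z * y)) has_real_derivative E' (z * y) * z) (at y)"
      by (rule DERIV_chain2[where f=E and g="\<lambda>y. z * y", OF dE[OF zy]]) (auto intro!: derivative_eq_intros)
    then show "(F z has_real_derivative F' z y) (at y)"
      unfolding F_def[abs_def] F'_def using y by (auto intro!: derivative_eq_intros)
    have "z \<le> z * y" using z y by simp
    then have "(z * y) powr - \<theta> \<le> z powr - \<theta>" using z \<theta>0 by (intro powr_mono2') auto
    then have mono: "C * (1 + (z * y) powr - \<theta>) \<le> C * (1 + z powr - \<theta>)" using C(1) by (intro mult_left_mono) auto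
    define N where "N = C * (1 + z powr - \<theta>)"
    have N: "N \<ge> 0" "M z = N + \<sigma> * N" using C(1) by (auto simp: N_def M_def algebra_simps)
    have e: "\<bar>E (z * y)\<bar> \<le> N" "z * y * \<bar>E' (z * y)\<bar> \<le> N"
      using C(2)[OF zy] C(3)[OF zy] mono by (auto simp: N_def)
    have "\<bar>F z y\<bar> \<le> y powr - \<sigma> * N" unfolding F_def abs_mult using e by (simp add: mult_left_mono)
    also have "\<dots> \<le> y powr - \<sigma> * M z" using N \<sigma> by (intro mult_left_mono) auto
    finally show "\<bar>F z y\<bar> \<le> M z * y powr - \<sigma>" by (simp add: mult.commute)
    \<comment> \<open>One factor y is moved from the power to z, so that the bound on s * E' s at s
      = z * y applies.\<close>
    have "y powr - \<sigma> * (z * E' (z * y)) = y powr (- \<sigma> - 1) * (z * y * E' (z * y))"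
      using y by (simp add: powr_diff)
    then have "\<bar>F' z y\<bar> \<le> \<sigma> * y powr (- \<sigma> - 1) * \<bar>E (z * y)\<bar> + y powr (- \<sigma> - 1) * (z * y * \<bar>E' (z * y)\<bar>)"
      unfolding F'_def using \<sigma> z y by (simp only:) (rule order_trans[OF abs_triangle_ineq], simp add: abs_mult)
    also have "\<dots> \<le> \<sigma> * y powr (- \<sigma> - 1) * N + y powr (- \<sigma> - 1) * N"
      using \<sigma> e by (intro add_mono mult_left_mono) auto
    finally show "\<bar>F' z y\<bar> \<le> M z * y powr (- \<sigma> - 1)" by (simp add: N(2) algebra_simps)
  qed
  define G where "G y = y powr - \<sigma>" for y :: real
  have G: "(G has_real_derivative - \<sigma> * y powr (- \<sigma> - 1)) (at y)" "\<bar>G y\<bar> \<le> (1 + \<sigma>) * y powr - \<sigma>"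
      "\<bar>- \<sigma> * y powr (- \<sigma> - 1)\<bar> \<le> (1 + \<sigma>) * y powr (- \<sigma> - 1)" if y: "y \<ge> 1" for y
    unfolding G_def[abs_def] using y \<sigma> by (auto intro!: derivative_eq_intros simp: abs_mult distrib_right)
  define I where "I H w d r = integral {1..r} (\<lambda>y. H y * cos (w * y + d))" for H :: "real \<Rightarrow> real" and w d r
  define P where "P z r = 1/2 * (I (F z) (x + t) (- (c + c')) r + I (F z) (x - t) (- (c - c')) r)" for z r
  define Q where "Q z r = \<rho>/4 * (I G (z + x + t) (- (c + c + c')) r + I G (z + x - t) (- (c + c - c')) r
      + I G (z - x + t) (- c') r + I G (z - x - t) c' r)" for z r
  have contI: "continuous_on {1..r} H \<Longrightarrow> ((\<lambda>y. H y * cos (w * y + d)) has_integral I H w d r) {1..r}" for H w d r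
    unfolding I_def by (intro integrable_integral integrable_continuous_real continuous_intros)
  have contF: "continuous_on {1..r} (F z)" if "z > 0" for z r
    by (intro continuous_at_imp_continuous_on ballI DERIV_isCont[OF F(1)[OF that]]) auto
  have contG: "continuous_on {1..r} G" for r
    by (intro continuous_at_imp_continuous_on ballI DERIV_isCont[OF G(1)]) auto
  have P: "((\<lambda>y. y powr - \<sigma> * (cos (t * y - c') * cos (x * y - c)) * E (z * y)) has_integral P z r) {1..r}" if z: "z > 0" for z r
  proof -
    have "((\<lambda>y. 1/2 * (F z y * cos ((x + t) * y + - (c + c')) + F z y * cos ((x - t) * y + - (c - c')))) has_integral P z r) {1..r}"
      unfolding P_def by (intro has_integral_mult_right has_integral_add contI contF z)
    moreover have "1/2 * (F z y * cos ((x + t) * y + - (c + c')) + F z y * cos ((x - t) * y + - (c - c')))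
        = y powr - \<sigma> * (cos (t * y - c') * cos (x * y - c)) * E (z * y)" for y
    proof -
      have "cos (x * y - c) * cos (t * y - c') = (cos ((x - t) * y + - (c - c')) + cos ((x + t) * y + - (c + c'))) / 2"
        unfolding cos_times_cos by (simp add: algebra_simps)
      then have *: "cos (t * y - c') * cos (x * y - c) = (cos ((x - t) * y + - (c - c')) + cos ((x + t) * y + - (c + c'))) / 2"
        by (simp only: mult.commute)
      have "1/2 * (g * e * u + g * e * v) = g * ((v + u) / 2) * e" for g e u v :: real
        by (simp add: field_simps)
      then show ?thesis unfolding F_def * .
    qed
    ultimately show ?thesis by simp
  qed
  have Q: "((\<lambda>y. y powr - \<sigma> * (cos (t * y - c') * cos (x * y - c)) * (\<rho> * cos (z * y - c))) has_integral Q z r) {1..r}" for z r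
  proof -
    have "((\<lambda>y. \<rho>/4 * (G y * cos ((z + x + t) * y + - (c + c + c')) + G y * cos ((z + x - t) * y + - (c + c - c'))
        + G y * cos ((z - x + t) * y + - c') + G y * cos ((z - x - t) * y + c'))) has_integral Q z r) {1..r}"
      unfolding Q_def by (intro has_integral_mult_right has_integral_add contI contG)
    moreover have "\<rho>/4 * (G y * cos ((z + x + t) * y + - (c + c + c')) + G y * cos ((z + x - t) * y + - (c + c - c'))
        + G y * cos ((z - x + t) * y + - c') + G y * cos ((z - x - t) * y + c'))
        = y powr - \<sigma> * (cos (t * y - c') * cos (x * y - c)) * (\<rho> * cos (z * y - c))" for y
    proof -
      have 1: "cos (z * y - c) * cos (x * y - c) * cos (t * y - c') =
         (cos ((z + x + t) * y + - (c + c + c')) + cos ((z + x - t) * y + - (c + c - c'))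
        + cos ((z - x + t) * y + - c') + cos ((z - x - t) * y + c')) / 4"
        unfolding cos_times_cos_times_cos by (simp add: algebra_simps)
      have 2: "y powr - \<sigma> * (cos (t * y - c') * cos (x * y - c)) * (\<rho> * cos (z * y - c))
          = y powr - \<sigma> * \<rho> * (cos (z * y - c) * cos (x * y - c) * cos (t * y - c'))" by (simp only: mult_ac)
      have "\<rho>/4 * (g * k + g * l + g * m + g * n) = g * \<rho> * ((k + l + m + n) / 4)" for g k l m n :: real
        by (simp add: field_simps)
      then show ?thesis unfolding G_def 2 1 .
    qed
    ultimately show ?thesis by (simp only:)
  qed
  have JPQ: "J z r = P z r + Q z r" if z: "z > 0" for z r
  proof -
    have "((\<lambda>y. y powr - \<sigma> * (cos (t * y - c') * cos (x * y - c)) * bessel_osc \<alpha> (z * y)) has_integral P z r + Q z r) {1..r}"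
      using has_integral_add[OF P[OF z, of r] Q[of z r]] by (simp add: E_def flip: distrib_left)
    then show ?thesis unfolding J_def by (rule integral_unique)
  qed
  obtain CG where CG: "CG \<ge> 0" "\<And>w d r. w \<noteq> 0 \<Longrightarrow> \<bar>I G w d r\<bar> \<le> CG * singular_bound \<delta> w"
    using cos_powr_integral_bound[OF \<sigma> \<delta>] unfolding I_def G_def by blast
  define S where "S z = singular_bound \<delta> (z + x + t) + singular_bound \<delta> (z + x - t)
            + singular_bound \<delta> (z - x + t) + singular_bound \<delta> (z - x - t)" for z
  have Qbound: "\<bar>Q z r\<bar> \<le> \<bar>\<rho>\<bar> * CG * S z" if "z > 0" "z \<noteq> x + t" "z \<noteq> x - t" "z \<noteq> t - x" for z r
  proof -
    have "\<bar>I G (z + x + t) (- (c + c + c')) r + I G (z + x - t) (- (c + c - c')) r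
      + I G (z - x + t) (- c') r + I G (z - x - t) c' r\<bar>
      \<le> \<bar>I G (z + x + t) (- (c + c + c')) r\<bar> + \<bar>I G (z + x - t) (- (c + c - c')) r\<bar>
      + \<bar>I G (z - x + t) (- c') r\<bar> + \<bar>I G (z - x - t) c' r\<bar>" by linarith
    also have "\<dots> \<le> CG * S z"
      unfolding S_def distrib_left using that x t by (intro add_mono CG) auto
    finally have "\<bar>\<rho>\<bar> / 4 * \<bar>I G (z + x + t) (- (c + c + c')) r + I G (z + x - t) (- (c + c - c')) r
      + I G (z - x + t) (- c') r + I G (z - x - t) c' r\<bar> \<le> \<bar>\<rho>\<bar> / 4 * (CG * S z)" by (intro mult_left_mono) auto
    also have "\<dots> \<le> \<bar>\<rho>\<bar> * (CG * S z)" using CG(1) by (intro mult_right_mono mult_nonneg_nonneg) (auto simp: S_def)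
    finally show ?thesis by (simp add: Q_def abs_mult)
  qed
  \<comment> \<open>The assumption x \<noteq> t enters here: x - t is a frequency of P and would
    otherwise give no oscillation.\<close>
  define W where "W = 1 / \<bar>x + t\<bar> + 1 / \<bar>x - t\<bar>"
  define K where "K = (2 + 1 / \<sigma>) * (C * (1 + \<sigma>) * 2) * W + C / \<sigma>"
  have W: "W \<ge> 0" by (simp add: W_def)
  have K1: "0 \<le> (2 + 1 / \<sigma>) * (C * (1 + \<sigma>) * 2) * W" "0 \<le> C / \<sigma>" using W C(1) \<sigma> by auto
  \<comment> \<open>For z < 1 integration by parts is used, and
    \<open>1 \<le> z powr - \<theta>\<close> absorbs the constant term of M z, whence the factor 2
    in K. For z \<ge> 1 the estimate \<open>C / s\<close> of E makes the integrand absolutely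
    integrable and supplies the decay \<open>1 / z\<close>; it contributes
    \<open>C / \<sigma>\<close> to K.\<close>
  have Pbound: "\<bar>P z r\<bar> \<le> K * decay_bound \<theta> z" if z: "z > 0" for z r
  proof (cases "1 \<le> r")
    case False
    then have "P z r = 0" by (simp add: P_def I_def)
    then show ?thesis using K1 z by (simp add: K_def decay_bound_def)
  next
    case r: True
    show ?thesis
    proof (cases "z < 1")
      case True
      have IF: "\<bar>I (F z) w d r\<bar> \<le> (2 + 1 / \<sigma>) * M z * (1 / \<bar>w\<bar>)" if "w \<noteq> 0" for w d
        using oscillatory_integral_bound[where A=1 and s=1 and F="F z" and F'="F' z", OF F(1)[OF z] F(2)[OF z] F(3)[OF z] \<sigma> that _ _ r]
        by (simp add: I_def)
      have "\<bar>P z r\<bar> \<le> \<bar>I (F z) (x + t) (- (c + c')) r\<bar> + \<bar>I (F z) (x - t) (- (c - c')) r\<bar>"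
      proof -
        have "\<bar>1/2 * (a + b)\<bar> \<le> \<bar>a\<bar> + \<bar>b\<bar>" for a b :: real by argo
        then show ?thesis unfolding P_def .
      qed
      also have "\<dots> \<le> (2 + 1 / \<sigma>) * M z * (1 / \<bar>x + t\<bar>) + (2 + 1 / \<sigma>) * M z * (1 / \<bar>x - t\<bar>)"
        using x t xt by (intro add_mono IF) auto
      also have "\<dots> = (2 + 1 / \<sigma>) * M z * W" by (simp only: W_def distrib_left)
      also have "\<dots> \<le> (2 + 1 / \<sigma>) * (C * (1 + \<sigma>) * (2 * z powr - \<theta>)) * W"
      proof -
        have "1 \<le> z powr - \<theta>" using z True \<theta>0 by (simp add: powr_minus one_le_inverse_iff powr_le1)
        then show ?thesis unfolding M_def using W C(1) \<sigma>
          by (intro mult_right_mono mult_left_mono) auto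
      qed
      also have "\<dots> = (2 + 1 / \<sigma>) * (C * (1 + \<sigma>) * 2) * W * z powr - \<theta>" by (simp only: mult_ac)
      also have "\<dots> \<le> K * z powr - \<theta>" using K1(2) by (intro mult_right_mono) (simp_all add: K_def)
      finally show ?thesis using True by (simp add: decay_bound_def)
    next
      case False
      have pw: "((\<lambda>y. (C / z) * y powr (- \<sigma> - 1)) has_integral (C / z) * ((1 powr - \<sigma> - r powr - \<sigma>) / \<sigma>)) {1..r}"
        by (intro has_integral_mult_right has_integral_powr_interval) (use \<sigma> r in auto)
      have "norm (integral {1..r} (\<lambda>y. y powr - \<sigma> * (cos (t * y - c') * cos (x * y - c)) * E (z * y)))
          \<le> integral {1..r} (\<lambda>y. (C / z) * y powr (- \<sigma> - 1))"
      proof (rule Henstock_Kurzweil_Integration.integral_norm_bound_integral)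
        fix y assume y: "y \<in> {1..r}"
        have zy: "z * y \<ge> 1" using False y mult_mono[of 1 z 1 y] by simp
        have "\<bar>cos (t * y - c') * cos (x * y - c)\<bar> \<le> 1 * 1"
          unfolding abs_mult by (intro mult_mono) auto
        then have "y powr - \<sigma> * \<bar>cos (t * y - c') * cos (x * y - c)\<bar> * \<bar>E (z * y)\<bar> \<le> y powr - \<sigma> * 1 * (C / (z * y))"
          using C(4)[OF zy] by (intro mult_mono) auto
        also have "\<dots> = (C / z) * y powr (- \<sigma> - 1)" using y by (simp add: powr_diff)
        finally show "norm (y powr - \<sigma> * (cos (t * y - c') * cos (x * y - c)) * E (z * y)) \<le> (C / z) * y powr (- \<sigma> - 1)"
          by (simp add: abs_mult)
      qed (use P[OF z, of r] pw in \<open>auto simp: has_integral_integrable_integral\<close>)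
      then have "\<bar>P z r\<bar> \<le> (C / z) * ((1 - r powr - \<sigma>) / \<sigma>)"
        using integral_unique[OF P[OF z, of r]] integral_unique[OF pw] by simp
      also have "\<dots> \<le> (C / z) * (1 / \<sigma>)" using C(1) \<sigma> z by (intro mult_left_mono divide_right_mono) auto
      also have "\<dots> = (C / \<sigma>) * (1 / z)" by simp
      also have "\<dots> \<le> K * (1 / z)" using K1(1) z by (intro mult_right_mono) (simp_all add: K_def)
      finally show ?thesis using False by (simp add: decay_bound_def)
    qed
  qed
  have conv: "\<exists>L. (J z \<longlongrightarrow> L) at_top" if z: "z > 0" "z \<noteq> x + t" "z \<noteq> x - t" "z \<noteq> t - x" for z
  proof -
    have cF: "\<exists>L. (I (F z) w d \<longlongrightarrow> L) at_top" if "w \<noteq> 0" for w d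
      unfolding I_def
      by (rule oscillatory_integral_convergent[where F="F z" and F'="F' z", OF F(1)[OF z(1)] F(2)[OF z(1)] F(3)[OF z(1)] \<sigma> that])
    have cG: "\<exists>L. (I G w d \<longlongrightarrow> L) at_top" if "w \<noteq> 0" for w d
      unfolding I_def by (rule oscillatory_integral_convergent[where F=G, OF G \<sigma> that])
    have "x + t \<noteq> 0" "x - t \<noteq> 0" "z + x + t \<noteq> 0" "z + x - t \<noteq> 0" "z - x + t \<noteq> 0" "z - x - t \<noteq> 0"
      using z x t xt by auto
    then obtain L1 L2 L3 L4 L5 L6 where
      "(I (F z) (x + t) (- (c + c')) \<longlongrightarrow> L1) at_top" "(I (F z) (x - t) (- (c - c')) \<longlongrightarrow> L2) at_top"
      "(I G (z + x + t) (- (c + c + c')) \<longlongrightarrow> L3) at_top" "(I G (z + x - t) (- (c + c - c')) \<longlongrightarrow> L4) at_top"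
      "(I G (z - x + t) (- c') \<longlongrightarrow> L5) at_top" "(I G (z - x - t) c' \<longlongrightarrow> L6) at_top"
      using cF cG by meson
    then have "((\<lambda>r. P z r + Q z r) \<longlongrightarrow> 1/2 * (L1 + L2) + \<rho>/4 * (L3 + L4 + L5 + L6)) at_top"
      unfolding P_def Q_def by (intro tendsto_intros)
    moreover have "J z = (\<lambda>r. P z r + Q z r)" using JPQ[OF z(1)] by (intro ext)
    ultimately have "(J z \<longlongrightarrow> 1/2 * (L1 + L2) + \<rho>/4 * (L3 + L4 + L5 + L6)) at_top" by (simp only:)
    then show ?thesis by (rule exI)
  qed
  show ?thesis
  proof (rule exI[of _ "K + \<bar>\<rho>\<bar> * CG"], intro conjI allI impI)
    show "0 \<le> K + \<bar>\<rho>\<bar> * CG" using K1 CG(1) by (simp add: K_def)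
    fix z :: real assume z: "0 < z" and ne: "z \<noteq> x + t \<and> z \<noteq> x - t \<and> z \<noteq> t - x"
    show "\<exists>L. (J z \<longlongrightarrow> L) at_top" using conv[OF z] ne by blast
    fix r
    have d0: "0 \<le> decay_bound \<theta> z" using z by (simp add: decay_bound_def)
    have S0: "0 \<le> S z" by (simp add: S_def)
    have "\<bar>J z r\<bar> \<le> \<bar>P z r\<bar> + \<bar>Q z r\<bar>" unfolding JPQ[OF z] by (rule abs_triangle_ineq)
    also have "\<dots> \<le> K * decay_bound \<theta> z + \<bar>\<rho>\<bar> * CG * S z"
      using Pbound[OF z] Qbound[of z] z ne by (intro add_mono) auto
    also have "\<dots> \<le> (K + \<bar>\<rho>\<bar> * CG) * decay_bound \<theta> z + (K + \<bar>\<rho>\<bar> * CG) * S z"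
      using K1 CG(1) d0 S0 by (intro add_mono mult_right_mono) (auto simp: K_def)
    also have "\<dots> = (K + \<bar>\<rho>\<bar> * CG) * (decay_bound \<theta> z + singular_bound \<delta> (z + x + t) + singular_bound \<delta> (z + x - t)
            + singular_bound \<delta> (z - x + t) + singular_bound \<delta> (z - x - t))"
      by (simp add: S_def algebra_simps)
    finally show "\<bar>J z r\<bar> \<le> (K + \<bar>\<rho>\<bar> * CG) * (decay_bound \<theta> z + singular_bound \<delta> (z + x + t) + singular_bound \<delta> (z + x - t)
            + singular_bound \<delta> (z - x + t) + singular_bound \<delta> (z - x - t))" .
  qed
qed

text \<open>The density, the leading power and the factor split off from
  \<open>bessel_quot \<alpha> (z * y)\<close> combine to \<open>y powr - \<sigma>\<close>, because 2
  * \<alpha> + 1 + p - \<alpha> - 1/2 = -\<sigma>. The result is a gauge integral over a compact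
  interval, the form in which integration by parts was done.\<close>

lemma leading_term_integral:
  assumes \<alpha>: "\<alpha> > -1" and p: "p = - \<sigma> - \<alpha> - 1/2" and z: "z > 0"
  shows "(LINT y:{0<..<r}|\<mu> \<alpha>. leading_term p t c' x c \<kappa> y * bessel_quot \<alpha> (z * y))
    = \<kappa> * z powr (- \<alpha> - 1/2) *
      integral {1..r} (\<lambda>y. y powr - \<sigma> * (cos (t * y - c') * cos (x * y - c)) * bessel_osc \<alpha> (z * y))"
proof -
  define G where "G y = \<kappa> * z powr (- \<alpha> - 1/2) * (y powr - \<sigma> * (cos (t * y - c') * cos (x * y - c)) * bessel_osc \<alpha> (z * y))" for y
  have m: "(\<lambda>y. indicator {0<..<r} y *\<^sub>R (leading_term p t c' x c \<kappa> y * bessel_quot \<alpha> (z * y))) \<in> borel_measurable (\<mu> \<alpha>)"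
    by (rule borel_measurable_mu) measurable
  have "continuous_on {1..r} (bessel_osc \<alpha> \<circ> (*) z)"
  proof (rule continuous_on_compose)
    show "continuous_on {1..r} ((*) z)" by (intro continuous_intros)
    show "continuous_on ((*) z ` {1..r}) (bessel_osc \<alpha>)"
      by (intro continuous_at_imp_continuous_on ballI DERIV_isCont[OF DERIV_bessel_osc[OF \<alpha>]]) (use z in auto)
  qed
  then have cont: "continuous_on {1..r} G"
    unfolding G_def o_def by (intro continuous_intros) auto
  have "(LINT y:{0<..<r}|\<mu> \<alpha>. leading_term p t c' x c \<kappa> y * bessel_quot \<alpha> (z * y))
      = (LINT y|lborel. indicator {0<..} y *\<^sub>R (y powr (2 * \<alpha> + 1) *\<^sub>R (indicator {0<..<r} y *\<^sub>R (leading_term p t c' x c \<kappa> y * bessel_quot \<alpha> (z * y)))))"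
    unfolding set_lebesgue_integral_def by (rule integral_mu[OF m])
  also have "\<dots> = (LINT y|lborel. indicator {1..r} y *\<^sub>R G y)"
  proof (rule integral_cong_AE)
    show "AE y in lborel. indicator {0<..} y *\<^sub>R (y powr (2 * \<alpha> + 1) *\<^sub>R (indicator {0<..<r} y *\<^sub>R (leading_term p t c' x c \<kappa> y * bessel_quot \<alpha> (z * y))))
        = indicator {1..r} y *\<^sub>R G y"
      using AE_lborel_singleton[of r]
    proof eventually_elim
      case (elim y)
      show ?case
      proof (cases "1 \<le> y \<and> y < r")
        case True
        have "y powr (2 * \<alpha> + 1) * (y powr p * y powr (- \<alpha> - 1/2)) = y powr - \<sigma>"
          by (simp add: p flip: powr_add)
        moreover have "bessel_quot \<alpha> (z * y) = z powr (- \<alpha> - 1/2) * y powr (- \<alpha> - 1/2) * bessel_osc \<alpha> (z * y)"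
          using True z bessel_quot_eq_osc[of "z * y" \<alpha>] by (simp add: powr_mult)
        ultimately have "y powr (2 * \<alpha> + 1) * (\<kappa> * y powr p * (cos (t * y - c') * cos (x * y - c)) * bessel_quot \<alpha> (z * y)) = G y"
          unfolding G_def by (simp add: mult_ac flip: \<open>_ = y powr - \<sigma>\<close>)
        then show ?thesis using True by (simp add: leading_term_def)
      next
        case False
        then show ?thesis using elim by (auto simp: leading_term_def indicator_def)
      qed
    qed
    show "(\<lambda>y. indicator {1..r} y *\<^sub>R G y) \<in> borel_measurable lborel"
      unfolding G_def bessel_osc_def by measurable
  qed measurable
  also have "\<dots> = integral {1..r} G"
    using set_borel_integral_eq_integral(2)[OF borel_integrable_atLeastAtMost'[OF cont]]
    by (simp add: set_lebesgue_integral_def)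
  also have "\<dots> = \<kappa> * z powr (- \<alpha> - 1/2) *
      integral {1..r} (\<lambda>y. y powr - \<sigma> * (cos (t * y - c') * cos (x * y - c)) * bessel_osc \<alpha> (z * y))"
    unfolding G_def by simp
  finally show ?thesis .
qed

lemma decay_bound_sq_integrable:
  assumes \<alpha>: "\<alpha> > -1" and \<theta>: "\<theta> = max 0 (- \<alpha> - 1/2)"
  shows "(\<lambda>z. complex_of_real (z powr (- \<alpha> - 1/2) * decay_bound \<theta> z)) \<in> sq_integrable (\<mu> \<alpha>)"
proof (rule sq_integrable_powr_times)
  show m: "decay_bound \<theta> \<in> borel_measurable borel" unfolding decay_bound_def[abs_def] by measurable
  have i1: "integrable lborel (\<lambda>z::real. indicator {0<..1} z * z powr (- 2 * \<theta>))"
  proof (rule integrable_powr_near_0)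
    have "\<theta> < 1/2" using \<alpha> by (simp add: \<theta> max_def)
    then show "- 1 < - 2 * \<theta>" by simp
  qed simp
  have i2: "integrable lborel (\<lambda>z::real. indicator {1..} z * z powr (- 2))"
    by (rule integrable_powr_at_top) auto
  show "integrable lborel (\<lambda>z. indicator {0<..} z * (decay_bound \<theta> z)\<^sup>2)"
  proof (rule Bochner_Integration.integrable_bound[OF Bochner_Integration.integrable_add[OF i1 i2]])
    show "(\<lambda>z. indicator {0<..} z * (decay_bound \<theta> z)\<^sup>2) \<in> borel_measurable lborel"
      using m by measurable
    have "indicator {0<..} z * (decay_bound \<theta> z)\<^sup>2 \<le> indicator {0<..1} z * z powr (- 2 * \<theta>) + indicator {1..} z * z powr (- 2)" for z
    proof (cases "0 < z \<and> z < 1")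
      case True
      have "(z powr - \<theta>)\<^sup>2 = z powr (- 2 * \<theta>)" by (simp add: power2_eq_square flip: powr_add)
      then show ?thesis using True by (simp add: decay_bound_def)
    next
      case False
      then show ?thesis
        by (auto simp: decay_bound_def indicator_def powr_minus power_divide inverse_eq_divide)
    qed
    then show "AE z in lborel. norm (indicator {0<..} z * (decay_bound \<theta> z)\<^sup>2)
        \<le> norm (indicator {0<..1} z * z powr (- 2 * \<theta>) + indicator {1..} z * z powr (- 2))"
      by (intro AE_I2) (simp add: abs_mult)
  qed
qed

section \<open>The kernel operator\<close>

lemma truncate_sq_integrable:
  assumes "g \<in> sq_integrable (\<mu> \<alpha>)"
  shows "(\<lambda>y. indicator {0<..<r} y * g y) \<in> sq_integrable (\<mu> \<alpha>)"
  by (rule sq_integrable_mult_bounded[OF assms, where B=1])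
     (auto simp: indicator_def intro!: borel_measurable_mu)

lemma truncate_tendsto:
  fixes a :: "'a::real_normed_algebra_1" and y :: real
  assumes "y > 0"
  shows "((\<lambda>r. indicator {0<..<r} y * a) \<longlongrightarrow> a) at_top"
proof (rule tendsto_eventually)
  show "\<forall>\<^sub>F r in at_top. indicator {0<..<r} y * a = a"
    using eventually_gt_at_top[of y] by eventually_elim (use assms in simp)
qed

lemma truncate_sq_norm_tendsto:
  assumes g: "g \<in> sq_integrable (\<mu> \<alpha>)"
  shows "(\<lambda>n. sq_norm (\<mu> \<alpha>) (\<lambda>y. indicator {0<..<real n} y * g y - g y)) \<longlonglongrightarrow> 0"
proof (rule sq_norm_dominated_convergence[OF _ _ sq_integrableD[OF g]])
  show "AE y in \<mu> \<alpha>. (cmod (indicator {0<..<real n} y * g y - g y))\<^sup>2 \<le> (cmod (g y))\<^sup>2" for n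
    by (rule AE_I2) (auto simp: indicator_def)
  show "AE y in \<mu> \<alpha>. (\<lambda>n. indicator {0<..<real n} y * g y) \<longlonglongrightarrow> g y"
    by (rule AE_I2) (use filterlim_compose[OF truncate_tendsto filterlim_real_sequentially] in auto)
qed (intro sq_integrable_measurable truncate_sq_integrable g)+

text \<open>Wherever the integral converges it may replace \<open>hankel\<close>, which is
  determined only up to null sets, and it inherits its norm properties.\<close>

lemma hankel_integral_sq_integrable:
  assumes \<alpha>: "\<alpha> > -1" and g: "g \<in> sq_integrable (\<mu> \<alpha>)"
    and int: "\<forall>z>0. integrable (\<mu> \<alpha>) (hankel_integrand \<alpha> g z)"
  shows "AE z in \<mu> \<alpha>. hankel \<alpha> g z = hankel_integral \<alpha> g z" "hankel_integral \<alpha> g \<in> sq_integrable (\<mu> \<alpha>)"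
proof -
  show ae: "AE z in \<mu> \<alpha>. hankel \<alpha> g z = hankel_integral \<alpha> g z"
    by (rule hankel_eq_hankel_integral[OF \<alpha> g]) (rule AE_I2, use int in simp)
  show "hankel_integral \<alpha> g \<in> sq_integrable (\<mu> \<alpha>)"
  proof (rule sq_integrable_bound[OF _ sq_integrableD[OF hankel_sq_integrable[OF \<alpha> g]]])
    show "hankel_integral \<alpha> g \<in> borel_measurable (\<mu> \<alpha>)"
      by (rule hankel_integral_measurable[OF sq_integrable_measurable[OF g]])
    show "AE z in \<mu> \<alpha>. (cmod (hankel_integral \<alpha> g z))\<^sup>2 \<le> (cmod (hankel \<alpha> g z))\<^sup>2"
      using ae by eventually_elim simp
  qed
qed

lemma sq_norm_hankel_integral_diff:
  assumes \<alpha>: "\<alpha> > -1" and g: "g \<in> sq_integrable (\<mu> \<alpha>)" "h \<in> sq_integrable (\<mu> \<alpha>)"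
    and int: "\<forall>z>0. integrable (\<mu> \<alpha>) (hankel_integrand \<alpha> g z)"
      "\<forall>z>0. integrable (\<mu> \<alpha>) (hankel_integrand \<alpha> h z)"
  shows "sq_norm (\<mu> \<alpha>) (\<lambda>z. hankel_integral \<alpha> g z - hankel_integral \<alpha> h z) = sq_norm (\<mu> \<alpha>) (\<lambda>y. g y - h y)"
proof -
  note G = hankel_integral_sq_integrable[OF \<alpha> g(1) int(1)] and K = hankel_integral_sq_integrable[OF \<alpha> g(2) int(2)]
  have "sq_norm (\<mu> \<alpha>) (\<lambda>z. hankel_integral \<alpha> g z - hankel_integral \<alpha> h z) = sq_norm (\<mu> \<alpha>) (\<lambda>z. hankel \<alpha> g z - hankel \<alpha> h z)"
  proof (rule sq_norm_cong_AE)
    show "AE z in \<mu> \<alpha>. hankel_integral \<alpha> g z - hankel_integral \<alpha> h z = hankel \<alpha> g z - hankel \<alpha> h z"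
      using G(1) K(1) by eventually_elim simp
  qed (intro sq_integrable_measurable sq_integrable_diff G K hankel_sq_integrable \<alpha> g)+
  also have "\<dots> = sq_norm (\<mu> \<alpha>) (\<lambda>y. g y - h y)" by (rule hankel_isometry[OF \<alpha> g])
  finally show ?thesis .
qed

section \<open>Symmetry of the transform\<close>

text \<open>The kernel depends on the product y * z only, so the claim is Fubini's theorem. Bounded
  supports make it applicable: f and g become integrable, as (0, N] has finite measure for \<alpha>
  > -1, and the kernel is bounded on the arguments up to the product of the two supports'
  endpoints.\<close>

lemma hankel_integral_symmetric_bounded_support:
  assumes \<alpha>: "\<alpha> > -1" and f: "f \<in> sq_integrable (\<mu> \<alpha>)" "\<And>y. y > N \<Longrightarrow> f y = 0"
    and g: "g \<in> sq_integrable (\<mu> \<alpha>)" "\<And>y. y > N' \<Longrightarrow> g y = 0"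
  shows "(LINT z|\<mu> \<alpha>. hankel_integral \<alpha> g z * f z) = (LINT y|\<mu> \<alpha>. g y * hankel_integral \<alpha> f y)"
proof -
  interpret M: sigma_finite_measure "\<mu> \<alpha>" by (rule sigma_finite_mu)
  interpret P: pair_sigma_finite "\<mu> \<alpha>" "\<mu> \<alpha>" by unfold_locales
  obtain C where C: "C \<ge> 0" "\<And>s. 0 < s \<and> s \<le> \<bar>N\<bar> * \<bar>N'\<bar> \<Longrightarrow> \<bar>bessel_quot \<alpha> s\<bar> \<le> C"
    using bessel_quot_bound_near_0[OF \<alpha>] by blast
  have L1: "integrable (\<mu> \<alpha>) h" if h: "h \<in> sq_integrable (\<mu> \<alpha>)" and supp: "\<And>y. y > K \<Longrightarrow> h y = 0" for h :: "real \<Rightarrow> complex" and K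
  proof -
    have "(\<lambda>y. complex_of_real (indicator {0<..K} y)) \<in> sq_integrable (\<mu> \<alpha>)"
      by (rule sq_integrable_bounded_support[OF \<alpha>, where K=1 and N=K])
         (auto simp: indicator_def intro!: borel_measurable_mu)
    from sq_integrable_mult_integrable[OF h this] show ?thesis
    proof (rule Bochner_Integration.integrable_cong[OF refl, THEN iffD1, rotated])
      fix y assume "y \<in> space (\<mu> \<alpha>)"
      then show "h y * complex_of_real (indicator {0<..K} y) = h y" using supp[of y] by (cases "y \<le> K") auto
    qed
  qed
  have fi: "integrable (\<mu> \<alpha>) f" and gi: "integrable (\<mu> \<alpha>) g"
    using L1 f g by blast+
  define k where "k y z = g y * f z * complex_of_real (bessel_quot \<alpha> (y * z))" for y z
  have km: "(\<lambda>(y, z). k y z) \<in> borel_measurable (\<mu> \<alpha> \<Otimes>\<^sub>M \<mu> \<alpha>)"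
  proof -
    have gm: "(\<lambda>q. g (fst q)) \<in> borel_measurable (\<mu> \<alpha> \<Otimes>\<^sub>M \<mu> \<alpha>)"
      by (rule measurable_compose[OF measurable_fst sq_integrable_measurable[OF g(1)]])
    have fm: "(\<lambda>q. f (snd q)) \<in> borel_measurable (\<mu> \<alpha> \<Otimes>\<^sub>M \<mu> \<alpha>)"
      by (rule measurable_compose[OF measurable_snd sq_integrable_measurable[OF f(1)]])
    have "(\<lambda>q. fst q * snd q) \<in> borel_measurable (\<mu> \<alpha> \<Otimes>\<^sub>M \<mu> \<alpha>)"
      by (rule borel_measurable_times[OF measurable_compose[OF measurable_fst measurable_ident_mu]
            measurable_compose[OF measurable_snd measurable_ident_mu]])
    from measurable_compose[OF this borel_measurable_bessel_quot]
    have bm: "(\<lambda>q. complex_of_real (bessel_quot \<alpha> (fst q * snd q))) \<in> borel_measurable (\<mu> \<alpha> \<Otimes>\<^sub>M \<mu> \<alpha>)"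
      by (rule measurable_compose) simp
    show ?thesis unfolding k_def case_prod_beta by (intro borel_measurable_times gm fm bm)
  qed
  have kb: "cmod (k y z) \<le> C * (cmod (g y) * cmod (f z))" if "y > 0" "z > 0" for y z
  proof (cases "y \<le> N' \<and> z \<le> N")
    case True
    then have "y * z \<le> \<bar>N'\<bar> * \<bar>N\<bar>" using that by (intro mult_mono) auto
    then have "\<bar>bessel_quot \<alpha> (y * z)\<bar> \<le> C" using that by (intro C) (simp add: mult.commute)
    then have "cmod (g y) * cmod (f z) * \<bar>bessel_quot \<alpha> (y * z)\<bar> \<le> cmod (g y) * cmod (f z) * C"
      by (intro mult_left_mono) auto
    then show ?thesis by (simp add: k_def norm_mult mult.commute)
  next
    case False
    then show ?thesis using f(2)[of z] g(2)[of y] C(1) by (auto simp: k_def not_le)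
  qed
  have ki: "integrable (\<mu> \<alpha>) (k y)" if y: "y > 0" for y
  proof (rule Bochner_Integration.integrable_bound)
    show "integrable (\<mu> \<alpha>) (\<lambda>z. C * (cmod (g y) * cmod (f z)))"
      by (intro integrable_mult_right integrable_norm fi)
    have "(\<lambda>z. complex_of_real (bessel_quot \<alpha> (y * z))) \<in> borel_measurable (\<mu> \<alpha>)"
      by (rule borel_measurable_mu) measurable
    then show "k y \<in> borel_measurable (\<mu> \<alpha>)"
      unfolding k_def[abs_def]
      by (rule borel_measurable_times[OF borel_measurable_times[OF borel_measurable_const sq_integrable_measurable[OF f(1)]]])
    show "AE z in \<mu> \<alpha>. norm (k y z) \<le> norm (C * (cmod (g y) * cmod (f z)))"
      by (rule AE_I2) (use kb[OF y] C(1) in \<open>simp add: abs_mult\<close>)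
  qed
  have prod: "integrable (\<mu> \<alpha> \<Otimes>\<^sub>M \<mu> \<alpha>) (\<lambda>(y, z). k y z)"
  proof (rule P.Fubini_integrable[OF km])
    show "AE y in \<mu> \<alpha>. integrable (\<mu> \<alpha>) (\<lambda>z. case (y, z) of (y, z) \<Rightarrow> k y z)"
      by (rule AE_I2) (use ki in simp)
    show "integrable (\<mu> \<alpha>) (\<lambda>y. LINT z|\<mu> \<alpha>. norm (case (y, z) of (y, z) \<Rightarrow> k y z))"
    proof (rule Bochner_Integration.integrable_bound)
      define F where "F = (LINT z|\<mu> \<alpha>. cmod (f z))"
      show "integrable (\<mu> \<alpha>) (\<lambda>y. C * F * cmod (g y))"
        by (intro integrable_mult_right integrable_norm gi)
      have "(\<lambda>y. LINT z|\<mu> \<alpha>. cmod (k y z)) \<in> borel_measurable (\<mu> \<alpha>)"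
      proof (rule M.borel_measurable_lebesgue_integral)
        show "(\<lambda>(y, z). cmod (k y z)) \<in> borel_measurable (\<mu> \<alpha> \<Otimes>\<^sub>M \<mu> \<alpha>)"
          using measurable_compose[OF km borel_measurable_norm] by (simp add: case_prod_beta)
      qed
      then show "(\<lambda>y. LINT z|\<mu> \<alpha>. norm (case (y, z) of (y, z) \<Rightarrow> k y z)) \<in> borel_measurable (\<mu> \<alpha>)" by simp
      show "AE y in \<mu> \<alpha>. norm (LINT z|\<mu> \<alpha>. norm (case (y, z) of (y, z) \<Rightarrow> k y z)) \<le> norm (C * F * cmod (g y))"
      proof (rule AE_I2)
        fix y assume "y \<in> space (\<mu> \<alpha>)"
        then have y: "y > 0" by simp
        have "(LINT z|\<mu> \<alpha>. cmod (k y z)) \<le> (LINT z|\<mu> \<alpha>. C * (cmod (g y) * cmod (f z)))"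
          by (rule integral_mono[OF integrable_norm[OF ki[OF y]]])
             (use kb[OF y] in \<open>auto intro!: integrable_mult_right integrable_norm fi\<close>)
        also have "\<dots> = C * F * cmod (g y)" by (simp add: F_def)
        finally have le: "(LINT z|\<mu> \<alpha>. cmod (k y z)) \<le> C * F * cmod (g y)" .
        have "0 \<le> (LINT z|\<mu> \<alpha>. cmod (k y z))" by (rule integral_nonneg_AE) simp
        with le show "norm (LINT z|\<mu> \<alpha>. norm (case (y, z) of (y, z) \<Rightarrow> k y z)) \<le> norm (C * F * cmod (g y))"
          by simp
      qed
    qed
  qed
  have "(LINT z|\<mu> \<alpha>. hankel_integral \<alpha> g z * f z) = (LINT z|\<mu> \<alpha>. (LINT y|\<mu> \<alpha>. k y z))"
  proof (rule Bochner_Integration.integral_cong[OF refl])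
    fix z
    have "(LINT y|\<mu> \<alpha>. k y z) = (LINT y|\<mu> \<alpha>. hankel_integrand \<alpha> g z y * f z)"
      by (simp add: k_def hankel_integrand_def mult_ac)
    then show "hankel_integral \<alpha> g z * f z = (LINT y|\<mu> \<alpha>. k y z)" by (simp add: hankel_integral_def)
  qed
  also have "\<dots> = (LINT y|\<mu> \<alpha>. (LINT z|\<mu> \<alpha>. k y z))" by (rule P.Fubini_integral[OF prod])
  also have "\<dots> = (LINT y|\<mu> \<alpha>. g y * hankel_integral \<alpha> f y)"
    by (simp add: k_def hankel_integral_def hankel_integrand_def mult.assoc)
  finally show ?thesis .
qed

text \<open>Truncations of f exhaust it in mean square, and both sides are continuous in f: the left
  one as a pairing, the right one by the isometry. g keeps its bounded support, so that its
  transform stays an explicit integral.\<close>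

lemma hankel_symmetric:
  assumes \<alpha>: "\<alpha> > -1" and f: "f \<in> sq_integrable (\<mu> \<alpha>)"
    and g: "g \<in> sq_integrable (\<mu> \<alpha>)" "\<And>y. y > N \<Longrightarrow> g y = 0"
  shows "(LINT z|\<mu> \<alpha>. hankel_integral \<alpha> g z * f z) = (LINT y|\<mu> \<alpha>. g y * hankel \<alpha> f y)"
proof (rule LIMSEQ_unique)
  define F where "F n y = indicator {0<..<real n} y * f y" for n y
  have FL: "F n \<in> sq_integrable (\<mu> \<alpha>)" for n unfolding F_def by (rule truncate_sq_integrable[OF f])
  have Fsupp: "F n y = 0" if "y > real n" for n y using that by (simp add: F_def)
  have Flim: "(\<lambda>n. sq_norm (\<mu> \<alpha>) (\<lambda>y. F n y - f y)) \<longlonglongrightarrow> 0" unfolding F_def by (rule truncate_sq_norm_tendsto[OF f])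
  have gi: "\<forall>z>0. integrable (\<mu> \<alpha>) (hankel_integrand \<alpha> g z)"
    by (intro allI impI hankel_integrand_integrable_bounded_support[OF \<alpha> g])
  have Fi: "\<forall>z>0. integrable (\<mu> \<alpha>) (hankel_integrand \<alpha> (F n) z)" for n
    by (intro allI impI hankel_integrand_integrable_bounded_support[OF \<alpha> FL Fsupp])
  have Hg: "hankel_integral \<alpha> g \<in> sq_integrable (\<mu> \<alpha>)"
    by (rule hankel_integral_sq_integrable(2)[OF \<alpha> g(1) gi])
  show "(\<lambda>n. LINT z|\<mu> \<alpha>. hankel_integral \<alpha> g z * F n z) \<longlonglongrightarrow> (LINT z|\<mu> \<alpha>. hankel_integral \<alpha> g z * f z)"
    using sq_norm_tendsto_integral[OF FL f Hg Flim] by (simp add: mult.commute)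
  have "(LINT z|\<mu> \<alpha>. hankel_integral \<alpha> g z * F n z) = (LINT y|\<mu> \<alpha>. hankel \<alpha> (F n) y * g y)" for n
  proof -
    note H = hankel_integral_sq_integrable[OF \<alpha> FL Fi, of n]
    have "(LINT z|\<mu> \<alpha>. hankel_integral \<alpha> g z * F n z) = (LINT y|\<mu> \<alpha>. g y * hankel_integral \<alpha> (F n) y)"
      by (rule hankel_integral_symmetric_bounded_support[OF \<alpha> FL Fsupp g])
    also have "\<dots> = (LINT y|\<mu> \<alpha>. hankel \<alpha> (F n) y * g y)"
    proof (rule integral_cong_AE)
      show "AE y in \<mu> \<alpha>. g y * hankel_integral \<alpha> (F n) y = hankel \<alpha> (F n) y * g y"
        using H(1) by eventually_elim simp
    qed (intro borel_measurable_times sq_integrable_measurable g H(2) hankel_sq_integrable[OF \<alpha> FL])+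
    finally show ?thesis .
  qed
  moreover have "(\<lambda>n. LINT y|\<mu> \<alpha>. hankel \<alpha> (F n) y * g y) \<longlonglongrightarrow> (LINT y|\<mu> \<alpha>. hankel \<alpha> f y * g y)"
    by (rule sq_norm_tendsto_integral[OF hankel_sq_integrable[OF \<alpha> FL] hankel_sq_integrable[OF \<alpha> f] g(1)])
       (simp only: hankel_isometry[OF \<alpha> FL f] Flim)
  ultimately show "(\<lambda>n. LINT z|\<mu> \<alpha>. hankel_integral \<alpha> g z * F n z) \<longlonglongrightarrow> (LINT y|\<mu> \<alpha>. g y * hankel \<alpha> f y)"
    by (simp add: mult.commute)
qed

section \<open>Truncated kernels and their limit\<close>

lemma bessel_quot_bounded:
  assumes "\<nu> > -1/2"
  shows "\<exists>B\<ge>0. \<forall>s>0. \<bar>bessel_quot \<nu> s\<bar> \<le> B"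
proof -
  obtain B1 where B1: "B1 \<ge> 0" "\<And>s. 0 < s \<and> s \<le> 1 \<Longrightarrow> \<bar>bessel_quot \<nu> s\<bar> \<le> B1"
    using bessel_quot_bound_near_0[of \<nu>] assms by auto
  obtain B2 where B2: "B2 \<ge> 0" "\<And>s. s \<ge> 1 \<Longrightarrow> \<bar>bessel_quot \<nu> s\<bar> \<le> B2 * s powr (- \<nu> - 1/2)"
    using bessel_quot_bound_at_top[of \<nu> 1] assms by auto
  have "\<bar>bessel_quot \<nu> s\<bar> \<le> B1 + B2" if "s > 0" for s
  proof (cases "s \<le> 1")
    case True
    then show ?thesis using B1(2)[of s] B2(1) that by simp
  next
    case False
    have "s powr (- \<nu> - 1/2) \<le> s powr 0" using False assms by (intro powr_mono) auto
    then have "B2 * s powr (- \<nu> - 1/2) \<le> B2 * 1" using False B2(1) by (intro mult_left_mono) auto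
    then show ?thesis using B2(2)[of s] B1(1) False by linarith
  qed
  with B1(1) B2(1) show ?thesis by (intro exI[of _ "B1 + B2"]) auto
qed

lemma bessel_product_truncated_sq_integrable:
  assumes \<alpha>: "\<alpha> > -1" and \<nu>: "\<nu> > -1/2" and "t > 0" "x > 0"
  shows "(\<lambda>y. complex_of_real (indicator {0<..<r} y * (bessel_quot \<nu> (t * y) * bessel_quot \<alpha> (x * y)))) \<in> sq_integrable (\<mu> \<alpha>)"
proof -
  obtain B where B: "B \<ge> 0" "\<And>s. s > 0 \<Longrightarrow> \<bar>bessel_quot \<nu> s\<bar> \<le> B" using bessel_quot_bounded[OF \<nu>] by blast
  have "(\<lambda>y. complex_of_real (bessel_quot \<nu> (t * y)) * complex_of_real (indicator {0<..r} y * bessel_quot \<alpha> (x * y))) \<in> sq_integrable (\<mu> \<alpha>)"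
  proof (rule sq_integrable_mult_bounded[OF bessel_trunc_sq_integrable[OF \<alpha> \<alpha> \<open>x > 0\<close>]])
    show "(\<lambda>y. complex_of_real (bessel_quot \<nu> (t * y))) \<in> borel_measurable (\<mu> \<alpha>)"
      by (rule borel_measurable_mu) measurable
    show "cmod (complex_of_real (bessel_quot \<nu> (t * y))) \<le> B" if "y \<in> space (\<mu> \<alpha>)" for y
      using B(2)[of "t * y"] that \<open>t > 0\<close> by simp
  qed
  from truncate_sq_integrable[OF this, of r] show ?thesis
  proof (rule back_subst[where P="\<lambda>f. f \<in> sq_integrable (\<mu> \<alpha>)"])
    show "(\<lambda>y. indicator {0<..<r} y * (complex_of_real (bessel_quot \<nu> (t * y)) * complex_of_real (indicator {0<..r} y * bessel_quot \<alpha> (x * y))))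
      = (\<lambda>y. complex_of_real (indicator {0<..<r} y * (bessel_quot \<nu> (t * y) * bessel_quot \<alpha> (x * y))))"
      by (rule ext) (simp add: indicator_def)
  qed
qed

text \<open>With g the product of the factors in t and x, this exhibits the truncated kernel as a
  Hankel integral in z. It is the entry point for symmetry and isometry.\<close>

lemma hankel_integral_of_real_truncated:
  "hankel_integral \<alpha> (\<lambda>y. complex_of_real (indicator {0<..<r} y * g y)) z
    = complex_of_real (LINT y:{0<..<r}|\<mu> \<alpha>. g y * bessel_quot \<alpha> (z * y))"
  unfolding hankel_integral_def hankel_integrand_def set_lebesgue_integral_def
  by (subst integral_complex_of_real[symmetric]) (simp add: mult.assoc)

lemma singleton_null_mu:
  assumes "z > 0"
  shows "{z} \<in> sets (\<mu> \<alpha>)" "emeasure (\<mu> \<alpha>) {z} = 0"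
proof -
  show s: "{z} \<in> sets (\<mu> \<alpha>)"
    unfolding sets_mu by (subst sets_restrict_space_iff) (use assms in auto)
  have "AE y in \<mu> \<alpha>. \<not> (y = z)" unfolding AE_mu_iff using AE_lborel_singleton[of z] by eventually_elim simp
  from emeasure_eq_0_AE[OF this] have "emeasure (\<mu> \<alpha>) {y \<in> space (\<mu> \<alpha>). y = z} = 0" .
  moreover have "{y \<in> space (\<mu> \<alpha>). y = z} = {z}" using assms by auto
  ultimately show "emeasure (\<mu> \<alpha>) {z} = 0" by simp
qed

text \<open>A statement for one fixed x: the four integrability hypotheses and x \<noteq> t hold for
  almost every x and are selected outside. \<delta> is the largest exponent below both \<sigma> =
  \<alpha> + \<beta> + 1/2 and 1/2 that the oscillatory bound admits.\<close>

lemma kernel_integral_limit: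
  assumes \<alpha>: "\<alpha> > -1" and \<nu>: "\<alpha> + \<beta> > -1/2" and t: "t > 0" and x: "x > 0" and xt: "x \<noteq> t"
    and f: "f \<in> sq_integrable (\<mu> \<alpha>)" and \<delta>: "\<delta> = min (\<alpha> + \<beta> + 1/2) (1/2)"
    and sing: "integrable (\<mu> \<alpha>) (\<lambda>z. z powr (- \<alpha> - 1/2) * singular_bound \<delta> (z + x + t) * cmod (f z))"
      "integrable (\<mu> \<alpha>) (\<lambda>z. z powr (- \<alpha> - 1/2) * singular_bound \<delta> (z + x - t) * cmod (f z))"
      "integrable (\<mu> \<alpha>) (\<lambda>z. z powr (- \<alpha> - 1/2) * singular_bound \<delta> (z - x + t) * cmod (f z))"
      "integrable (\<mu> \<alpha>) (\<lambda>z. z powr (- \<alpha> - 1/2) * singular_bound \<delta> (z - x - t) * cmod (f z))"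
  defines "D \<equiv> \<lambda>r z. LINT y:{0<..<r}|\<mu> \<alpha>. bessel_quot (\<alpha> + \<beta>) (t * y) * bessel_quot \<alpha> (x * y) * bessel_quot \<alpha> (z * y)"
    and "m0 \<equiv> 2 powr (\<alpha> + \<beta>) * Gamma (\<alpha> + \<beta> + 1)"
  shows "integrable (\<mu> \<alpha>) (\<lambda>z. complex_of_real (kernel \<alpha> \<beta> t x z) * f z)"
    and "(\<lambda>n. complex_of_real m0 * (LINT z|\<mu> \<alpha>. complex_of_real (D (real n) z) * f z))
      \<longlonglongrightarrow> (LINT z|\<mu> \<alpha>. complex_of_real (kernel \<alpha> \<beta> t x z) * f z)"
proof -
  define \<nu>' where "\<nu>' = \<alpha> + \<beta>"
  have \<nu>1: "\<nu>' > -1/2" "\<nu>' > -1" using \<nu> by (auto simp: \<nu>'_def)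
  obtain \<rho>' c' where ph': "bessel_phase \<nu>' \<rho>' c'" using bessel_phase_exists[OF \<nu>1(2)] by blast
  obtain \<rho> c where ph: "bessel_phase \<alpha> \<rho> c" using bessel_phase_exists[OF \<alpha>] by blast
  define \<kappa> where "\<kappa> = \<rho>' * \<rho> * t powr (- \<nu>' - 1/2) * x powr (- \<alpha> - 1/2)"
  define p where "p = - \<nu>' - \<alpha> - 1"
  define \<sigma> where "\<sigma> = \<nu>' + 1/2"
  define \<theta> where "\<theta> = max 0 (- \<alpha> - 1/2)"
  have \<sigma>: "\<sigma> > 0" and p': "p = - \<sigma> - \<alpha> - 1/2" using \<nu>1 by (auto simp: \<sigma>_def p_def)
  have \<delta>': "0 < \<delta>" "\<delta> \<le> 1/2" "\<delta> \<le> \<sigma>" using \<nu> by (auto simp: \<delta> \<sigma>_def \<nu>'_def min_def)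
  define lead where "lead = leading_term p t c' x c \<kappa>"
  define g where "g y = bessel_quot \<nu>' (t * y) * bessel_quot \<alpha> (x * y)" for y
  define rem where "rem y = g y - lead y" for y
  have [measurable]: "lead \<in> borel_measurable borel" by (simp add: lead_def)
  have gm [measurable]: "g \<in> borel_measurable borel" unfolding g_def[abs_def] by measurable
  have rm [measurable]: "rem \<in> borel_measurable borel" unfolding rem_def[abs_def] by measurable
  obtain C where C: "C \<ge> 0" "\<And>y. y > 0 \<Longrightarrow> \<bar>rem y\<bar> \<le> C * (if y < 1 then 1 else y powr (p - 1))"
    using bessel_product_remainder_bound[OF \<alpha> \<nu>1(2) ph' ph t x \<kappa>_def p_def]
    unfolding rem_def g_def lead_def by blast
  define R where "R y = complex_of_real (rem y)" for y
  have RL: "R \<in> sq_integrable (\<mu> \<alpha>)" unfolding R_def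
    by (rule remainder_sq_integrable[OF \<alpha> \<nu>1(1) p_def rm C])
  have Rint: "\<forall>z>0. integrable (\<mu> \<alpha>) (hankel_integrand \<alpha> R z)"
    unfolding R_def by (intro allI impI remainder_hankel_integrable[OF \<alpha> \<nu>1(1) p_def rm C])
  define Pr where "Pr r z = (LINT y:{0<..<r}|\<mu> \<alpha>. rem y * bessel_quot \<alpha> (z * y))" for r z
  define Pinf where "Pinf z = (LINT y|\<mu> \<alpha>. rem y * bessel_quot \<alpha> (z * y))" for z
  define Lr where "Lr r z = (LINT y:{0<..<r}|\<mu> \<alpha>. lead y * bessel_quot \<alpha> (z * y))" for r z
  \<comment> \<open>The limit is taken along the integers to obtain a measurable function of z; off
    the exceptional points \<open>Llim\<close> shows that it is also the limit over real r.\<close>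
  define Linf where "Linf z = lim (\<lambda>n. Lr (real n) z)" for z
  have remint: "integrable (\<mu> \<alpha>) (\<lambda>y. rem y * bessel_quot \<alpha> (z * y))" if "z > 0" for z
  proof -
    have "integrable (\<mu> \<alpha>) (\<lambda>y. complex_of_real (rem y * bessel_quot \<alpha> (z * y)))"
      using Rint that by (simp add: hankel_integrand_def[abs_def] R_def)
    then show ?thesis by (subst (asm) complex_of_real_integrable_eq)
  qed
  have remint': "integrable (\<mu> \<alpha>) (\<lambda>y. indicator {0<..<r} y *\<^sub>R (rem y * bessel_quot \<alpha> (z * y)))" if "z > 0" for z r
    by (rule Bochner_Integration.integrable_bound[OF remint[OF that]])
       (auto simp: indicator_def intro!: borel_measurable_mu)
  have gint': "integrable (\<mu> \<alpha>) (\<lambda>y. indicator {0<..<r} y *\<^sub>R (g y * bessel_quot \<alpha> (z * y)))" if "z > 0" for z r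
  proof -
    have "integrable (\<mu> \<alpha>) (hankel_integrand \<alpha> (\<lambda>y. complex_of_real (indicator {0<..<r} y * g y)) z)"
      unfolding g_def
      by (rule hankel_integrand_integrable_bounded_support[OF \<alpha> bessel_product_truncated_sq_integrable[OF \<alpha> \<nu>1(1) t x] _ that, where N=r]) simp
    then have "integrable (\<mu> \<alpha>) (\<lambda>y. complex_of_real (indicator {0<..<r} y *\<^sub>R (g y * bessel_quot \<alpha> (z * y))))"
      by (simp add: hankel_integrand_def[abs_def] mult.assoc)
    then show ?thesis by (subst (asm) complex_of_real_integrable_eq)
  qed
  have Dsplit: "D r z = Pr r z + Lr r z" if z: "z > 0" for r z
  proof -
    have "D r z = (LINT y|\<mu> \<alpha>. indicator {0<..<r} y *\<^sub>R (g y * bessel_quot \<alpha> (z * y)))"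
      unfolding D_def set_lebesgue_integral_def g_def \<nu>'_def ..
    moreover have "Lr r z = (LINT y|\<mu> \<alpha>. indicator {0<..<r} y *\<^sub>R (g y * bessel_quot \<alpha> (z * y))
        - indicator {0<..<r} y *\<^sub>R (rem y * bessel_quot \<alpha> (z * y)))"
      unfolding Lr_def set_lebesgue_integral_def
      by (intro Bochner_Integration.integral_cong refl) (simp add: rem_def algebra_simps)
    ultimately show ?thesis
      using Bochner_Integration.integral_diff[OF gint'[OF z] remint'[OF z], of r r]
      by (simp add: Pr_def set_lebesgue_integral_def)
  qed
  \<comment> \<open>Limits over real r are needed here and in \<open>Llim\<close> because
    \<open>kernel\<close> is a limit at infinity over the reals. For the integrals against f,
    integer truncations will suffice.\<close>
  have Plim: "((\<lambda>r. Pr r z) \<longlongrightarrow> Pinf z) at_top" if z: "z > 0" for z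
    unfolding Pr_def Pinf_def set_lebesgue_integral_def
  proof (rule integral_dominated_convergence_at_top[OF _ _ integrable_norm[OF remint[OF z]]])
    show "\<forall>\<^sub>F r in at_top. AE y in \<mu> \<alpha>. norm (indicator {0<..<r} y *\<^sub>R (rem y * bessel_quot \<alpha> (z * y))) \<le> norm (rem y * bessel_quot \<alpha> (z * y))"
      by (intro always_eventually allI AE_I2) (auto simp: indicator_def)
    show "AE y in \<mu> \<alpha>. ((\<lambda>r. indicator {0<..<r} y *\<^sub>R (rem y * bessel_quot \<alpha> (z * y))) \<longlongrightarrow> rem y * bessel_quot \<alpha> (z * y)) at_top"
      by (rule AE_I2) (use truncate_tendsto[where 'a=real] in simp)
  qed (rule borel_measurable_mu, measurable)+
  obtain K where K: "K \<ge> 0" and KL: "\<And>z. z > 0 \<Longrightarrow> z \<noteq> x + t \<and> z \<noteq> x - t \<and> z \<noteq> t - x \<Longrightarrow>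
      (\<forall>r. \<bar>integral {1..r} (\<lambda>y. y powr - \<sigma> * (cos (t * y - c') * cos (x * y - c)) * bessel_osc \<alpha> (z * y))\<bar>
        \<le> K * (decay_bound \<theta> z + singular_bound \<delta> (z + x + t) + singular_bound \<delta> (z + x - t)
            + singular_bound \<delta> (z - x + t) + singular_bound \<delta> (z - x - t))) \<and>
      (\<exists>L. ((\<lambda>r. integral {1..r} (\<lambda>y. y powr - \<sigma> * (cos (t * y - c') * cos (x * y - c)) * bessel_osc \<alpha> (z * y))) \<longlongrightarrow> L) at_top)"
    using leading_oscillatory_integral[OF \<alpha> \<sigma> \<delta>' ph t x xt \<theta>_def, of c'] by blast
  \<comment> \<open>The points at which one of the frequencies vanishes; z + x + t is always
    positive. Restricting to the half-line makes the singletons measurable for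
    \<open>\<mu> \<alpha>\<close>.\<close>
  define bad where "bad = {x + t, x - t, t - x} \<inter> {0<..}"
  have good: "z \<noteq> x + t \<and> z \<noteq> x - t \<and> z \<noteq> t - x" if "z > 0" "z \<notin> bad" for z using that by (auto simp: bad_def)
  have Lr: "Lr r z = \<kappa> * z powr (- \<alpha> - 1/2) *
      integral {1..r} (\<lambda>y. y powr - \<sigma> * (cos (t * y - c') * cos (x * y - c)) * bessel_osc \<alpha> (z * y))" if "z > 0" for r z
    unfolding Lr_def lead_def by (rule leading_term_integral[OF \<alpha> p' that])
  \<comment> \<open>One majorant for all truncations of the leading part: the square integrable
    envelope is paired with f, and the singular terms are integrable by hypothesis.\<close>
  define W where "W z = \<bar>\<kappa>\<bar> * K * (z powr (- \<alpha> - 1/2) * decay_bound \<theta> z * cmod (f z)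
      + z powr (- \<alpha> - 1/2) * singular_bound \<delta> (z + x + t) * cmod (f z)
      + z powr (- \<alpha> - 1/2) * singular_bound \<delta> (z + x - t) * cmod (f z)
      + z powr (- \<alpha> - 1/2) * singular_bound \<delta> (z - x + t) * cmod (f z)
      + z powr (- \<alpha> - 1/2) * singular_bound \<delta> (z - x - t) * cmod (f z))" for z
  have Wint: "integrable (\<mu> \<alpha>) W"
  proof -
    have "integrable (\<mu> \<alpha>) (\<lambda>z. cmod (complex_of_real (z powr (- \<alpha> - 1/2) * decay_bound \<theta> z) * f z))"
      by (intro integrable_norm sq_integrable_mult_integrable decay_bound_sq_integrable[OF \<alpha> \<theta>_def] f)
    then have "integrable (\<mu> \<alpha>) (\<lambda>z. z powr (- \<alpha> - 1/2) * decay_bound \<theta> z * cmod (f z))"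
    proof (rule Bochner_Integration.integrable_cong[OF refl, THEN iffD1, rotated])
      fix z assume "z \<in> space (\<mu> \<alpha>)"
      then show "cmod (complex_of_real (z powr (- \<alpha> - 1/2) * decay_bound \<theta> z) * f z) = z powr (- \<alpha> - 1/2) * decay_bound \<theta> z * cmod (f z)"
        by (simp add: norm_mult decay_bound_def)
    qed
    then show ?thesis unfolding W_def
      by (intro integrable_mult_right Bochner_Integration.integrable_add sing)
  qed
  have Lbound: "cmod (complex_of_real (Lr r z) * f z) \<le> W z" if z: "z > 0" "z \<notin> bad" for r z
  proof -
    define S where "S = decay_bound \<theta> z + singular_bound \<delta> (z + x + t) + singular_bound \<delta> (z + x - t)
            + singular_bound \<delta> (z - x + t) + singular_bound \<delta> (z - x - t)"
    have "\<bar>Lr r z\<bar> \<le> \<bar>\<kappa>\<bar> * z powr (- \<alpha> - 1/2) * (K * S)"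
      unfolding Lr[OF z(1)] abs_mult S_def using KL[OF z(1) good[OF z]] by (intro mult_mono) auto
    then have "\<bar>Lr r z\<bar> * cmod (f z) \<le> \<bar>\<kappa>\<bar> * z powr (- \<alpha> - 1/2) * (K * S) * cmod (f z)"
      by (rule mult_right_mono) simp
    also have "\<dots> = W z" by (simp add: W_def S_def algebra_simps)
    finally show ?thesis by (simp add: norm_mult)
  qed
  have Llim: "((\<lambda>r. Lr r z) \<longlongrightarrow> Linf z) at_top" if z: "z > 0" "z \<notin> bad" for z
  proof -
    obtain L where "((\<lambda>r. integral {1..r} (\<lambda>y. y powr - \<sigma> * (cos (t * y - c') * cos (x * y - c)) * bessel_osc \<alpha> (z * y))) \<longlongrightarrow> L) at_top"
      using KL[OF z(1) good[OF z]] by blast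
    then have L: "((\<lambda>r. Lr r z) \<longlongrightarrow> \<kappa> * z powr (- \<alpha> - 1/2) * L) at_top"
      unfolding Lr[OF z(1)] by (intro tendsto_intros)
    have "Linf z = \<kappa> * z powr (- \<alpha> - 1/2) * L"
      unfolding Linf_def by (rule limI[OF filterlim_compose[OF L filterlim_real_sequentially]])
    with L show ?thesis by simp
  qed
  have ker: "kernel \<alpha> \<beta> t x z = m0 * (Pinf z + Linf z)" if z: "z > 0" "z \<notin> bad" for z
  proof -
    have "((\<lambda>r. D r z) \<longlongrightarrow> Pinf z + Linf z) at_top"
      unfolding Dsplit[OF z(1)] by (intro tendsto_add Plim Llim z)
    then have "Lim at_top (\<lambda>r. D r z) = Pinf z + Linf z" by (rule tendsto_Lim[OF trivial_limit_at_top_linorder])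
    then show ?thesis by (simp add: kernel_def D_def m0_def)
  qed
  have badnull: "{z} \<in> sets (\<mu> \<alpha>)" "emeasure (\<mu> \<alpha>) {z} = 0" if "z \<in> bad" for z
    using singleton_null_mu[of z \<alpha>] that by (auto simp: bad_def)
  have bad: "countable bad" by (auto simp: bad_def)
  have AEgood: "AE z in \<mu> \<alpha>. z \<notin> bad"
    by (rule AE_discrete_difference[OF bad]) (use badnull in auto)
  \<comment> \<open>Truncation in y commutes with passing to the remainder, so \<open>Pr\<close> at
    n is the Hankel integral of \<open>Rn n\<close>; mean-square convergence in y thus becomes
    mean-square convergence in z.\<close>
  define Rn where "Rn n y = complex_of_real (indicator {0<..<real n} y * rem y)" for n y
  have Rn: "Rn n y = indicator {0<..<real n} y * R y" for n y by (simp add: Rn_def R_def indicator_def)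
  have RnL: "Rn n \<in> sq_integrable (\<mu> \<alpha>)" for n
    unfolding Rn[abs_def] by (rule truncate_sq_integrable[OF RL])
  have Rnint: "\<forall>z>0. integrable (\<mu> \<alpha>) (hankel_integrand \<alpha> (Rn n) z)" for n
    by (intro allI impI hankel_integrand_integrable_bounded_support[OF \<alpha> RnL, where N="real n"]) (simp_all add: Rn_def)
  have Pn: "hankel_integral \<alpha> (Rn n) z = complex_of_real (Pr (real n) z)" for n z
    unfolding Rn_def Pr_def by (rule hankel_integral_of_real_truncated)
  have Pi: "hankel_integral \<alpha> R z = complex_of_real (Pinf z)" for z
    unfolding hankel_integral_def hankel_integrand_def R_def Pinf_def
    by (subst integral_complex_of_real[symmetric]) simp
  note HR = hankel_integral_sq_integrable(2)[OF \<alpha> RL Rint] and HRn = hankel_integral_sq_integrable(2)[OF \<alpha> RnL Rnint]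
  have Pconv: "(\<lambda>n. LINT z|\<mu> \<alpha>. complex_of_real (Pr (real n) z) * f z) \<longlonglongrightarrow> (LINT z|\<mu> \<alpha>. complex_of_real (Pinf z) * f z)"
  proof -
    have "(\<lambda>n. sq_norm (\<mu> \<alpha>) (\<lambda>z. hankel_integral \<alpha> (Rn n) z - hankel_integral \<alpha> R z)) \<longlonglongrightarrow> 0"
      unfolding sq_norm_hankel_integral_diff[OF \<alpha> RnL RL Rnint Rint] unfolding Rn
      by (rule truncate_sq_norm_tendsto[OF RL])
    from sq_norm_tendsto_integral[OF HRn HR f this] show ?thesis by (simp only: Pn Pi)
  qed
  have Pnint: "integrable (\<mu> \<alpha>) (\<lambda>z. complex_of_real (Pr (real n) z) * f z)" for n
    using sq_integrable_mult_integrable[OF HRn f] by (simp only: Pn)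
  have Pint: "integrable (\<mu> \<alpha>) (\<lambda>z. complex_of_real (Pinf z) * f z)"
    using sq_integrable_mult_integrable[OF HR f] by (simp only: Pi)
  have fm: "f \<in> borel_measurable (\<mu> \<alpha>)" by (rule sq_integrable_measurable[OF f])
  have Lnm: "(\<lambda>z. complex_of_real (Lr (real n) z)) \<in> borel_measurable (\<mu> \<alpha>)" for n
  proof -
    have "(\<lambda>y. complex_of_real (indicator {0<..<real n} y * lead y)) \<in> borel_measurable (\<mu> \<alpha>)"
      by (rule borel_measurable_mu) measurable
    from hankel_integral_measurable[OF this]
    show ?thesis unfolding hankel_integral_of_real_truncated[abs_def] Lr_def by simp
  qed
  have Lim: "(\<lambda>z. complex_of_real (Linf z)) \<in> borel_measurable (\<mu> \<alpha>)"
  proof -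
    have "(\<lambda>z. Re (complex_of_real (Lr (real n) z))) \<in> borel_measurable (\<mu> \<alpha>)" for n
      by (rule measurable_compose[OF Lnm]) simp
    then have "Linf \<in> borel_measurable (\<mu> \<alpha>)"
      unfolding Linf_def[abs_def] by (intro borel_measurable_lim_metric) simp
    then show ?thesis by (rule measurable_compose) simp
  qed
  have dom: "AE z in \<mu> \<alpha>. cmod (complex_of_real (Lr (real n) z) * f z) \<le> W z" for n
    using AEgood AE_space by eventually_elim (use Lbound in auto)
  have Lae: "AE z in \<mu> \<alpha>. (\<lambda>n. complex_of_real (Lr (real n) z) * f z) \<longlonglongrightarrow> complex_of_real (Linf z) * f z"
    using AEgood AE_space
  proof eventually_elim
    case (elim z)
    then have "(\<lambda>n. Lr (real n) z) \<longlonglongrightarrow> Linf z"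
      by (intro filterlim_compose[OF Llim filterlim_real_sequentially]) auto
    then show ?case by (intro tendsto_intros)
  qed
  have Lint: "integrable (\<mu> \<alpha>) (\<lambda>z. complex_of_real (Linf z) * f z)"
    by (rule integrable_dominated_convergence[OF borel_measurable_times[OF Lim fm] borel_measurable_times[OF Lnm fm] Wint Lae dom])
  have Lnint: "integrable (\<mu> \<alpha>) (\<lambda>z. complex_of_real (Lr (real n) z) * f z)" for n
    by (rule integrable_dominated_convergence2[OF borel_measurable_times[OF Lim fm] borel_measurable_times[OF Lnm fm] Wint Lae dom])
  have Lconv: "(\<lambda>n. LINT z|\<mu> \<alpha>. complex_of_real (Lr (real n) z) * f z) \<longlonglongrightarrow> (LINT z|\<mu> \<alpha>. complex_of_real (Linf z) * f z)"
    by (rule integral_dominated_convergence[OF borel_measurable_times[OF Lim fm] borel_measurable_times[OF Lnm fm] Wint Lae dom])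
  define Q where "Q z = complex_of_real m0 * (complex_of_real (Pinf z) * f z + complex_of_real (Linf z) * f z)" for z
  have Qint: "integrable (\<mu> \<alpha>) Q" unfolding Q_def
    by (intro integrable_mult_right Bochner_Integration.integrable_add Pint Lint)
  \<comment> \<open>On \<open>bad\<close> the limit in \<open>kernel\<close> need not exist, so
    nothing is known about its value there. Changing a function at finitely many null points
    preserves integrability and integral, which also spares a separate measurability proof for the
    kernel.\<close>
  have kerQ: "complex_of_real (kernel \<alpha> \<beta> t x z) * f z = Q z" if "z \<in> space (\<mu> \<alpha>)" "z \<notin> bad" for z
    using ker[of z] that by (simp add: Q_def algebra_simps)
  show "integrable (\<mu> \<alpha>) (\<lambda>z. complex_of_real (kernel \<alpha> \<beta> t x z) * f z)"
    by (rule integrable_discrete_difference[THEN iffD2, OF bad badnull(2) badnull(1) kerQ Qint])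
  have "(LINT z|\<mu> \<alpha>. complex_of_real (kernel \<alpha> \<beta> t x z) * f z) = (LINT z|\<mu> \<alpha>. Q z)"
    by (rule integral_discrete_difference[OF bad badnull(2) badnull(1) kerQ])
  also have "\<dots> = complex_of_real m0 * ((LINT z|\<mu> \<alpha>. complex_of_real (Pinf z) * f z) + (LINT z|\<mu> \<alpha>. complex_of_real (Linf z) * f z))"
    unfolding Q_def using Pint Lint by simp
  finally have lim_eq: "(LINT z|\<mu> \<alpha>. complex_of_real (kernel \<alpha> \<beta> t x z) * f z)
      = complex_of_real m0 * ((LINT z|\<mu> \<alpha>. complex_of_real (Pinf z) * f z) + (LINT z|\<mu> \<alpha>. complex_of_real (Linf z) * f z))" .
  have "(LINT z|\<mu> \<alpha>. complex_of_real (D (real n) z) * f z)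
      = (LINT z|\<mu> \<alpha>. complex_of_real (Pr (real n) z) * f z) + (LINT z|\<mu> \<alpha>. complex_of_real (Lr (real n) z) * f z)" for n
  proof -
    have "(LINT z|\<mu> \<alpha>. complex_of_real (D (real n) z) * f z)
        = (LINT z|\<mu> \<alpha>. complex_of_real (Pr (real n) z) * f z + complex_of_real (Lr (real n) z) * f z)"
      by (intro Bochner_Integration.integral_cong refl) (simp add: Dsplit distrib_right)
    then show ?thesis by (simp add: Bochner_Integration.integral_add[OF Pnint Lnint])
  qed
  then show "(\<lambda>n. complex_of_real m0 * (LINT z|\<mu> \<alpha>. complex_of_real (D (real n) z) * f z))
      \<longlonglongrightarrow> (LINT z|\<mu> \<alpha>. complex_of_real (kernel \<alpha> \<beta> t x z) * f z)"
    unfolding lim_eq by (simp only:) (intro tendsto_intros Pconv Lconv)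
qed

theorem corollary4p2:
  fixes \<alpha> \<beta> :: real
  assumes "\<alpha> > -1" and "\<alpha> + \<beta> > -1/2"
  shows "\<forall>t>0. \<forall>f \<in> L2 \<alpha>.
           f \<in> kernel_op_domain \<alpha> \<beta> t \<and>
           (AE x in \<mu> \<alpha>. multiplier_op \<alpha> \<beta> t f x = kernel_op \<alpha> \<beta> t f x)"
proof (intro allI ballI impI)
  fix t :: real and f assume t: "t > 0" and "f \<in> L2 \<alpha>"
  then have f: "f \<in> sq_integrable (\<mu> \<alpha>)" by (simp add: L2_eq_sq_integrable)
  define \<delta> where "\<delta> = min (\<alpha> + \<beta> + 1/2) (1/2)"
  have \<delta>: "\<delta> > 0" using assms by (simp add: \<delta>_def)
  define m0 where "m0 = 2 powr (\<alpha> + \<beta>) * Gamma (\<alpha> + \<beta> + 1)"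
  define D where "D x r z = (LINT y:{0<..<r}|\<mu> \<alpha>. bessel_quot (\<alpha> + \<beta>) (t * y) * bessel_quot \<alpha> (x * y) * bessel_quot \<alpha> (z * y))" for x r z
  \<comment> \<open>The four sign patterns are written as z + s * x + q with s equal to 1 or -1, the
    form in which almost every x was shown to be admissible.\<close>
  have "AE x in lborel. integrable (\<mu> \<alpha>) (\<lambda>z. z powr (- \<alpha> - 1/2) * singular_bound \<delta> (z + 1 * x + t) * cmod (f z))
      \<and> integrable (\<mu> \<alpha>) (\<lambda>z. z powr (- \<alpha> - 1/2) * singular_bound \<delta> (z + 1 * x + - t) * cmod (f z))
      \<and> integrable (\<mu> \<alpha>) (\<lambda>z. z powr (- \<alpha> - 1/2) * singular_bound \<delta> (z + -1 * x + t) * cmod (f z))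
      \<and> integrable (\<mu> \<alpha>) (\<lambda>z. z powr (- \<alpha> - 1/2) * singular_bound \<delta> (z + -1 * x + - t) * cmod (f z))
      \<and> x \<noteq> t"
    by (intro AE_conjI AE_singular_bound_integrable[OF f \<delta>] AE_lborel_singleton) simp_all
  then have main: "AE x in \<mu> \<alpha>. integrable (\<mu> \<alpha>) (\<lambda>z. complex_of_real (kernel \<alpha> \<beta> t x z) * f z) \<and>
     (\<lambda>n. complex_of_real m0 * (LINT z|\<mu> \<alpha>. complex_of_real (D x (real n) z) * f z)) \<longlonglongrightarrow> kernel_op \<alpha> \<beta> t f x"
    unfolding AE_mu_iff
  proof eventually_elim
    case (elim x)
    show ?case
    proof
      assume "0 < x"
      from kernel_integral_limit[OF assms t this _ f \<delta>_def] elim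
      show "integrable (\<mu> \<alpha>) (\<lambda>z. complex_of_real (kernel \<alpha> \<beta> t x z) * f z) \<and>
        (\<lambda>n. complex_of_real m0 * (LINT z|\<mu> \<alpha>. complex_of_real (D x (real n) z) * f z)) \<longlonglongrightarrow> kernel_op \<alpha> \<beta> t f x"
        by (simp add: D_def m0_def kernel_op_def)
    qed
  qed
  have dom: "f \<in> kernel_op_domain \<alpha> \<beta> t"
    unfolding kernel_op_domain_def mem_Collect_eq using main by eventually_elim simp
  define h where "h y = complex_of_real (multiplier \<alpha> \<beta> (t * y)) * hankel \<alpha> f y" for y
  have hfL: "hankel \<alpha> f \<in> sq_integrable (\<mu> \<alpha>)" by (rule hankel_sq_integrable[OF assms(1) f])
  obtain B where B: "B \<ge> 0" "\<And>s. s > 0 \<Longrightarrow> \<bar>bessel_quot (\<alpha> + \<beta>) s\<bar> \<le> B" using bessel_quot_bounded[OF assms(2)] by blast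
  have hL: "h \<in> sq_integrable (\<mu> \<alpha>)"
    unfolding h_def
  proof (rule sq_integrable_mult_bounded[OF hfL, where B="\<bar>m0\<bar> * B"])
    show "(\<lambda>y. complex_of_real (multiplier \<alpha> \<beta> (t * y))) \<in> borel_measurable (\<mu> \<alpha>)"
      unfolding multiplier_def by (rule borel_measurable_mu) measurable
    show "cmod (complex_of_real (multiplier \<alpha> \<beta> (t * y))) \<le> \<bar>m0\<bar> * B" if "y \<in> space (\<mu> \<alpha>)" for y
    proof -
      have "\<bar>m0\<bar> * \<bar>bessel_quot (\<alpha> + \<beta>) (t * y)\<bar> \<le> \<bar>m0\<bar> * B"
        using that t by (intro mult_left_mono B) auto
      moreover have "multiplier \<alpha> \<beta> (t * y) = m0 * bessel_quot (\<alpha> + \<beta>) (t * y)"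
        by (simp add: multiplier_def m0_def)
      ultimately show ?thesis by (simp only: norm_of_real abs_mult)
    qed
  qed
  define hn where "hn n y = indicator {0<..<real n} y * h y" for n y
  have hnL: "hn n \<in> sq_integrable (\<mu> \<alpha>)" for n unfolding hn_def by (rule truncate_sq_integrable[OF hL])
  have hnint: "\<forall>x>0. integrable (\<mu> \<alpha>) (hankel_integrand \<alpha> (hn n) x)" for n
    by (intro allI impI hankel_integrand_integrable_bounded_support[OF assms(1) hnL, where N="real n"]) (simp_all add: hn_def)
  \<comment> \<open>Symmetry moves the transform from f to the truncated product of Bessel
    functions, whose Hankel integral in z is the truncated kernel
    \<open>D x (real n)\<close>.\<close>
  have Wn: "hankel_integral \<alpha> (hn n) x = complex_of_real m0 * (LINT z|\<mu> \<alpha>. complex_of_real (D x (real n) z) * f z)"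
    if x: "x > 0" for n x
  proof -
    define G where "G y = complex_of_real (indicator {0<..<real n} y * (bessel_quot (\<alpha> + \<beta>) (t * y) * bessel_quot \<alpha> (x * y)))" for y
    have GL: "G \<in> sq_integrable (\<mu> \<alpha>)"
      unfolding G_def by (rule bessel_product_truncated_sq_integrable[OF assms t x])
    have "(LINT z|\<mu> \<alpha>. complex_of_real (D x (real n) z) * f z) = (LINT z|\<mu> \<alpha>. hankel_integral \<alpha> G z * f z)"
      unfolding G_def hankel_integral_of_real_truncated D_def ..
    also have "\<dots> = (LINT y|\<mu> \<alpha>. G y * hankel \<alpha> f y)"
      by (rule hankel_symmetric[OF assms(1) f GL, where N="real n"]) (simp add: G_def)
    also have "complex_of_real m0 * \<dots> = (LINT y|\<mu> \<alpha>. complex_of_real m0 * (G y * hankel \<alpha> f y))" by simp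
    also have "\<dots> = hankel_integral \<alpha> (hn n) x"
      unfolding hankel_integral_def hankel_integrand_def
      by (intro Bochner_Integration.integral_cong refl)
         (simp add: G_def hn_def h_def multiplier_def m0_def indicator_def)
    finally show ?thesis by simp
  qed
  \<comment> \<open>The same sequence has two limits: in mean square by the isometry, since the
    truncations of h converge to h, and pointwise almost everywhere by \<open>main\<close>.\<close>
  have "AE x in \<mu> \<alpha>. hankel \<alpha> h x = kernel_op \<alpha> \<beta> t f x"
  proof (rule sq_norm_limit_AE_unique[OF hankel_sq_integrable[OF assms(1) hnL] hankel_sq_integrable[OF assms(1) hL]])
    show "(\<lambda>n. sq_norm (\<mu> \<alpha>) (\<lambda>x. hankel \<alpha> (hn n) x - hankel \<alpha> h x)) \<longlonglongrightarrow> 0"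
      unfolding hankel_isometry[OF assms(1) hnL hL] hn_def by (rule truncate_sq_norm_tendsto[OF hL])
    \<comment> \<open>Each n has its own exceptional null set; countably many of them still form a
      null set.\<close>
    have "AE x in \<mu> \<alpha>. \<forall>n. hankel \<alpha> (hn n) x = hankel_integral \<alpha> (hn n) x"
      unfolding AE_all_countable using hankel_integral_sq_integrable(1)[OF assms(1) hnL hnint] by blast
    then show "AE x in \<mu> \<alpha>. (\<lambda>n. hankel \<alpha> (hn n) x) \<longlonglongrightarrow> kernel_op \<alpha> \<beta> t f x"
      using main AE_space by eventually_elim (simp add: Wn)
  qed
  then have "AE x in \<mu> \<alpha>. multiplier_op \<alpha> \<beta> t f x = kernel_op \<alpha> \<beta> t f x"
    unfolding multiplier_op_def h_def[abs_def] .
  with dom show "f \<in> kernel_op_domain \<alpha> \<beta> t \<and> (AE x in \<mu> \<alpha>. multiplier_op \<alpha> \<beta> t f x = kernel_op \<alpha> \<beta> t f x)" ..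
qed

end
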